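(* Assume $\lambda_k<\alpha<\lambda_{k+1}$. Then one of the following is true: 1. $m(\alpha,\beta)>0$ and $(\alpha,\beta)\notin\Sigma_K$ for all $\beta\ge\alpha$. 2. There is a unique $\beta(\alpha)>\lambda_{k+1}$ such that $m(\alpha,\beta(\alpha))=0$. Moreover, $(\alpha,\beta(\alpha))\in\Sigma_K$, but $(\alpha,\beta)\notin\Sigma_K$ if $\alpha\le\beta<\beta(\alpha)$.
   Context: Setting: $s\in(0,1)$, $n>2s$, $\Omega\subset\mathbb{R}^n$ is a bounded domain with Lipschitz boundary, and $u^\pm=\max\{\pm u,0\}$. The kernel $K:\mathbb{R}^n\setminus\{0\}\to(0,\infty)$ satisfies: $mK\in L^1(\mathbb{R}^n)$ with $m(x)=\min\{|x|^2,1\}$; there is $\lambda>0$ with $K(x)\ge\lambda|x|^{-(n+2s)}$; and $K(x)=K(-x)$. The operator is $\mathcal{L}_Ku(x)=\frac12\int_{\mathbb{R}^n}(u(x+y)+u(x-y)-2u(x))K(y)\,dy$. Spaces: $Q=\mathbb{R}^{2n}\setminus((\mathbb{R}^n\setminus\Omega)\times(\mathbb{R}^n\setminus\Omega))$. $X$ is the set of measurable $u:\mathbb{R}^n\to\mathbb{R}$ with $u|_\Omega\in L^2(\Omega)$ and $(u(x)-u(y))\sqrt{K(x-y)}\in L^2(Q)$. $X_0=\{u\in X: u=0\text{ a.e. in }\mathbb{R}^n\setminus\Omega\}$ is a Hilbert space with norm $\|u\|=\left(\int_Q|u(x)-u(y)|^2K(x-y)\,dx\,dy\right)^{1/2}$.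 $\|\cdot\|_{L^2}$ is the norm of $L^2(\Omega)$. Weak solution: $u\in X_0$ is a weak solution of $-\mathcal{L}_Ku=g$ in $\Omega$, $u=0$ on $\mathbb{R}^n\setminus\Omega$ (where $g$ may depend on $u$), if $\int_Q(u(x)-u(y))(v(x)-v(y))K(x-y)\,dx\,dy=\int_\Omega g\,v\,dx$ for all $v\in X_0$. The Fučík spectrum $\Sigma_K$ is the set of $(\alpha,\beta)\in\mathbb{R}^2$ such that $-\mathcal{L}_Ku=\alpha u^+-\beta u^-$ in $\Omega$, $u=0$ on $\mathbb{R}^n\setminus\Omega$, has a nontrivial weak solution. Eigenvalues: $0<\lambda_1<\lambda_2\le\lambda_3\le\cdots$ are the eigenvalues (counted with multiplicity) of $-\mathcal{L}_Ku=\lambda u$ in $\Omega$, $u=0$ on $\mathbb{R}^n\setminus\Omega$ (in the weak sense above), with eigenfunctions $\phi_1,\phi_2,\dots$ forming an orthonormal basis of $L^2(\Omega)$ and an orthogonal basis of $X_0$. $k\ge1$ is fixed with $\lambda_k<\lambda_{k+1}$; $X_1=\mathrm{span}\{\phi_1,\dots,\phi_k\}$ and $X_2=X_1^\perp$ in $X_0$. Let $J_{\alpha,\beta}(u)=\frac12\left(\|u\|^2-\alpha\int_\Omega|u^+|^2-\beta\int_\Omega|u^-|^2\right)$ on $X_0$ and, for $\lambda_k<\alpha<\lambda_{k+1}$, $\beta\ge\alpha$, let $$m(\alpha,\beta)=\min_{v\in X_2,\ \|v\|_{L^2}=1}\ \max_{u\in X_1}J_{\alpha,\beta}(u+v)$$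 (the max and min are attained). *)

theory Defs
  imports "HOL-Analysis.Analysis"
begin

section \<open>Domain and kernel\<close>

text \<open>
  Near every boundary point \<open>p\<close> the set is the strict epigraph, in some direction \<open>e\<close>, of a
  Lipschitz function on the hyperplane orthogonal to \<open>e\<close>. The choice of \<open>e\<close> plays the role of the
  rigid change of coordinates, and \<open>x - (x \<bullet> e) *\<^sub>R e\<close> that of the first \<open>n - 1\<close> coordinates.
\<close>

definition lipschitz_boundary :: "(real ^ 'n) set \<Rightarrow> bool" where
  "lipschitz_boundary \<Omega> \<longleftrightarrow>
     (\<forall>p \<in> frontier \<Omega>. \<exists>e r C \<gamma>. norm e = 1 \<and> 0 < r \<and> C-lipschitz_on {y. y \<bullet> e = 0} \<gamma> \<and>
        \<Omega> \<inter> ball p r = {x \<in> ball p r. \<gamma> (x - (x \<bullet> e) *\<^sub>R e) < x \<bullet> e})"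

definition bounded_lipschitz_domain :: "(real ^ 'n) set \<Rightarrow> bool" where
  "bounded_lipschitz_domain \<Omega> \<longleftrightarrow>
     open \<Omega> \<and> connected \<Omega> \<and> \<Omega> \<noteq> {} \<and> bounded \<Omega> \<and> lipschitz_boundary \<Omega>"

text \<open>
  Kernels are defined on the punctured space; the value \<open>K 0\<close> is arbitrary and never matters, since
  \<open>K (x - y)\<close> is always multiplied by a factor vanishing on the diagonal.
\<close>

definition admissible_kernel :: "real \<Rightarrow> (real ^ 'n \<Rightarrow> real) \<Rightarrow> bool" where
  "admissible_kernel s K \<longleftrightarrow>
     (\<forall>x. x \<noteq> 0 \<longrightarrow> 0 < K x) \<and>
     integrable lebesgue (\<lambda>x. min ((norm x)\<^sup>2) 1 * K x) \<and>
     (\<exists>\<theta>>0. \<forall>x. x \<noteq> 0 \<longrightarrow> \<theta> * norm x powr (- (real CARD('n) + 2 * s)) \<le> K x) \<and>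
     (\<forall>x. x \<noteq> 0 \<longrightarrow> K (- x) = K x)"


section \<open>Function spaces\<close>

text \<open>
  Elements of \<open>L\<^sup>2\<close>, \<open>X\<close> and \<open>X\<^sub>0\<close> are represented by functions rather than by classes modulo
  equality almost everywhere.
\<close>

definition L2_on :: "'a::euclidean_space set \<Rightarrow> ('a \<Rightarrow> real) set" where
  "L2_on S = {f. f \<in> borel_measurable (lebesgue_on S) \<and> integrable (lebesgue_on S) (\<lambda>x. (f x)\<^sup>2)}"

definition L2_inner :: "(real ^ 'n) set \<Rightarrow> (real ^ 'n \<Rightarrow> real) \<Rightarrow> (real ^ 'n \<Rightarrow> real) \<Rightarrow> real" where
  "L2_inner \<Omega> u v = (LINT x|lebesgue_on \<Omega>. u x * v x)"

definition L2_norm :: "(real ^ 'n) set \<Rightarrow> (real ^ 'n \<Rightarrow> real) \<Rightarrow> real" where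
  "L2_norm \<Omega> u = sqrt (LINT x|lebesgue_on \<Omega>. (u x)\<^sup>2)"

definition Q_set :: "(real ^ 'n) set \<Rightarrow> ((real ^ 'n) \<times> (real ^ 'n)) set" where
  "Q_set \<Omega> = UNIV - (UNIV - \<Omega>) \<times> (UNIV - \<Omega>)"

definition X_space :: "(real ^ 'n \<Rightarrow> real) \<Rightarrow> (real ^ 'n) set \<Rightarrow> (real ^ 'n \<Rightarrow> real) set" where
  "X_space K \<Omega> = {u. u \<in> borel_measurable lebesgue \<and> u \<in> L2_on \<Omega> \<and>
     (\<lambda>(x, y). (u x - u y) * sqrt (K (x - y))) \<in> L2_on (Q_set \<Omega>)}"

definition X0_space :: "(real ^ 'n \<Rightarrow> real) \<Rightarrow> (real ^ 'n) set \<Rightarrow> (real ^ 'n \<Rightarrow> real) set" where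
  "X0_space K \<Omega> = {u \<in> X_space K \<Omega>. AE x in lebesgue. x \<notin> \<Omega> \<longrightarrow> u x = 0}"

definition X0_inner ::
  "(real ^ 'n \<Rightarrow> real) \<Rightarrow> (real ^ 'n) set \<Rightarrow> (real ^ 'n \<Rightarrow> real) \<Rightarrow> (real ^ 'n \<Rightarrow> real) \<Rightarrow> real" where
  "X0_inner K \<Omega> u v =
     (LINT (x, y)|lebesgue_on (Q_set \<Omega>). (u x - u y) * (v x - v y) * K (x - y))"

definition X0_norm :: "(real ^ 'n \<Rightarrow> real) \<Rightarrow> (real ^ 'n) set \<Rightarrow> (real ^ 'n \<Rightarrow> real) \<Rightarrow> real" where
  "X0_norm K \<Omega> u = sqrt (LINT (x, y)|lebesgue_on (Q_set \<Omega>). \<bar>u x - u y\<bar>\<^sup>2 * K (x - y))"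


section \<open>Weak solutions and the Fucik spectrum\<close>

definition pos_part :: "('a \<Rightarrow> real) \<Rightarrow> 'a \<Rightarrow> real" where
  "pos_part u x = max (u x) 0"

definition neg_part :: "('a \<Rightarrow> real) \<Rightarrow> 'a \<Rightarrow> real" where
  "neg_part u x = max (- u x) 0"

text \<open>
  Weak solutions of \<open>- L\<^sub>K u = g\<close> in \<open>\<Omega>\<close>, \<open>u = 0\<close> outside \<open>\<Omega>\<close>, where
  \<open>L\<^sub>K u(x) = 1/2 \<integral> (u(x + y) + u(x - y) - 2 u(x)) K(y) dy\<close>. A right-hand side depending on \<open>u\<close>
  is obtained by letting \<open>g\<close> mention \<open>u\<close>. The form on the left carries no factor \<open>1/2\<close>.
\<close>

definition weak_solution ::
  "(real ^ 'n \<Rightarrow> real) \<Rightarrow> (real ^ 'n) set \<Rightarrow> (real ^ 'n \<Rightarrow> real) \<Rightarrow> (real ^ 'n \<Rightarrow> real) \<Rightarrow> bool" where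
  "weak_solution K \<Omega> g u \<longleftrightarrow> u \<in> X0_space K \<Omega> \<and>
     (\<forall>v \<in> X0_space K \<Omega>.
        (LINT (x, y)|lebesgue_on (Q_set \<Omega>). (u x - u y) * (v x - v y) * K (x - y)) =
        (LINT x|lebesgue_on \<Omega>. g x * v x))"

definition fucik_spectrum :: "(real ^ 'n \<Rightarrow> real) \<Rightarrow> (real ^ 'n) set \<Rightarrow> (real \<times> real) set" where
  "fucik_spectrum K \<Omega> = {(\<alpha>, \<beta>). \<exists>u.
     weak_solution K \<Omega> (\<lambda>x. \<alpha> * pos_part u x - \<beta> * neg_part u x) u \<and>
     \<not> (AE x in lebesgue. u x = 0)}"


section \<open>Eigenvalues and eigenfunctions\<close>

text \<open>
  Sequences are indexed from 1; the entry with index 0 is irrelevant. A basis is meant in the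
  Hilbert space sense: finite linear combinations are dense.
\<close>

definition orthogonal_basis ::
  "(('a \<Rightarrow> real) \<Rightarrow> ('a \<Rightarrow> real) \<Rightarrow> real) \<Rightarrow> ('a \<Rightarrow> real) set \<Rightarrow> (nat \<Rightarrow> 'a \<Rightarrow> real) \<Rightarrow> bool" where
  "orthogonal_basis ip V \<phi> \<longleftrightarrow>
     (\<forall>j\<ge>1. \<phi> j \<in> V \<and> 0 < ip (\<phi> j) (\<phi> j)) \<and>
     (\<forall>i\<ge>1. \<forall>j\<ge>1. i \<noteq> j \<longrightarrow> ip (\<phi> i) (\<phi> j) = 0) \<and>
     (\<forall>u \<in> V. \<forall>\<epsilon>>0. \<exists>N c. let w = (\<lambda>x. u x - (\<Sum>j=1..N. c j * \<phi> j x)) in sqrt (ip w w) < \<epsilon>)"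

definition orthonormal_basis ::
  "(('a \<Rightarrow> real) \<Rightarrow> ('a \<Rightarrow> real) \<Rightarrow> real) \<Rightarrow> ('a \<Rightarrow> real) set \<Rightarrow> (nat \<Rightarrow> 'a \<Rightarrow> real) \<Rightarrow> bool" where
  "orthonormal_basis ip V \<phi> \<longleftrightarrow> orthogonal_basis ip V \<phi> \<and> (\<forall>j\<ge>1. ip (\<phi> j) (\<phi> j) = 1)"

text \<open>
  That \<open>\<Lambda> 1, \<Lambda> 2, \<dots>\<close> lists all eigenvalues counted with multiplicity is the clause on \<open>\<mu>\<close>: each
  number occurs in the list finitely often, and the \<open>\<phi> j\<close> belonging to the occurrences of \<open>\<mu>\<close> span
  the space of weak solutions of \<open>- L\<^sub>K u = \<mu> u\<close>. If \<open>\<mu>\<close> does not occur, that space is thus trivial.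
\<close>

definition eigensystem ::
  "(real ^ 'n \<Rightarrow> real) \<Rightarrow> (real ^ 'n) set \<Rightarrow> (nat \<Rightarrow> real) \<Rightarrow> (nat \<Rightarrow> real ^ 'n \<Rightarrow> real) \<Rightarrow> bool" where
  "eigensystem K \<Omega> \<Lambda> \<phi> \<longleftrightarrow>
     0 < \<Lambda> 1 \<and> \<Lambda> 1 < \<Lambda> 2 \<and> (\<forall>j\<ge>2. \<Lambda> j \<le> \<Lambda> (Suc j)) \<and>
     (\<forall>j\<ge>1. weak_solution K \<Omega> (\<lambda>x. \<Lambda> j * \<phi> j x) (\<phi> j)) \<and>
     (\<forall>\<mu>. finite {j. 1 \<le> j \<and> \<Lambda> j = \<mu>} \<and>
        (\<forall>u. weak_solution K \<Omega> (\<lambda>x. \<mu> * u x) u \<longrightarrow>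
           (\<exists>c. AE x in lebesgue. u x = (\<Sum>j | 1 \<le> j \<and> \<Lambda> j = \<mu>. c j * \<phi> j x)))) \<and>
     orthonormal_basis (L2_inner \<Omega>) (L2_on \<Omega>) \<phi> \<and>
     orthogonal_basis (X0_inner K \<Omega>) (X0_space K \<Omega>) \<phi>"


section \<open>The functional and its minimax value\<close>

definition X1_space :: "(nat \<Rightarrow> 'a \<Rightarrow> real) \<Rightarrow> nat \<Rightarrow> ('a \<Rightarrow> real) set" where
  "X1_space \<phi> k = {u. \<exists>c. u = (\<lambda>x. \<Sum>j=1..k. c j * \<phi> j x)}"

definition X2_space ::
  "(real ^ 'n \<Rightarrow> real) \<Rightarrow> (real ^ 'n) set \<Rightarrow> (nat \<Rightarrow> real ^ 'n \<Rightarrow> real) \<Rightarrow> nat \<Rightarrow> (real ^ 'n \<Rightarrow> real) set" where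
  "X2_space K \<Omega> \<phi> k = {v \<in> X0_space K \<Omega>. \<forall>u \<in> X1_space \<phi> k. X0_inner K \<Omega> u v = 0}"

definition J_functional ::
  "(real ^ 'n \<Rightarrow> real) \<Rightarrow> (real ^ 'n) set \<Rightarrow> real \<Rightarrow> real \<Rightarrow> (real ^ 'n \<Rightarrow> real) \<Rightarrow> real" where
  "J_functional K \<Omega> \<alpha> \<beta> u = 1 / 2 * ((X0_norm K \<Omega> u)\<^sup>2
     - \<alpha> * (LINT x|lebesgue_on \<Omega>. \<bar>pos_part u x\<bar>\<^sup>2)
     - \<beta> * (LINT x|lebesgue_on \<Omega>. \<bar>neg_part u x\<bar>\<^sup>2))"

text \<open>
  \<open>GREATEST\<close> and \<open>LEAST\<close> are the maximum and minimum of sets of real numbers, meaningful when these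
  are attained, as is the case for \<open>\<lambda>\<^sub>k < \<alpha> < \<lambda>\<^sub>k\<^sub>+\<^sub>1\<close> and \<open>\<beta> \<ge> \<alpha>\<close>.
\<close>

definition minimax ::
  "(real ^ 'n \<Rightarrow> real) \<Rightarrow> (real ^ 'n) set \<Rightarrow> (nat \<Rightarrow> real ^ 'n \<Rightarrow> real) \<Rightarrow> nat \<Rightarrow> real \<Rightarrow> real \<Rightarrow> real" where
  "minimax K \<Omega> \<phi> k \<alpha> \<beta> =
     (LEAST a. \<exists>v \<in> X2_space K \<Omega> \<phi> k. L2_norm \<Omega> v = 1 \<and>
        a = (GREATEST b. \<exists>u \<in> X1_space \<phi> k. b = J_functional K \<Omega> \<alpha> \<beta> (\<lambda>x. u x + v x)))"

end

theory Submission
  imports Defs "HOL-Library.Function_Algebras"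
begin

text \<open>
Write \<open>|u|\<close> for the norm of \<open>L\<^sup>2(\<Omega>)\<close>, \<open>\<parallel>u\<parallel>\<close> for that of \<open>X\<^sub>0\<close>, \<open>J\<close> for \<open>J\<^sub>\<alpha>\<^sub>,\<^sub>\<beta>\<close>, and \<open>M(v)\<close> for
the maximum of \<open>J(u + v)\<close> over \<open>u \<in> X\<^sub>1\<close>; so \<open>m(\<alpha>, \<beta>)\<close> is the minimum of \<open>M\<close> over the unit
vectors of \<open>X\<^sub>2\<close>. Everything rests on one estimate. Since \<open>|w\<^sup>-|\<^sup>2\<close> is the squared distance to
the cone of nonnegative functions, it lies above its tangents by at most \<open>|h|\<^sup>2\<close>, and therefore
\<open>J(w + h) = J(w) + J'(w)h + R\<close> with \<open>(\<parallel>h\<parallel>\<^sup>2 - \<beta>|h|\<^sup>2)/2 \<le> R \<le> (\<parallel>h\<parallel>\<^sup>2 - \<alpha>|h|\<^sup>2)/2\<close> (lemma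
\<open>J_expansion\<close>). The upper form is negative on \<open>X\<^sub>1\<close>, because \<open>\<lambda>\<^sub>k < \<alpha>\<close>. So being critical in the
directions of \<open>X\<^sub>1\<close> is the same as being the maximum point over \<open>X\<^sub>1\<close>, and with the maximum
point \<open>u\<close> for \<open>v\<close> one gets \<open>M(v + h) \<le> M(v) + J'(u + v)h + (\<parallel>h\<parallel>\<^sup>2 - \<alpha>|h|\<^sup>2)/2\<close> for \<open>h \<in> X\<^sub>2\<close>
(lemma \<open>M_perturb\<close>).

If \<open>m = 0\<close> then \<open>M \<ge> 0\<close> on \<open>X\<^sub>2\<close> by homogeneity, with equality at a unit vector \<open>v\<close>; the last
inequality then forces \<open>J'(u + v) = 0\<close>, however \<open>u\<close> depends on \<open>v\<close>, and \<open>u + v\<close> is a nontrivial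
solution. Conversely a solution \<open>w = u + v\<close> satisfies \<open>M(v) = J(w) = J'(w)w/2 = 0\<close>, which for \<open>m
> 0\<close> is possible only if \<open>v = 0\<close>; but then \<open>J(w) < 0\<close> because \<open>w \<in> X\<^sub>1\<close>.

As a function of \<open>\<beta>\<close> the value \<open>m\<close> is nonincreasing and locally Lipschitz, so it remains to see
where it can vanish. It is positive for \<open>\<alpha> \<le> \<beta> \<le> \<lambda>\<^sub>k\<^sub>+\<^sub>1\<close>: at a zero the minimizer would be a
nonpositive function orthogonal to \<open>\<phi>\<^sub>1\<close>. Such functions do not exist, since the nonlocal form
is strictly negative on pairs of nontrivial nonnegative functions with disjoint supports (lemma
\<open>disjoint_nonneg_form\<close>); this first makes \<open>\<phi>\<^sub>1\<close> one-signed and then excludes the orthogonality.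
The zero is unique: if \<open>m(\<beta>\<^sub>1) = 0\<close> and \<open>m(\<beta>\<^sub>2) \<ge> 0\<close> with \<open>\<beta>\<^sub>1 < \<beta>\<^sub>2\<close>, comparing both
functionals at the same point yields a solution \<open>w\<close> with \<open>w\<^sup>- = 0\<close>, that is, an eigenfunction
for \<open>\<alpha>\<close>, whereas \<open>\<lambda>\<^sub>k < \<alpha> < \<lambda>\<^sub>k\<^sub>+\<^sub>1\<close>.

The minimum exists because \<open>X\<^sub>0\<close> embeds compactly into \<open>L\<^sup>2(\<Omega>)\<close>. As the \<open>\<phi>\<^sub>j\<close> are orthogonal for
both inner products, compactness follows from two facts: \<open>\<lambda>\<^sub>j \<rightarrow> \<infinity>\<close>, because concentrating bump
functions have unbounded Rayleigh quotient (lemma \<open>rayleigh_quotient_unbounded\<close>), and \<open>L\<^sup>2\<close>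
limits of sequences of bounded energy have finite energy (lemma \<open>X0_closed\<close>, by Fatou's lemma).

The variational argument uses only the two forms, the eigenbasis and the positive part, and is
carried out over an arbitrary real vector space.
\<close>

section \<open>Two quadratic forms with a common eigenbasis\<close>

lemma slope_zero_if_quadratic_nonneg:
  fixes a b :: real
  assumes "\<And>t. 0 \<le> t * a + t\<^sup>2 * b"
  shows "a = 0"
proof (rule ccontr)
  assume "a \<noteq> 0"
  define d where "d = \<bar>b\<bar> + 1"
  then have d: "d > 0" "\<bar>b\<bar> = d - 1" by simp_all
  define t where "t = - a / d"
  have "t * a + t\<^sup>2 * b \<le> t * a + t\<^sup>2 * \<bar>b\<bar>"
    by (simp add: mult_left_mono)
  also have "\<dots> = - (a\<^sup>2 / d\<^sup>2)"
    unfolding t_def d(2) using d(1) by (simp add: field_simps power2_eq_square)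
  also have "\<dots> < 0" using \<open>a \<noteq> 0\<close> d by simp
  finally show False using assms[of t] by linarith
qed

lemma square_diff_le_double: "(a - b)\<^sup>2 \<le> 2 * a\<^sup>2 + 2 * b\<^sup>2" for a b :: real
  using zero_le_power2[of "a + b"] by (simp add: power2_eq_square algebra_simps)

text \<open>
Tychonoff's theorem. Real sequences with pointwise convergence form a metrizable space, so the
cube is sequentially compact as well, which does the work of a diagonal subsequence.
\<close>

lemma compact_cube: "compact (PiE UNIV (\<lambda>j::nat. {- S..S :: real}))"
  using compactin_PiE[of "\<lambda>_. euclidean" UNIV "\<lambda>j::nat. {- S..S}"]
  by (simp add: euclidean_product_topology)

text \<open>
Functions that agree almost everywhere are not identified, so the forms are only semidefinite;
and the integrals defining them are additive only on the subspace where they converge.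
\<close>

locale semi_inner =
  fixes V :: "'a::real_vector set" and B :: "'a \<Rightarrow> 'a \<Rightarrow> real"
  assumes V: "subspace V"
    and commute: "u \<in> V \<Longrightarrow> v \<in> V \<Longrightarrow> B u v = B v u"
    and add_left: "u \<in> V \<Longrightarrow> v \<in> V \<Longrightarrow> w \<in> V \<Longrightarrow> B (u + v) w = B u w + B v w"
    and scale_left: "u \<in> V \<Longrightarrow> w \<in> V \<Longrightarrow> B (c *\<^sub>R u) w = c * B u w"
    and nonneg: "u \<in> V \<Longrightarrow> 0 \<le> B u u"
begin

lemma V_add [intro, simp]: "u \<in> V \<Longrightarrow> v \<in> V \<Longrightarrow> u + v \<in> V"
  and V_scale [intro, simp]: "u \<in> V \<Longrightarrow> c *\<^sub>R u \<in> V"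
  and V_diff [intro, simp]: "u \<in> V \<Longrightarrow> v \<in> V \<Longrightarrow> u - v \<in> V"
  and V_minus [intro, simp]: "u \<in> V \<Longrightarrow> - u \<in> V"
  and V_0 [intro, simp]: "0 \<in> V"
  using V by (auto simp: subspace_add subspace_scale subspace_diff subspace_neg subspace_0)

lemma V_sum [intro]: "(\<And>i. i \<in> A \<Longrightarrow> f i \<in> V) \<Longrightarrow> sum f A \<in> V"
  using V by (rule subspace_sum)

lemma zero_left [simp]: "w \<in> V \<Longrightarrow> B 0 w = 0"
  using scale_left[of 0 w 0] by simp

lemma minus_left: "u \<in> V \<Longrightarrow> w \<in> V \<Longrightarrow> B (- u) w = - B u w"
  using scale_left[of u w "-1"] by simp

lemma diff_left: "u \<in> V \<Longrightarrow> v \<in> V \<Longrightarrow> w \<in> V \<Longrightarrow> B (u - v) w = B u w - B v w"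
  using add_left[of u "- v" w] minus_left[of v w] by simp

lemma add_right: "u \<in> V \<Longrightarrow> v \<in> V \<Longrightarrow> w \<in> V \<Longrightarrow> B w (u + v) = B w u + B w v"
  by (simp add: commute[of w] add_left)

lemma scale_right: "u \<in> V \<Longrightarrow> w \<in> V \<Longrightarrow> B w (c *\<^sub>R u) = c * B w u"
  by (simp add: commute[of w] scale_left)

lemma minus_right: "u \<in> V \<Longrightarrow> w \<in> V \<Longrightarrow> B w (- u) = - B w u"
  by (simp add: commute[of w] minus_left)

lemma diff_right: "u \<in> V \<Longrightarrow> v \<in> V \<Longrightarrow> w \<in> V \<Longrightarrow> B w (u - v) = B w u - B w v"
  by (simp add: commute[of w] diff_left)

lemma sum_left:
  "(\<And>i. i \<in> A \<Longrightarrow> f i \<in> V) \<Longrightarrow> w \<in> V \<Longrightarrow> B (sum f A) w = (\<Sum>i\<in>A. B (f i) w)"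
  by (induction A rule: infinite_finite_induct) (auto simp: add_left V_sum)

lemmas bilin = add_left add_right diff_left diff_right scale_left scale_right
  minus_left minus_right

lemma square_add: "u \<in> V \<Longrightarrow> v \<in> V \<Longrightarrow> B (u + v) (u + v) = B u u + 2 * B u v + B v v"
  by (simp add: bilin commute[of v u])

lemma square_diff: "u \<in> V \<Longrightarrow> v \<in> V \<Longrightarrow> B (u - v) (u - v) = B u u - 2 * B u v + B v v"
  by (simp add: bilin commute[of v u])

lemma square_scale: "u \<in> V \<Longrightarrow> B (c *\<^sub>R u) (c *\<^sub>R u) = c\<^sup>2 * B u u"
  by (simp add: bilin power2_eq_square)

lemma square_diff_le: "u \<in> V \<Longrightarrow> v \<in> V \<Longrightarrow> B (u - v) (u - v) \<le> 2 * B u u + 2 * B v v"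
  using square_diff[of u v] square_add[of u v] nonneg[of "u + v"] by simp

lemma cauchy_schwarz:
  assumes u: "u \<in> V" and v: "v \<in> V"
  shows "(B u v)\<^sup>2 \<le> B u u * B v v"
proof (cases "B v v = 0")
  case True
  have "0 \<le> t * (2 * B u v) + t\<^sup>2 * 0 + B u u" for t
    using nonneg[of "u + t *\<^sub>R v"] u v True by (simp add: square_add square_scale scale_right scale_left)
  from this[of "- (B u u + 1) / (2 * B u v)"] have "B u v = 0"
    by (cases "B u v = 0") auto
  with True show ?thesis by simp
next
  case False
  then have pos: "B v v > 0" using nonneg[OF v] by simp
  have "0 \<le> B (B v v *\<^sub>R u - B u v *\<^sub>R v) (B v v *\<^sub>R u - B u v *\<^sub>R v)"
    using u v by (intro nonneg) auto
  also have "\<dots> = B v v * (B u u * B v v - (B u v)\<^sup>2)"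
    using u v by (simp add: square_diff bilin commute[of v u] algebra_simps power2_eq_square)
  finally show ?thesis using pos by (simp add: zero_le_mult_iff)
qed

lemma null_left: "u \<in> V \<Longrightarrow> v \<in> V \<Longrightarrow> B u u = 0 \<Longrightarrow> B u v = 0"
  using cauchy_schwarz[of u v] by simp

lemma null_right: "u \<in> V \<Longrightarrow> v \<in> V \<Longrightarrow> B u u = 0 \<Longrightarrow> B v u = 0"
  by (metis null_left commute)

end

text \<open>
\<open>E\<close> stands for the energy form of \<open>X\<^sub>0\<close> and \<open>I\<close> for the inner product of \<open>L\<^sup>2(\<Omega>)\<close>. The
eigenvalue equation makes the vectors \<open>\<phi> j\<close> orthogonal for \<open>E\<close> too, so that a vector has the
same Fourier coefficients with respect to both forms.
\<close>

locale eigenbasis = E: semi_inner V E + I: semi_inner V I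
  for V :: "'a::real_vector set" and E I :: "'a \<Rightarrow> 'a \<Rightarrow> real" +
  fixes \<Lambda> :: "nat \<Rightarrow> real" and \<phi> :: "nat \<Rightarrow> 'a"
  assumes \<phi>_V: "1 \<le> j \<Longrightarrow> \<phi> j \<in> V"
    and eigen: "1 \<le> j \<Longrightarrow> u \<in> V \<Longrightarrow> E (\<phi> j) u = \<Lambda> j * I (\<phi> j) u"
    and orthonormal: "1 \<le> i \<Longrightarrow> 1 \<le> j \<Longrightarrow> I (\<phi> i) (\<phi> j) = (if i = j then 1 else 0)"
    and dense_I: "u \<in> V \<Longrightarrow> \<epsilon> > 0 \<Longrightarrow>
      \<exists>N c. I (u - (\<Sum>j=1..N. c j *\<^sub>R \<phi> j)) (u - (\<Sum>j=1..N. c j *\<^sub>R \<phi> j)) < \<epsilon>"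
    and dense_E: "u \<in> V \<Longrightarrow> \<epsilon> > 0 \<Longrightarrow>
      \<exists>N c. E (u - (\<Sum>j=1..N. c j *\<^sub>R \<phi> j)) (u - (\<Sum>j=1..N. c j *\<^sub>R \<phi> j)) < \<epsilon>"
    and \<Lambda>_pos: "0 < \<Lambda> 1"
    and \<Lambda>_mono: "1 \<le> i \<Longrightarrow> i \<le> j \<Longrightarrow> \<Lambda> i \<le> \<Lambda> j"
begin

definition coef :: "nat \<Rightarrow> 'a \<Rightarrow> real" where
  "coef j u = I (\<phi> j) u"

definition comb :: "nat \<Rightarrow> (nat \<Rightarrow> real) \<Rightarrow> 'a" where
  "comb N c = (\<Sum>j=1..N. c j *\<^sub>R \<phi> j)"

lemma \<Lambda>_pos': "1 \<le> j \<Longrightarrow> 0 < \<Lambda> j"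
  using \<Lambda>_pos \<Lambda>_mono[of 1 j] by simp

lemma comb_V [intro, simp]: "comb N c \<in> V"
  unfolding comb_def using \<phi>_V by (auto intro!: E.V_sum)

lemma coef_bilin:
  "1 \<le> j \<Longrightarrow> u \<in> V \<Longrightarrow> v \<in> V \<Longrightarrow> coef j (u + v) = coef j u + coef j v"
  "1 \<le> j \<Longrightarrow> u \<in> V \<Longrightarrow> v \<in> V \<Longrightarrow> coef j (u - v) = coef j u - coef j v"
  "1 \<le> j \<Longrightarrow> u \<in> V \<Longrightarrow> coef j (t *\<^sub>R u) = t * coef j u"
  using \<phi>_V by (simp_all add: coef_def I.bilin)

lemma I_comb: assumes "u \<in> V" shows "I (comb N c) u = (\<Sum>j=1..N. c j * coef j u)"
proof -
  have "I (comb N c) u = (\<Sum>j=1..N. I (c j *\<^sub>R \<phi> j) u)"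
    unfolding comb_def using assms by (intro I.sum_left) (simp_all add: \<phi>_V)
  then show ?thesis using assms by (simp add: coef_def I.scale_left \<phi>_V)
qed

lemma E_comb: assumes "u \<in> V" shows "E (comb N c) u = (\<Sum>j=1..N. \<Lambda> j * c j * coef j u)"
proof -
  have "E (comb N c) u = (\<Sum>j=1..N. E (c j *\<^sub>R \<phi> j) u)"
    unfolding comb_def using assms by (intro E.sum_left) (simp_all add: \<phi>_V)
  then show ?thesis using assms by (simp add: coef_def E.scale_left \<phi>_V eigen mult.commute mult.left_commute)
qed

lemma coef_comb: "1 \<le> i \<Longrightarrow> coef i (comb N c) = (if i \<le> N then c i else 0)"
proof -
  assume i: "1 \<le> i"
  have "coef i (comb N c) = I (comb N c) (\<phi> i)"
    unfolding coef_def using i \<phi>_V by (intro I.commute) auto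
  also have "\<dots> = (\<Sum>j=1..N. c j * coef j (\<phi> i))"
    using i \<phi>_V by (intro I_comb) auto
  also have "\<dots> = (\<Sum>j=1..N. if j = i then c j else 0)"
    using i by (intro sum.cong) (auto simp: coef_def orthonormal)
  finally show ?thesis using i by simp
qed

lemma I_comb_comb: "I (comb N c) (comb N c) = (\<Sum>j=1..N. (c j)\<^sup>2)"
  by (subst I_comb[OF comb_V], rule sum.cong) (simp_all add: coef_comb power2_eq_square)

lemma E_comb_comb: "E (comb N c) (comb N c) = (\<Sum>j=1..N. \<Lambda> j * (c j)\<^sup>2)"
  by (subst E_comb[OF comb_V], rule sum.cong) (simp_all add: coef_comb power2_eq_square)

lemma coef_minus_projection:
  "u \<in> V \<Longrightarrow> 1 \<le> j \<Longrightarrow> coef j (u - comb N (\<lambda>i. coef i u)) = (if j \<le> N then 0 else coef j u)"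
  by (simp add: coef_bilin coef_comb)

text \<open>
Completing squares: the combination closest to \<open>u\<close> is the one with the Fourier coefficients of
\<open>u\<close>.
\<close>

lemma E_minus_comb:
  assumes "u \<in> V"
  shows "E (u - comb N c) (u - comb N c)
    = E u u - (\<Sum>j=1..N. \<Lambda> j * (coef j u)\<^sup>2) + (\<Sum>j=1..N. \<Lambda> j * (coef j u - c j)\<^sup>2)"
proof -
  have "E (u - comb N c) (u - comb N c)
    = E u u - 2 * (\<Sum>j=1..N. \<Lambda> j * c j * coef j u) + (\<Sum>j=1..N. \<Lambda> j * (c j)\<^sup>2)"
    using assms by (simp add: E.square_diff E_comb_comb E_comb E.commute[of u "comb N c"])
  also have "(\<Sum>j=1..N. \<Lambda> j * (c j)\<^sup>2) = (\<Sum>j=1..N. \<Lambda> j * (coef j u - c j)\<^sup>2)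
      - (\<Sum>j=1..N. \<Lambda> j * (coef j u)\<^sup>2) + 2 * (\<Sum>j=1..N. \<Lambda> j * c j * coef j u)"
    unfolding sum_distrib_left sum_subtractf[symmetric] sum.distrib[symmetric]
    by (intro sum.cong) (simp_all add: power2_eq_square algebra_simps)
  finally show ?thesis by simp
qed

lemma I_minus_comb:
  assumes "u \<in> V"
  shows "I (u - comb N c) (u - comb N c)
    = I u u - (\<Sum>j=1..N. (coef j u)\<^sup>2) + (\<Sum>j=1..N. (coef j u - c j)\<^sup>2)"
proof -
  have "I (u - comb N c) (u - comb N c)
    = I u u - 2 * (\<Sum>j=1..N. c j * coef j u) + (\<Sum>j=1..N. (c j)\<^sup>2)"
    using assms by (simp add: I.square_diff I_comb_comb I_comb I.commute[of u "comb N c"])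
  also have "(\<Sum>j=1..N. (c j)\<^sup>2) = (\<Sum>j=1..N. (coef j u - c j)\<^sup>2)
      - (\<Sum>j=1..N. (coef j u)\<^sup>2) + 2 * (\<Sum>j=1..N. c j * coef j u)"
    unfolding sum_distrib_left sum_subtractf[symmetric] sum.distrib[symmetric]
    by (intro sum.cong) (simp_all add: power2_eq_square algebra_simps)
  finally show ?thesis by simp
qed

lemma bessel_I: "u \<in> V \<Longrightarrow> (\<Sum>j=1..N. (coef j u)\<^sup>2) \<le> I u u"
  using I_minus_comb[of u N "\<lambda>j. coef j u"] I.nonneg[of "u - comb N (\<lambda>j. coef j u)"] by simp

lemma bessel_E: "u \<in> V \<Longrightarrow> (\<Sum>j=1..N. \<Lambda> j * (coef j u)\<^sup>2) \<le> E u u"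
  using E_minus_comb[of u N "\<lambda>j. coef j u"] E.nonneg[of "u - comb N (\<lambda>j. coef j u)"] by simp

lemma parseval_I: "u \<in> V \<Longrightarrow> (\<lambda>N. \<Sum>j=1..N. (coef j u)\<^sup>2) \<longlonglongrightarrow> I u u"
proof (rule LIMSEQ_I)
  fix r :: real assume u: "u \<in> V" and r: "r > 0"
  from dense_I[OF u r] obtain N c where Nc: "I (u - comb N c) (u - comb N c) < r"
    unfolding comb_def by blast
  have "norm ((\<Sum>j=1..n. (coef j u)\<^sup>2) - I u u) < r" if "N \<le> n" for n
  proof -
    have "(\<Sum>j=1..N. (coef j u)\<^sup>2) \<le> (\<Sum>j=1..n. (coef j u)\<^sup>2)"
      using that by (intro sum_mono2) auto
    moreover have "0 \<le> (\<Sum>j=1..N. (coef j u - c j)\<^sup>2)" by (intro sum_nonneg) auto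
    ultimately show ?thesis
      using bessel_I[OF u, of n] Nc I_minus_comb[OF u, of N c] by simp
  qed
  then show "\<exists>N. \<forall>n\<ge>N. norm ((\<Sum>j=1..n. (coef j u)\<^sup>2) - I u u) < r" by blast
qed

lemma parseval_E: "u \<in> V \<Longrightarrow> (\<lambda>N. \<Sum>j=1..N. \<Lambda> j * (coef j u)\<^sup>2) \<longlonglongrightarrow> E u u"
proof (rule LIMSEQ_I)
  fix r :: real assume u: "u \<in> V" and r: "r > 0"
  from dense_E[OF u r] obtain N c where Nc: "E (u - comb N c) (u - comb N c) < r"
    unfolding comb_def by blast
  have "norm ((\<Sum>j=1..n. \<Lambda> j * (coef j u)\<^sup>2) - E u u) < r" if "N \<le> n" for n
  proof -
    have "(\<Sum>j=1..N. \<Lambda> j * (coef j u)\<^sup>2) \<le> (\<Sum>j=1..n. \<Lambda> j * (coef j u)\<^sup>2)"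
      using that \<Lambda>_pos' by (intro sum_mono2) (auto simp: less_imp_le)
    moreover have "0 \<le> (\<Sum>j=1..N. \<Lambda> j * (coef j u - c j)\<^sup>2)"
      using \<Lambda>_pos' by (intro sum_nonneg) (auto simp: less_imp_le)
    ultimately show ?thesis
      using bessel_E[OF u, of n] Nc E_minus_comb[OF u, of N c] by simp
  qed
  then show "\<exists>N. \<forall>n\<ge>N. norm ((\<Sum>j=1..n. \<Lambda> j * (coef j u)\<^sup>2) - E u u) < r" by blast
qed

lemma rayleigh_lower:
  assumes u: "u \<in> V" and 0: "\<And>j. j \<in> {1..k} \<Longrightarrow> coef j u = 0"
  shows "\<Lambda> (k + 1) * I u u \<le> E u u"
proof (rule LIMSEQ_le[OF tendsto_mult_left[OF parseval_I[OF u]] parseval_E[OF u]])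
  have "\<Lambda> (k + 1) * (coef j u)\<^sup>2 \<le> \<Lambda> j * (coef j u)\<^sup>2" if "1 \<le> j" for j
    using that 0[of j] \<Lambda>_mono[of "k + 1" j]
    by (cases "j \<le> k") (auto intro: mult_right_mono)
  then show "\<exists>N. \<forall>n\<ge>N. \<Lambda> (k + 1) * (\<Sum>j=1..n. (coef j u)\<^sup>2)
      \<le> (\<Sum>j=1..n. \<Lambda> j * (coef j u)\<^sup>2)"
    by (auto simp: sum_distrib_left intro!: sum_mono)
qed

lemma poincare: "u \<in> V \<Longrightarrow> \<Lambda> 1 * I u u \<le> E u u"
  using rayleigh_lower[of u 0] by simp

text \<open>
If the eigenvalues were bounded, the energy would be controlled by the \<open>L\<^sup>2\<close> norm; refuting this
for the concrete form is how the eigenvalues are shown to be unbounded.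
\<close>

lemma rayleigh_upper:
  assumes u: "u \<in> V" and M: "\<And>j. 1 \<le> j \<Longrightarrow> \<Lambda> j \<le> M"
  shows "E u u \<le> M * I u u"
  by (rule LIMSEQ_le[OF parseval_E[OF u] tendsto_mult_left[OF parseval_I[OF u]]])
    (use M in \<open>auto simp: sum_distrib_left intro!: sum_mono mult_right_mono\<close>)

lemma null_if_coef_zero:
  assumes u: "u \<in> V" and 0: "\<And>j. 1 \<le> j \<Longrightarrow> coef j u = 0"
  shows "I u u = 0"
proof -
  have "(\<lambda>N. \<Sum>j=1..N. (coef j u)\<^sup>2) = (\<lambda>N. 0)" using 0 by auto
  with parseval_I[OF u] show ?thesis using LIMSEQ_unique tendsto_const by metis
qed

text \<open>
Vectors that vanish almost everywhere have no energy, because Parseval's identity sees only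
their coefficients.
\<close>

lemma E_null:
  assumes u: "u \<in> V" and 0: "I u u = 0"
  shows "E u u = 0"
proof -
  have "coef j u = 0" if "1 \<le> j" for j
    unfolding coef_def using I.null_right[OF u \<phi>_V[OF that] 0] .
  then have "(\<lambda>N. \<Sum>j=1..N. \<Lambda> j * (coef j u)\<^sup>2) = (\<lambda>N. 0)" by auto
  with parseval_E[OF u] show ?thesis using LIMSEQ_unique tendsto_const by metis
qed

lemma coef_square_le: "1 \<le> j \<Longrightarrow> u \<in> V \<Longrightarrow> (coef j u)\<^sup>2 \<le> I u u"
  using I.cauchy_schwarz[of "\<phi> j" u] \<phi>_V by (simp add: coef_def orthonormal)

lemma coef_tendsto:
  assumes j: "1 \<le> j" and v: "v \<in> V" "\<And>n. f n \<in> V"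
    and lim: "(\<lambda>n. I (f n - v) (f n - v)) \<longlonglongrightarrow> 0"
  shows "(\<lambda>n. coef j (f n)) \<longlonglongrightarrow> coef j v"
proof -
  have "(\<lambda>n. (coef j (f n) - coef j v)\<^sup>2) \<longlonglongrightarrow> 0"
  proof (rule tendsto_sandwich[OF _ _ tendsto_const lim])
    show "\<forall>\<^sub>F n in sequentially. (coef j (f n) - coef j v)\<^sup>2 \<le> I (f n - v) (f n - v)"
      using coef_square_le[OF j, of "f _ - v"] v j by (auto simp: coef_bilin)
  qed auto
  then have "(\<lambda>n. coef j (f n) - coef j v) \<longlonglongrightarrow> 0"
    using tendsto_real_sqrt[of "\<lambda>n. (coef j (f n) - coef j v)\<^sup>2" 0 sequentially]
    by (simp add: tendsto_rabs_zero_iff)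
  then show ?thesis by (simp add: LIM_zero_iff)
qed

text \<open>
The energy is the supremum of the partial sums in Parseval's identity, each of which is
continuous for the \<open>L\<^sup>2\<close> norm.
\<close>

lemma E_lower_semicontinuous:
  assumes v: "v \<in> V" "\<And>n. f n \<in> V"
    and lim: "(\<lambda>n. I (f n - v) (f n - v)) \<longlonglongrightarrow> 0"
    and bound: "\<And>n. n \<ge> n0 \<Longrightarrow> E (f n) (f n) \<le> C"
  shows "E v v \<le> C"
proof (rule LIMSEQ_le_const2[OF parseval_E[OF v(1)]], intro exI allI impI)
  fix N
  have "(\<lambda>n. \<Sum>j=1..N. \<Lambda> j * (coef j (f n))\<^sup>2) \<longlonglongrightarrow> (\<Sum>j=1..N. \<Lambda> j * (coef j v)\<^sup>2)"
    by (intro tendsto_intros coef_tendsto[OF _ v lim]) auto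
  then show "(\<Sum>j=1..N. \<Lambda> j * (coef j v)\<^sup>2) \<le> C"
    using bound order_trans[OF bessel_E[OF v(2)]]
    by (intro LIMSEQ_le_const2) blast+
qed

end

text \<open>
The last assumption is the completeness needed to realise a limit of Fourier coefficients by an
element of \<open>V\<close>.
\<close>

locale compact_eigenbasis = eigenbasis +
  assumes \<Lambda>_unbounded: "\<exists>j\<ge>1. M < \<Lambda> j"
    and closed: "(\<And>n. f n \<in> V) \<Longrightarrow> (\<And>n. E (f n) (f n) \<le> C) \<Longrightarrow>
      (\<And>\<epsilon>. \<epsilon> > 0 \<Longrightarrow> \<exists>N. \<forall>m\<ge>N. \<forall>n\<ge>N. I (f m - f n) (f m - f n) < \<epsilon>) \<Longrightarrow>
      \<exists>v\<in>V. (\<lambda>n. I (f n - v) (f n - v)) \<longlonglongrightarrow> 0"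
begin

text \<open>
Bounded energy makes the tails of the Fourier expansions uniformly small, the part beyond index
\<open>k\<close> having squared norm at most \<open>E / \<Lambda> (k + 1)\<close>. So convergence of each coefficient already
gives a Cauchy sequence in \<open>L\<^sup>2\<close>.
\<close>

lemma rellich:
  assumes f: "\<And>n. f n \<in> V" and C: "\<And>n. E (f n) (f n) \<le> C"
  obtains v r where "v \<in> V" "strict_mono (r :: nat \<Rightarrow> nat)"
    "(\<lambda>n. I (f (r n) - v) (f (r n) - v)) \<longlonglongrightarrow> 0"
proof -
  have C0: "0 \<le> C" using order_trans[OF E.nonneg[OF f[of 0]] C] .
  define S where "S = sqrt (C / \<Lambda> 1)"
  have bd: "\<bar>coef j (f n)\<bar> \<le> S" if "1 \<le> j" for j n
  proof -
    have "\<Lambda> 1 * (coef j (f n))\<^sup>2 \<le> C"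
      using coef_square_le[OF that f[of n]] poincare[OF f[of n]] C[of n] \<Lambda>_pos
      by (smt (verit) mult_left_mono)
    then have "(coef j (f n))\<^sup>2 \<le> C / \<Lambda> 1" using \<Lambda>_pos by (simp add: field_simps)
    then show ?thesis unfolding S_def using real_le_rsqrt[of "\<bar>coef j (f n)\<bar>"] by simp
  qed
  define a where "a n j = coef (Suc j) (f n)" for n j
  have "compact (PiE UNIV (\<lambda>j::nat. {- S..S}))"
    by (rule compact_cube)
  then have "seq_compact (PiE UNIV (\<lambda>j::nat. {- S..S}))"
    by (rule compact_imp_seq_compact)
  moreover have "a n \<in> PiE UNIV (\<lambda>j::nat. {- S..S})" for n
    unfolding a_def using bd[of "Suc _" n] by (auto simp: abs_le_iff) (smt (verit) le_add1 plus_1_eq_Suc)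
  ultimately obtain l r where r: "strict_mono (r :: nat \<Rightarrow> nat)" and l: "(a \<circ> r) \<longlonglongrightarrow> l"
    unfolding seq_compact_def by metis
  define c where "c j = l (j - 1)" for j
  have lim: "(\<lambda>n. coef j (f (r n))) \<longlonglongrightarrow> c j" if "1 \<le> j" for j
  proof -
    have "((\<lambda>n. (a \<circ> r) n (j - 1)) \<longlonglongrightarrow> l (j - 1))"
      using continuous_on_tendsto_compose[OF continuous_on_product_coordinates l] by auto
    then show ?thesis using that by (simp add: a_def c_def)
  qed
  have "\<exists>N. \<forall>m\<ge>N. \<forall>n\<ge>N. I (f (r m) - f (r n)) (f (r m) - f (r n)) < \<epsilon>" if \<epsilon>: "\<epsilon> > 0" for \<epsilon>
  proof -
    \<comment> \<open>Differences of two members have energy at most \<open>4 * C\<close>, so this index leaves tails of squared norm at most \<open>\<epsilon> / 2\<close>.\<close>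
    obtain j0 where j0: "j0 \<ge> 1" "8 * C / \<epsilon> < \<Lambda> j0" using \<Lambda>_unbounded by blast
    define k where "k = j0 - 1"
    have k: "8 * C / \<epsilon> < \<Lambda> (k + 1)" using j0 by (simp add: k_def)
    have "(\<lambda>n. \<Sum>j=1..k. (coef j (f (r n)) - c j)\<^sup>2) \<longlonglongrightarrow> (\<Sum>j=1..k. (c j - c j)\<^sup>2)"
      by (intro tendsto_intros lim) auto
    then have "(\<lambda>n. \<Sum>j=1..k. (coef j (f (r n)) - c j)\<^sup>2) \<longlonglongrightarrow> 0" by simp
    then have "\<forall>\<^sub>F n in sequentially. (\<Sum>j=1..k. (coef j (f (r n)) - c j)\<^sup>2) < \<epsilon> / 8"
      using \<epsilon> by (intro order_tendstoD) auto
    then obtain N where N: "\<And>n. n \<ge> N \<Longrightarrow> (\<Sum>j=1..k. (coef j (f (r n)) - c j)\<^sup>2) < \<epsilon> / 8"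
      by (auto simp: eventually_sequentially)
    have "I (f (r m) - f (r n)) (f (r m) - f (r n)) < \<epsilon>" if mn: "m \<ge> N" "n \<ge> N" for m n
    proof -
      define u where "u = f (r m) - f (r n)"
      have u: "u \<in> V" using f by (simp add: u_def)
      define w where "w = u - comb k (\<lambda>j. coef j u)"
      have w: "w \<in> V" using u by (simp add: w_def)
      have "(coef j u)\<^sup>2 \<le> 2 * (coef j (f (r m)) - c j)\<^sup>2 + 2 * (coef j (f (r n)) - c j)\<^sup>2"
        if "1 \<le> j" for j
      proof -
        have "coef j u = (coef j (f (r m)) - c j) - (coef j (f (r n)) - c j)"
          using that f by (simp add: u_def coef_bilin)
        then show ?thesis using square_diff_le_double by metis
      qed
      then have "(\<Sum>j=1..k. (coef j u)\<^sup>2)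
          \<le> (\<Sum>j=1..k. 2 * (coef j (f (r m)) - c j)\<^sup>2 + 2 * (coef j (f (r n)) - c j)\<^sup>2)"
        by (intro sum_mono) auto
      also have "\<dots> < \<epsilon> / 2"
        using N[OF mn(1)] N[OF mn(2)] by (simp add: sum.distrib sum_distrib_left[symmetric])
      finally have head: "(\<Sum>j=1..k. (coef j u)\<^sup>2) < \<epsilon> / 2" .
      have "E u u \<le> 4 * C"
        using E.square_diff_le[OF f[of "r m"] f[of "r n"]] C[of "r m"] C[of "r n"]
        by (simp add: u_def)
      moreover have "E w w \<le> E u u"
        using E_minus_comb[OF u, of k "\<lambda>j. coef j u"] sum_nonneg[of "{1..k}" "\<lambda>j. \<Lambda> j * (coef j u)\<^sup>2"]
          \<Lambda>_pos' by (simp add: w_def less_imp_le)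
      moreover have "\<Lambda> (k + 1) * I w w \<le> E w w"
        using u w by (intro rayleigh_lower) (auto simp: w_def coef_minus_projection)
      ultimately have tail: "\<Lambda> (k + 1) * I w w \<le> 4 * C" by linarith
      have "I w w \<le> \<epsilon> / 2"
      proof (rule ccontr)
        assume *: "\<not> I w w \<le> \<epsilon> / 2"
        have "8 * C \<le> \<Lambda> (k + 1) * \<epsilon>" using k \<epsilon> by (simp add: field_simps)
        then have "4 * C \<le> \<Lambda> (k + 1) * (\<epsilon> / 2)" by simp
        also have "\<dots> < \<Lambda> (k + 1) * I w w" using * \<Lambda>_pos'[of "k + 1"] by simp
        finally show False using tail by linarith
      qed
      then show ?thesis
        using head I_minus_comb[OF u, of k "\<lambda>j. coef j u"] by (simp add: w_def u_def)
    qed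
    then show ?thesis by blast
  qed
  then obtain v where "v \<in> V" "(\<lambda>n. I (f (r n) - v) (f (r n) - v)) \<longlonglongrightarrow> 0"
    using closed[of "\<lambda>n. f (r n)" C] f C by blast
  with r show ?thesis using that by blast
qed

end

section \<open>Positive parts and the two-slope functional\<close>

text \<open>
The positive part enters through its behaviour under the two forms only. The assumption \<open>pos_E\<close>
is the trace of nonlocality: disjoint nonnegative functions interact strictly negatively. For a
local Dirichlet form, which vanishes on such pairs, it fails.
\<close>

locale lattice_eigenbasis = compact_eigenbasis +
  fixes pos :: "'a \<Rightarrow> 'a"
  assumes pos_V [intro, simp]: "u \<in> V \<Longrightarrow> pos u \<in> V"
    and pos_diff: "u \<in> V \<Longrightarrow> pos u - pos (- u) = u"
    and pos_scale: "u \<in> V \<Longrightarrow> 0 < t \<Longrightarrow> pos (t *\<^sub>R u) = t *\<^sub>R pos u"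
    and pos_disjoint: "u \<in> V \<Longrightarrow> I (pos u) (pos (- u)) = 0"
    and pos_I: "u \<in> V \<Longrightarrow> v \<in> V \<Longrightarrow> 0 \<le> I (pos u) (pos v)"
    and pos_E: "u \<in> V \<Longrightarrow> v \<in> V \<Longrightarrow> I (pos u) (pos v) = 0 \<Longrightarrow> 0 \<le> E (pos u) (pos v) \<Longrightarrow>
      I (pos u) (pos u) = 0 \<or> I (pos v) (pos v) = 0"
begin

abbreviation neg :: "'a \<Rightarrow> 'a" where
  "neg u \<equiv> pos (- u)"

definition negsq :: "'a \<Rightarrow> real" where
  "negsq u = I (neg u) (neg u)"

definition J :: "real \<Rightarrow> real \<Rightarrow> 'a \<Rightarrow> real" where
  "J \<alpha> \<beta> w = (E w w - \<alpha> * I (pos w) (pos w) - \<beta> * I (neg w) (neg w)) / 2"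

definition dJ :: "real \<Rightarrow> real \<Rightarrow> 'a \<Rightarrow> 'a \<Rightarrow> real" where
  "dJ \<alpha> \<beta> w h = E w h - (\<alpha> * I (pos w) h - \<beta> * I (neg w) h)"

lemma pos_neg_commute: "u \<in> V \<Longrightarrow> I (neg u) (pos u) = 0"
  using pos_disjoint[of u] I.commute[of "pos u" "neg u"] by simp

lemma I_split: "w \<in> V \<Longrightarrow> I w w = I (pos w) (pos w) + negsq w"
  using I.square_diff[of "pos w" "neg w"] pos_diff[of w] pos_disjoint[of w]
  by (simp add: negsq_def)

lemma negsq_bounds: "w \<in> V \<Longrightarrow> 0 \<le> negsq w \<and> negsq w \<le> I w w"
  using I_split[of w] I.nonneg[of "pos w"] I.nonneg[of "neg w"] by (simp add: negsq_def)

lemma I_pos: "w \<in> V \<Longrightarrow> h \<in> V \<Longrightarrow> I (pos w) h = I w h + I (neg w) h"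
  using I.diff_left[of "pos w" "neg w" h] pos_diff[of w] by simp

lemma J_alt: "w \<in> V \<Longrightarrow> J \<alpha> \<beta> w = (E w w - \<alpha> * I w w - (\<beta> - \<alpha>) * negsq w) / 2"
  using I_split[of w] by (simp add: J_def negsq_def algebra_simps)

lemma dJ_alt: "w \<in> V \<Longrightarrow> h \<in> V \<Longrightarrow> dJ \<alpha> \<beta> w h = E w h - \<alpha> * I w h + (\<beta> - \<alpha>) * I (neg w) h"
  using I_pos[of w h] by (simp add: dJ_def algebra_simps)

lemma dJ_add: "w \<in> V \<Longrightarrow> g \<in> V \<Longrightarrow> h \<in> V \<Longrightarrow> dJ \<alpha> \<beta> w (g + h) = dJ \<alpha> \<beta> w g + dJ \<alpha> \<beta> w h"
  by (simp add: dJ_def E.bilin I.bilin algebra_simps)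

lemma dJ_scale: "w \<in> V \<Longrightarrow> h \<in> V \<Longrightarrow> dJ \<alpha> \<beta> w (t *\<^sub>R h) = t * dJ \<alpha> \<beta> w h"
  by (simp add: dJ_def E.bilin I.bilin algebra_simps)

lemma dJ_self: "w \<in> V \<Longrightarrow> dJ \<alpha> \<beta> w w = 2 * J \<alpha> \<beta> w"
proof -
  assume w: "w \<in> V"
  have "I (neg w) w = - negsq w"
    using I.diff_right[of "pos w" "neg w" "neg w"] pos_diff[OF w] pos_neg_commute[OF w] w
    by (simp add: negsq_def)
  then show ?thesis using w by (simp add: dJ_alt J_alt algebra_simps)
qed

lemma J_scale: "w \<in> V \<Longrightarrow> 0 < t \<Longrightarrow> J \<alpha> \<beta> (t *\<^sub>R w) = t\<^sup>2 * J \<alpha> \<beta> w"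
  using pos_scale[of "w" t] pos_scale[of "- w" t]
  by (simp add: J_def E.square_scale I.square_scale algebra_simps)

text \<open>
\<open>negsq\<close> is the squared distance to the cone of nonnegative elements; it is convex, with gradient
\<open>- 2 *\<^sub>R neg w\<close>, and the projection \<open>neg\<close> is nonexpansive. Both inequalities come from expanding
squares, the mixed terms \<open>I (neg w) (pos z)\<close> being nonnegative.
\<close>

lemma negsq_expansion:
  assumes w: "w \<in> V" and h: "h \<in> V"
  shows "0 \<le> negsq (w + h) - negsq w + 2 * I (neg w) h"
    and "negsq (w + h) - negsq w + 2 * I (neg w) h \<le> I h h"
proof -
  define z where "z = w + h"
  have z: "z \<in> V" using w h by (simp add: z_def)
  define p q p' q' where defs: "p = pos w" "q = neg w" "p' = pos z" "q' = neg z"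
  have V: "p \<in> V" "q \<in> V" "p' \<in> V" "q' \<in> V" using w z by (simp_all add: defs)
  have h_eq: "h = (p' - p) - (q' - q)"
  proof -
    have "h = z - w" by (simp add: z_def)
    then show ?thesis using pos_diff[OF w] pos_diff[OF z] by (simp add: defs algebra_simps)
  qed
  have 0: "I p q = 0" "I q p = 0" "I p' q' = 0" "I q' p' = 0"
    using pos_disjoint pos_neg_commute w z by (simp_all add: defs)
  have ge: "0 \<le> I q p'" "0 \<le> I p q'" using pos_I w z by (simp_all add: defs)
  have comm: "I p' q = I q p'" "I q' p = I p q'" "I q' q = I q q'" using V I.commute by auto
  have q: "I q h = I q p' - I q q' + I q q"
    using V 0 by (simp add: h_eq I.bilin)
  have e1: "negsq (w + h) - negsq w + 2 * I (neg w) h = I (q' - q) (q' - q) + 2 * I q p'"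
    unfolding negsq_def z_def[symmetric] defs(2,4)[symmetric] q
    using V comm by (simp add: I.square_diff)
  show "0 \<le> negsq (w + h) - negsq w + 2 * I (neg w) h"
    unfolding e1 using ge I.nonneg[of "q' - q"] V by simp
  have "I h h = I (p' - p) (p' - p) - 2 * I (p' - p) (q' - q) + I (q' - q) (q' - q)"
    unfolding h_eq using V by (simp add: I.square_diff)
  also have "I (p' - p) (q' - q) = - I q p' - I p q'"
    using V 0 comm by (simp add: I.bilin)
  finally show "negsq (w + h) - negsq w + 2 * I (neg w) h \<le> I h h"
    unfolding e1 using ge I.nonneg[of "p' - p"] V by simp
qed

text \<open>
With \<open>I w w = I (pos w) (pos w) + negsq w\<close> the functional \<open>2 * J \<alpha> \<beta> w\<close> becomes the quadratic
form \<open>E w w - \<alpha> * I w w\<close> minus \<open>\<beta> - \<alpha>\<close> times the convex function \<open>negsq\<close>, whose deviation from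
its tangent lies between 0 and \<open>I h h\<close>. These two bounds replace second derivatives throughout.
\<close>

lemma J_expansion:
  assumes w: "w \<in> V" and h: "h \<in> V" and le: "\<alpha> \<le> \<beta>"
  shows "J \<alpha> \<beta> (w + h) \<le> J \<alpha> \<beta> w + dJ \<alpha> \<beta> w h + (E h h - \<alpha> * I h h) / 2"
    and "J \<alpha> \<beta> w + dJ \<alpha> \<beta> w h + (E h h - \<beta> * I h h) / 2 \<le> J \<alpha> \<beta> (w + h)"
proof -
  define d where "d = negsq (w + h) - negsq w + 2 * I (neg w) h"
  have "0 \<le> (\<beta> - \<alpha>) * d" "(\<beta> - \<alpha>) * d \<le> (\<beta> - \<alpha>) * I h h"
    using negsq_expansion[OF w h] le by (simp_all add: d_def mult_left_mono)
  moreover have "J \<alpha> \<beta> (w + h)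
      = J \<alpha> \<beta> w + dJ \<alpha> \<beta> w h + (E h h - \<alpha> * I h h) / 2 - (\<beta> - \<alpha>) * d / 2"
    unfolding d_def using w h
    by (simp add: J_alt dJ_alt E.square_add I.square_add E.commute[of h w] I.commute[of h w]
        algebra_simps add_divide_distrib diff_divide_distrib)
  ultimately show "J \<alpha> \<beta> (w + h) \<le> J \<alpha> \<beta> w + dJ \<alpha> \<beta> w h + (E h h - \<alpha> * I h h) / 2"
    and "J \<alpha> \<beta> w + dJ \<alpha> \<beta> w h + (E h h - \<beta> * I h h) / 2 \<le> J \<alpha> \<beta> (w + h)"
    by (simp_all add: algebra_simps add_divide_distrib diff_divide_distrib)
qed

lemma I_tendsto_0:
  assumes V: "g \<in> V" "\<And>n. h n \<in> V" and lim: "(\<lambda>n. I (h n) (h n)) \<longlonglongrightarrow> 0"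
  shows "(\<lambda>n. I g (h n)) \<longlonglongrightarrow> 0"
proof -
  have "(\<lambda>n. (I g (h n))\<^sup>2) \<longlonglongrightarrow> 0"
  proof (rule tendsto_sandwich[OF _ _ tendsto_const])
    show "(\<lambda>n. I g g * I (h n) (h n)) \<longlonglongrightarrow> 0" using tendsto_mult_left[OF lim, of "I g g"] by simp
  qed (use V I.cauchy_schwarz in auto)
  then show ?thesis
    using tendsto_real_sqrt[of "\<lambda>n. (I g (h n))\<^sup>2" 0 sequentially] by (simp add: tendsto_rabs_zero_iff)
qed

lemma I_square_tendsto:
  assumes V: "v \<in> V" "\<And>n. f n \<in> V" and lim: "(\<lambda>n. I (f n - v) (f n - v)) \<longlonglongrightarrow> 0"
  shows "(\<lambda>n. I (f n) (f n)) \<longlonglongrightarrow> I v v"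
proof -
  have "(\<lambda>n. I v v + 2 * I v (f n - v) + I (f n - v) (f n - v)) \<longlonglongrightarrow> I v v + 2 * 0 + 0"
    by (intro tendsto_intros I_tendsto_0 lim) (use V in auto)
  moreover have "I v v + 2 * I v (f n - v) + I (f n - v) (f n - v) = I (f n) (f n)" for n
    using I.square_add[of v "f n - v"] V by simp
  ultimately show ?thesis by simp
qed

lemma negsq_tendsto:
  assumes V: "v \<in> V" "\<And>n. f n \<in> V" and lim: "(\<lambda>n. I (f n - v) (f n - v)) \<longlonglongrightarrow> 0"
  shows "(\<lambda>n. negsq (f n)) \<longlonglongrightarrow> negsq v"
proof (rule tendsto_sandwich)
  have b: "0 \<le> negsq (f n) - negsq v + 2 * I (neg v) (f n - v)"
    "negsq (f n) - negsq v + 2 * I (neg v) (f n - v) \<le> I (f n - v) (f n - v)" for n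
    using negsq_expansion[of v "f n - v"] V by simp_all
  show "\<forall>\<^sub>F n in sequentially. negsq v - 2 * I (neg v) (f n - v) \<le> negsq (f n)"
    "\<forall>\<^sub>F n in sequentially. negsq (f n) \<le> negsq v - 2 * I (neg v) (f n - v) + I (f n - v) (f n - v)"
    using b by (auto simp: algebra_simps intro!: always_eventually)
  have "(\<lambda>n. I (neg v) (f n - v)) \<longlonglongrightarrow> 0"
    by (intro I_tendsto_0 lim) (use V in auto)
  then have "(\<lambda>n. negsq v - 2 * I (neg v) (f n - v)) \<longlonglongrightarrow> negsq v - 2 * 0"
    "(\<lambda>n. negsq v - 2 * I (neg v) (f n - v) + I (f n - v) (f n - v)) \<longlonglongrightarrow> negsq v - 2 * 0 + 0"
    by (intro tendsto_intros lim; assumption)+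
  then show "(\<lambda>n. negsq v - 2 * I (neg v) (f n - v)) \<longlonglongrightarrow> negsq v"
    "(\<lambda>n. negsq v - 2 * I (neg v) (f n - v) + I (f n - v) (f n - v)) \<longlonglongrightarrow> negsq v"
    by simp_all
qed

text \<open>
The energy is lower semicontinuous, and the other two terms are continuous, for the \<open>L\<^sup>2\<close> norm.
\<close>

lemma J_lower_semicontinuous:
  assumes V: "v \<in> V" "\<And>n. f n \<in> V" and lim: "(\<lambda>n. I (f n - v) (f n - v)) \<longlonglongrightarrow> 0"
    and le: "\<And>n. J \<alpha> \<beta> (f n) \<le> C n" and C: "C \<longlonglongrightarrow> c"
  shows "J \<alpha> \<beta> v \<le> c"
proof -
  define D where "D = 2 * c + \<alpha> * I v v + (\<beta> - \<alpha>) * negsq v"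
  have "(\<lambda>n. 2 * C n + \<alpha> * I (f n) (f n) + (\<beta> - \<alpha>) * negsq (f n)) \<longlonglongrightarrow> D"
    unfolding D_def by (intro tendsto_intros C I_square_tendsto[OF V lim] negsq_tendsto[OF V lim])
  moreover have "E (f n) (f n) \<le> 2 * C n + \<alpha> * I (f n) (f n) + (\<beta> - \<alpha>) * negsq (f n)" for n
    using le[of n] V(2)[of n] by (simp add: J_alt field_simps)
  ultimately have "E v v \<le> D + \<epsilon>" if "\<epsilon> > 0" for \<epsilon>
  proof -
    have "\<forall>\<^sub>F n in sequentially. 2 * C n + \<alpha> * I (f n) (f n) + (\<beta> - \<alpha>) * negsq (f n) < D + \<epsilon>"
      using \<open>_ \<longlonglongrightarrow> D\<close> that by (intro order_tendstoD) auto
    then obtain n0 where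
      "\<And>n. n \<ge> n0 \<Longrightarrow> 2 * C n + \<alpha> * I (f n) (f n) + (\<beta> - \<alpha>) * negsq (f n) < D + \<epsilon>"
      by (auto simp: eventually_sequentially)
    with \<open>\<And>n. E (f n) (f n) \<le> _ n\<close> show ?thesis
      by (intro E_lower_semicontinuous[OF V lim, of n0]) (meson less_imp_le order_trans)
  qed
  then have "E v v \<le> D" by (rule field_le_epsilon)
  then show ?thesis using V(1) by (simp add: J_alt D_def field_simps)
qed

text \<open>
Testing the eigenvalue equation of \<open>\<phi> 1\<close> with its positive part \<open>p\<close> gives \<open>E p p - E q p = \<Lambda> 1 *
I p p\<close>, where \<open>q\<close> is the negative part, while \<open>E p p \<ge> \<Lambda> 1 * I p p\<close>. Hence \<open>E q p \<ge> 0\<close>, and the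
strictness in \<open>pos_E\<close> leaves no room for both parts.
\<close>

lemma first_eigenvector_signed: "I (pos (\<phi> 1)) (pos (\<phi> 1)) = 0 \<or> negsq (\<phi> 1) = 0"
proof -
  define p q where defs: "p = pos (\<phi> 1)" "q = neg (\<phi> 1)"
  have V: "\<phi> 1 \<in> V" "p \<in> V" "q \<in> V" using \<phi>_V[of 1] by (simp_all add: defs)
  have eq: "p - q = \<phi> 1" using V pos_diff by (simp add: defs)
  have 0: "I p q = 0" "I q p = 0" using V pos_disjoint pos_neg_commute by (simp_all add: defs)
  have "E p p - E q p = \<Lambda> 1 * (I p p - I q p)"
    using eigen[of 1 p] V eq[symmetric] by (simp add: E.diff_left I.diff_left)
  then have "0 \<le> E q p" using poincare[OF V(2)] 0 by simp
  then have "0 \<le> E p q" using V by (simp add: E.commute)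
  then show ?thesis using pos_E[of "\<phi> 1" "- \<phi> 1"] 0 V by (simp add: defs negsq_def)
qed

text \<open>
A one-signed \<open>v\<close> orthogonal to the one-signed \<open>\<phi> 1\<close> has support disjoint from it, and \<open>E v (\<phi> 1)
= 0\<close> by the eigenvalue equation; \<open>pos_E\<close> excludes this for \<open>v \<noteq> 0\<close>.
\<close>

lemma nonpos_orthogonal_null:
  assumes v: "v \<in> V" and p0: "I (pos v) (pos v) = 0" and c0: "coef 1 v = 0"
  shows "I v v = 0"
proof -
  have \<phi>1: "\<phi> 1 \<in> V" using \<phi>_V by simp
  have orth: "I (neg v) (\<phi> 1) = 0" "E (neg v) (\<phi> 1) = 0"
  proof -
    have "I (\<phi> 1) v = 0" "E (\<phi> 1) v = 0" using c0 eigen[of 1 v] v by (simp_all add: coef_def)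
    then have 1: "I v (\<phi> 1) = 0" "E v (\<phi> 1) = 0"
      using I.commute[OF v \<phi>1] E.commute[OF v \<phi>1] by simp_all
    have "I (pos v) (\<phi> 1) = 0" "E (pos v) (\<phi> 1) = 0"
      using p0 E_null[of "pos v"] I.null_left[of "pos v" "\<phi> 1"]
        E.null_left[of "pos v" "\<phi> 1"] v \<phi>1 by simp_all
    with 1 show "I (neg v) (\<phi> 1) = 0" "E (neg v) (\<phi> 1) = 0"
      using I.diff_left[of "pos v" "neg v" "\<phi> 1"] E.diff_left[of "pos v" "neg v" "\<phi> 1"]
        pos_diff[OF v] v \<phi>1 by simp_all
  qed
  have unit: "I (\<phi> 1) (\<phi> 1) = 1" by (simp add: orthonormal)
  have diff: "pos (\<phi> 1) - neg (\<phi> 1) = \<phi> 1" using pos_diff \<phi>1 by simp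
  \<comment> \<open>Both signs of \<open>\<phi> 1\<close> are treated at once, \<open>g\<close> being the nonnegative one.\<close>
  have goal: "negsq v = 0" if g: "g = \<phi> 1 \<or> g = - \<phi> 1" and null: "I (pos (- g)) (pos (- g)) = 0" for g
  proof -
    have gV: "g \<in> V" using g \<phi>1 by auto
    have gg: "pos g - pos (- g) = g" using pos_diff[OF gV] .
    have "I (neg v) g = 0" "E (neg v) g = 0"
      using g orth v \<phi>1 by (auto simp: I.minus_right E.minus_right)
    moreover have "I (neg v) (pos (- g)) = 0" "E (neg v) (pos (- g)) = 0"
      using null E_null[of "pos (- g)"] I.null_right[of "pos (- g)" "neg v"]
        E.null_right[of "pos (- g)" "neg v"] v gV by simp_all
    ultimately have "I (neg v) (pos g) = 0" "E (neg v) (pos g) = 0"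
      using I.diff_right[of "pos g" "pos (- g)" "neg v"] E.diff_right[of "pos g" "pos (- g)" "neg v"]
        gg v gV by simp_all
    then have "negsq v = 0 \<or> I (pos g) (pos g) = 0"
      using pos_E[of "- v" g] v gV by (simp add: negsq_def)
    moreover have "I (pos g) (pos g) = 1"
    proof -
      have "I g g = 1" using g unit \<phi>1 by (auto simp: I.minus_right I.minus_left)
      then show ?thesis using I_split[OF gV] null by (simp add: negsq_def)
    qed
    ultimately show ?thesis by simp
  qed
  from first_eigenvector_signed have "negsq v = 0"
    using goal[of "\<phi> 1"] goal[of "- \<phi> 1"] by (auto simp: negsq_def)
  then show ?thesis using I_split[OF v] p0 by simp
qed

end

section \<open>The minimax value and the alternative\<close>

lemma continuous_at_coordinate: "((\<lambda>d::nat \<Rightarrow> real. d j) \<longlongrightarrow> c j) (at c)"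
proof -
  have "continuous_on UNIV (\<lambda>d::nat \<Rightarrow> real. d j)" by (rule continuous_on_product_coordinates)
  then show ?thesis by (simp add: continuous_on_def)
qed

locale fucik_gap = lattice_eigenbasis +
  fixes k :: nat and \<alpha> :: real
  assumes k: "1 \<le> k" and gap: "\<Lambda> k < \<alpha>" "\<alpha> < \<Lambda> (k + 1)"
begin

definition X1 :: "'a set" where
  "X1 = range (comb k)"

definition X2 :: "'a set" where
  "X2 = {v \<in> V. \<forall>j\<in>{1..k}. coef j v = 0}"

definition unit_sphere :: "'a set" where
  "unit_sphere = {v \<in> X2. I v v = 1}"

abbreviation Jf :: "real \<Rightarrow> 'a \<Rightarrow> real" where
  "Jf \<beta> \<equiv> J \<alpha> \<beta>"

abbreviation dJf :: "real \<Rightarrow> 'a \<Rightarrow> 'a \<Rightarrow> real" where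
  "dJf \<beta> \<equiv> dJ \<alpha> \<beta>"

lemma X1_V [simp]: "u \<in> X1 \<Longrightarrow> u \<in> V"
  and X2_V [simp]: "v \<in> X2 \<Longrightarrow> v \<in> V"
  and unit_sphere_X2 [simp]: "v \<in> unit_sphere \<Longrightarrow> v \<in> X2"
  and unit_sphere_norm [simp]: "v \<in> unit_sphere \<Longrightarrow> I v v = 1"
  by (auto simp: X1_def X2_def unit_sphere_def)

lemma X2I: "v \<in> V \<Longrightarrow> (\<And>j. 1 \<le> j \<Longrightarrow> j \<le> k \<Longrightarrow> coef j v = 0) \<Longrightarrow> v \<in> X2"
  and X2_coef: "v \<in> X2 \<Longrightarrow> 1 \<le> j \<Longrightarrow> j \<le> k \<Longrightarrow> coef j v = 0"
  and unit_sphereI: "v \<in> X2 \<Longrightarrow> I v v = 1 \<Longrightarrow> v \<in> unit_sphere"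
  unfolding X2_def unit_sphere_def by simp_all

lemma comb_add: "comb N c + comb N d = comb N (\<lambda>j. c j + d j)"
  and comb_diff: "comb N c - comb N d = comb N (\<lambda>j. c j - d j)"
  and comb_scale: "t *\<^sub>R comb N c = comb N (\<lambda>j. t * c j)"
  by (simp_all add: comb_def sum.distrib sum_subtractf scaleR_add_left scaleR_diff_left
      scaleR_sum_right)

lemma X1_add: "u \<in> X1 \<Longrightarrow> u' \<in> X1 \<Longrightarrow> u + u' \<in> X1"
  and X1_diff: "u \<in> X1 \<Longrightarrow> u' \<in> X1 \<Longrightarrow> u - u' \<in> X1"
  and X1_scale: "u \<in> X1 \<Longrightarrow> t *\<^sub>R u \<in> X1"
  by (auto simp: X1_def comb_add comb_diff comb_scale)

lemma X1_0: "0 \<in> X1"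
proof -
  have "comb k (\<lambda>_. 0) = 0" by (simp add: comb_def)
  then show ?thesis unfolding X1_def by (metis rangeI)
qed

lemma X2_add: "u \<in> X2 \<Longrightarrow> v \<in> X2 \<Longrightarrow> u + v \<in> X2"
  and X2_scale: "v \<in> X2 \<Longrightarrow> t *\<^sub>R v \<in> X2"
  by (auto intro!: X2I simp: coef_bilin X2_coef)

lemma X1_X2_orthogonal:
  assumes "u \<in> X1" "v \<in> X2"
  shows "I u v = 0" and "E u v = 0"
  using assms by (auto simp: X1_def X2_coef I_comb E_comb intro!: sum.neutral)

lemma decomposition:
  assumes "w \<in> V"
  obtains u v where "u \<in> X1" "v \<in> X2" "w = u + v"
proof
  show "comb k (\<lambda>j. coef j w) \<in> X1" by (simp add: X1_def)
  show "w - comb k (\<lambda>j. coef j w) \<in> X2"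
    using assms by (auto intro!: X2I simp: coef_minus_projection)
qed simp

lemma X1_form: "u \<in> X1 \<Longrightarrow> E u u \<le> \<Lambda> k * I u u"
  by (auto simp: X1_def I_comb_comb E_comb_comb sum_distrib_left
      intro!: sum_mono mult_right_mono \<Lambda>_mono)

lemma X2_form: "v \<in> X2 \<Longrightarrow> \<Lambda> (k + 1) * I v v \<le> E v v"
  by (rule rayleigh_lower) (auto simp: X2_coef)

lemma X1_coercive: "u \<in> X1 \<Longrightarrow> (\<alpha> - \<Lambda> k) * I u u \<le> \<alpha> * I u u - E u u"
  using X1_form by (simp add: algebra_simps)

lemma X1_negative: "u \<in> X1 \<Longrightarrow> E u u - \<alpha> * I u u \<le> 0"
  using X1_coercive[of u] gap I.nonneg[of u]
  by (smt (verit) X1_V mult_nonneg_nonneg)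

lemma unit_sphere_nonempty: "\<phi> (k + 1) \<in> unit_sphere"
  using \<phi>_V[of "k + 1"] by (auto intro!: unit_sphereI X2I simp: coef_def orthonormal)

text \<open>
The bound is independent of \<open>\<beta>\<close> and decays in the \<open>X1\<close> direction at a rate given by the gap \<open>\<alpha> -
\<Lambda> k\<close>; it gives the coercivity for the maximum over \<open>X1\<close> and the bound on maximum points.
\<close>

lemma J_sum_le:
  assumes "u \<in> X1" "v \<in> X2" "\<alpha> \<le> \<beta>"
  shows "2 * Jf \<beta> (u + v) \<le> E v v - \<alpha> * I v v - (\<alpha> - \<Lambda> k) * I u u"
proof -
  have "0 \<le> (\<beta> - \<alpha>) * negsq (u + v)" using assms negsq_bounds[of "u + v"] by simp
  moreover have "E (u + v) (u + v) = E u u + E v v" "I (u + v) (u + v) = I u u + I v v"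
    using assms by (simp_all add: E.square_add I.square_add X1_X2_orthogonal)
  moreover have "2 * Jf \<beta> (u + v)
      = E (u + v) (u + v) - \<alpha> * I (u + v) (u + v) - (\<beta> - \<alpha>) * negsq (u + v)"
    using assms by (simp add: J_alt)
  ultimately show ?thesis
    using X1_coercive[OF assms(1)] by (simp add: distrib_left)
qed

definition is_max :: "real \<Rightarrow> 'a \<Rightarrow> 'a \<Rightarrow> bool" where
  "is_max \<beta> v u \<longleftrightarrow> u \<in> X1 \<and> (\<forall>u'\<in>X1. Jf \<beta> (u' + v) \<le> Jf \<beta> (u + v))"

text \<open>
The two-sided expansion squeezes the increment between expressions that are polynomial in the
coefficients.
\<close>

lemma continuous_comb:
  assumes v: "v \<in> V" and le: "\<alpha> \<le> \<beta>"
  shows "continuous_on UNIV (\<lambda>c. Jf \<beta> (comb k c + v))"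
proof (rule continuous_at_imp_continuous_on, intro ballI)
  fix c :: "nat \<Rightarrow> real"
  define w where "w = comb k c + v"
  have w: "w \<in> V" using v by (simp add: w_def)
  define h where "h d = comb k (\<lambda>j. d j - c j)" for d
  have eq: "comb k d + v = w + h d" for d
    by (simp add: w_def h_def comb_diff[symmetric])
  have coords: "((\<lambda>d. d j) \<longlongrightarrow> c j) (at c)" for j
    by (rule continuous_at_coordinate)
  have "dJf \<beta> w (h d)
      = (\<Sum>j=1..k. (d j - c j) * (\<Lambda> j * coef j w - \<alpha> * coef j w + (\<beta> - \<alpha>) * coef j (neg w)))" for d
  proof -
    have "E w (h d) = (\<Sum>j=1..k. \<Lambda> j * (d j - c j) * coef j w)"
      "I w (h d) = (\<Sum>j=1..k. (d j - c j) * coef j w)"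
      "I (neg w) (h d) = (\<Sum>j=1..k. (d j - c j) * coef j (neg w))"
      using w E_comb[of w k] I_comb[of w k] I_comb[of "neg w" k] E.commute[of w "h d"]
        I.commute[of w "h d"] I.commute[of "neg w" "h d"] by (simp_all add: h_def)
    moreover have "h d \<in> V" by (simp add: h_def)
    ultimately have "dJf \<beta> w (h d) = (\<Sum>j=1..k. \<Lambda> j * (d j - c j) * coef j w)
        - \<alpha> * (\<Sum>j=1..k. (d j - c j) * coef j w)
        + (\<beta> - \<alpha>) * (\<Sum>j=1..k. (d j - c j) * coef j (neg w))"
      using w by (simp add: dJ_alt)
    then show ?thesis
      unfolding sum_distrib_left sum_subtractf[symmetric] sum.distrib[symmetric]
      by (simp add: algebra_simps)
  qed
  moreover have "((\<lambda>d. \<Sum>j=1..k. (d j - c j)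
      * (\<Lambda> j * coef j w - \<alpha> * coef j w + (\<beta> - \<alpha>) * coef j (neg w))) \<longlongrightarrow>
      (\<Sum>j=1..k. (c j - c j) * (\<Lambda> j * coef j w - \<alpha> * coef j w + (\<beta> - \<alpha>) * coef j (neg w)))) (at c)"
    by (intro tendsto_intros coords)
  ultimately have 1: "((\<lambda>d. dJf \<beta> w (h d)) \<longlongrightarrow> 0) (at c)" by simp
  have "((\<lambda>d. \<Sum>j=1..k. \<Lambda> j * (d j - c j)\<^sup>2) \<longlongrightarrow> (\<Sum>j=1..k. \<Lambda> j * (c j - c j)\<^sup>2)) (at c)"
    "((\<lambda>d. \<Sum>j=1..k. (d j - c j)\<^sup>2) \<longlongrightarrow> (\<Sum>j=1..k. (c j - c j)\<^sup>2)) (at c)"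
    by (intro tendsto_intros coords)+
  then have 2: "((\<lambda>d. E (h d) (h d)) \<longlongrightarrow> 0) (at c)" "((\<lambda>d. I (h d) (h d)) \<longlongrightarrow> 0) (at c)"
    by (simp_all add: h_def E_comb_comb I_comb_comb)
  have h: "h d \<in> V" for d by (simp add: h_def)
  have "((\<lambda>d. Jf \<beta> (w + h d)) \<longlongrightarrow> Jf \<beta> w) (at c)"
  proof (rule tendsto_sandwich)
    show "\<forall>\<^sub>F d in at c. Jf \<beta> w + dJf \<beta> w (h d) + (E (h d) (h d) - \<beta> * I (h d) (h d)) / 2 \<le> Jf \<beta> (w + h d)"
      "\<forall>\<^sub>F d in at c. Jf \<beta> (w + h d) \<le> Jf \<beta> w + dJf \<beta> w (h d) + (E (h d) (h d) - \<alpha> * I (h d) (h d)) / 2"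
      using J_expansion[OF w h le] by simp_all
    have "((\<lambda>d. Jf \<beta> w + dJf \<beta> w (h d) + (E (h d) (h d) - t * I (h d) (h d)) / 2)
        \<longlongrightarrow> Jf \<beta> w + 0 + (0 - t * 0) / 2) (at c)" for t
      by (intro tendsto_intros 1 2) simp
    from this[of \<beta>] this[of \<alpha>]
    show "((\<lambda>d. Jf \<beta> w + dJf \<beta> w (h d) + (E (h d) (h d) - \<beta> * I (h d) (h d)) / 2) \<longlongrightarrow> Jf \<beta> w) (at c)"
      "((\<lambda>d. Jf \<beta> w + dJf \<beta> w (h d) + (E (h d) (h d) - \<alpha> * I (h d) (h d)) / 2) \<longlongrightarrow> Jf \<beta> w) (at c)"
      by simp_all
  qed
  moreover have "h c = 0" by (simp add: h_def comb_def)
  ultimately show "isCont (\<lambda>c. Jf \<beta> (comb k c + v)) c"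
    unfolding isCont_def eq by simp
qed

text \<open>
By \<open>J_sum_le\<close> the functional lies below its value at \<open>u = 0\<close> outside a ball of \<open>X1\<close>, so the
maximum may be taken over a cube of coefficients. Only the first \<open>k\<close> coordinates of a sequence
matter; the cube in all of them is compact, too.
\<close>

lemma is_max_exists:
  assumes v: "v \<in> X2" and le: "\<alpha> \<le> \<beta>"
  obtains u where "is_max \<beta> v u"
proof -
  \<comment> \<open>The squared radius at which the bound of \<open>J_sum_le\<close> falls to \<open>2 * Jf \<beta> v\<close>.\<close>
  define R where "R = (\<beta> - \<alpha>) * negsq v / (\<alpha> - \<Lambda> k)"
  have R0: "0 \<le> R" unfolding R_def using le gap negsq_bounds[of v] v by simp
  define S where "S = sqrt R"
  have S0: "0 \<le> S" using R0 by (simp add: S_def)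
  define B where "B = PiE UNIV (\<lambda>j::nat. {- S..S})"
  have "compact B" unfolding B_def by (rule compact_cube)
  moreover have 0: "(\<lambda>_. 0) \<in> B" using S0 by (auto simp: B_def)
  ultimately obtain c where c: "c \<in> B" "\<And>d. d \<in> B \<Longrightarrow> Jf \<beta> (comb k d + v) \<le> Jf \<beta> (comb k c + v)"
    using continuous_attains_sup[of B "\<lambda>c. Jf \<beta> (comb k c + v)"]
      continuous_on_subset[OF continuous_comb[OF X2_V[OF v] le]] by blast
  have "Jf \<beta> (comb k d + v) \<le> Jf \<beta> (comb k c + v)" for d
  proof (cases "\<forall>j\<in>{1..k}. \<bar>d j\<bar> \<le> S")
    case True
    define d' where "d' j = (if j \<in> {1..k} then d j else 0)" for j
    have "comb k d' = comb k d" by (auto simp: comb_def d'_def intro!: sum.cong)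
    moreover have "- S \<le> d j \<and> d j \<le> S" if "j \<in> {1..k}" for j
      using True that by (meson abs_le_D1 abs_le_D2 minus_le_iff)
    then have "d' \<in> B" using S0 by (auto simp: B_def d'_def)
    ultimately show ?thesis using c(2)[of d'] by simp
  next
    case False
    then obtain i where i: "i \<in> {1..k}" "S < \<bar>d i\<bar>" by fastforce
    have "R = S\<^sup>2" using R0 by (simp add: S_def)
    also have "\<dots> < (d i)\<^sup>2" using i S0 by (metis power2_abs power_strict_mono zero_less_numeral)
    also have "\<dots> \<le> (\<Sum>j=1..k. (d j)\<^sup>2)" using i by (intro member_le_sum) auto
    finally have "R < I (comb k d) (comb k d)" by (simp add: I_comb_comb)
    then have "(\<alpha> - \<Lambda> k) * R < (\<alpha> - \<Lambda> k) * I (comb k d) (comb k d)" using gap by simp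
    moreover have "(\<alpha> - \<Lambda> k) * R = (\<beta> - \<alpha>) * negsq v" using gap by (simp add: R_def)
    moreover have "2 * Jf \<beta> (comb k d + v) \<le> E v v - \<alpha> * I v v - (\<alpha> - \<Lambda> k) * I (comb k d) (comb k d)"
      using v le by (intro J_sum_le) (auto simp: X1_def)
    moreover have "2 * Jf \<beta> v = E v v - \<alpha> * I v v - (\<beta> - \<alpha>) * negsq v" using v by (simp add: J_alt)
    ultimately have "Jf \<beta> (comb k d + v) \<le> Jf \<beta> v" by linarith
    also have "\<dots> \<le> Jf \<beta> (comb k c + v)" using c(2)[OF 0] by (simp add: comb_def)
    finally show ?thesis .
  qed
  then have "is_max \<beta> v (comb k c)" by (auto simp: is_max_def X1_def)
  then show ?thesis using that by blast
qed

lemma is_max_critical: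
  assumes m: "is_max \<beta> v u" and v: "v \<in> X2" and le: "\<alpha> \<le> \<beta>" and h: "h \<in> X1"
  shows "dJf \<beta> (u + v) h = 0"
proof -
  have u: "u \<in> X1" using m by (simp add: is_max_def)
  have "0 \<le> t * (- dJf \<beta> (u + v) h) + t\<^sup>2 * ((\<beta> * I h h - E h h) / 2)" for t
  proof -
    have "Jf \<beta> ((u + t *\<^sub>R h) + v) \<le> Jf \<beta> (u + v)"
      using m u h by (simp add: is_max_def X1_add X1_scale)
    moreover have "(u + t *\<^sub>R h) + v = (u + v) + t *\<^sub>R h" by simp
    moreover have "Jf \<beta> (u + v) + dJf \<beta> (u + v) (t *\<^sub>R h)
        + (E (t *\<^sub>R h) (t *\<^sub>R h) - \<beta> * I (t *\<^sub>R h) (t *\<^sub>R h)) / 2 \<le> Jf \<beta> ((u + v) + t *\<^sub>R h)"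
      using u v h le by (intro J_expansion) auto
    ultimately show ?thesis using u v h
      by (simp add: dJ_scale E.square_scale I.square_scale field_simps)
  qed
  from slope_zero_if_quadratic_nonneg[OF this] show ?thesis by simp
qed

text \<open>
The converse to \<open>is_max_critical\<close>, by concavity along \<open>X1\<close>.
\<close>

lemma critical_is_max:
  assumes u: "u \<in> X1" and v: "v \<in> X2" and le: "\<alpha> \<le> \<beta>"
    and crit: "\<And>h. h \<in> X1 \<Longrightarrow> dJf \<beta> (u + v) h = 0"
  shows "is_max \<beta> v u"
  unfolding is_max_def
proof (intro conjI ballI u)
  fix u' assume u': "u' \<in> X1"
  have d: "u' - u \<in> X1" using u u' by (rule X1_diff[rotated])
  have "Jf \<beta> ((u + v) + (u' - u)) \<le> Jf \<beta> (u + v) + dJf \<beta> (u + v) (u' - u)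
      + (E (u' - u) (u' - u) - \<alpha> * I (u' - u) (u' - u)) / 2"
    using u v u' le by (intro J_expansion) auto
  moreover have "(E (u' - u) (u' - u) - \<alpha> * I (u' - u) (u' - u)) / 2 \<le> 0"
    using X1_negative[OF d] by simp
  moreover have "(u + v) + (u' - u) = u' + v" by simp
  ultimately show "Jf \<beta> (u' + v) \<le> Jf \<beta> (u + v)"
    using crit[OF d] by (metis add.right_neutral add_le_cancel_left order_trans)
qed

definition M :: "real \<Rightarrow> 'a \<Rightarrow> real" where
  "M \<beta> v = (GREATEST b. \<exists>u\<in>X1. b = Jf \<beta> (u + v))"

lemma M_eq: "is_max \<beta> v u \<Longrightarrow> M \<beta> v = Jf \<beta> (u + v)"
  unfolding M_def by (rule Greatest_equality) (auto simp: is_max_def)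

lemma M_ge: "v \<in> X2 \<Longrightarrow> \<alpha> \<le> \<beta> \<Longrightarrow> u \<in> X1 \<Longrightarrow> Jf \<beta> (u + v) \<le> M \<beta> v"
  by (metis M_eq is_max_def is_max_exists)

lemma M_ge_J: "v \<in> X2 \<Longrightarrow> \<alpha> \<le> \<beta> \<Longrightarrow> Jf \<beta> v \<le> M \<beta> v"
  using M_ge[OF _ _ X1_0] by simp

lemma J_lower: "v \<in> V \<Longrightarrow> \<alpha> \<le> \<beta> \<Longrightarrow> E v v - \<beta> * I v v \<le> 2 * Jf \<beta> v"
proof -
  assume v: "v \<in> V" and "\<alpha> \<le> \<beta>"
  then have "(\<beta> - \<alpha>) * negsq v \<le> (\<beta> - \<alpha>) * I v v"
    using negsq_bounds[OF v] by (intro mult_left_mono) auto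
  then show ?thesis using v by (simp add: J_alt algebra_simps)
qed

lemma M_scale:
  assumes v: "v \<in> X2" and t: "0 < t" and le: "\<alpha> \<le> \<beta>"
  shows "M \<beta> (t *\<^sub>R v) = t\<^sup>2 * M \<beta> v"
proof -
  obtain u where m: "is_max \<beta> v u" using is_max_exists[OF v le] .
  then have u: "u \<in> X1" by (simp add: is_max_def)
  have J: "Jf \<beta> (u' + t *\<^sub>R v) = t\<^sup>2 * Jf \<beta> ((1 / t) *\<^sub>R u' + v)" if "u' \<in> X1" for u'
    using J_scale[of "(1 / t) *\<^sub>R u' + v" t \<alpha> \<beta>] that v t by (simp add: scaleR_add_right)
  have "is_max \<beta> (t *\<^sub>R v) (t *\<^sub>R u)"
    unfolding is_max_def
  proof (intro conjI ballI X1_scale u)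
    fix u' assume u': "u' \<in> X1"
    have "Jf \<beta> ((1 / t) *\<^sub>R u' + v) \<le> Jf \<beta> (u + v)"
      using m X1_scale[OF u'] by (simp add: is_max_def)
    then show "Jf \<beta> (u' + t *\<^sub>R v) \<le> Jf \<beta> (t *\<^sub>R u + t *\<^sub>R v)"
      using J[OF u'] J[OF X1_scale[OF u, of t]] t by (simp add: mult_left_mono)
  qed
  from M_eq[OF this] M_eq[OF m] J[OF X1_scale[OF u, of t]] t show ?thesis by simp
qed

text \<open>
Passing from \<open>v\<close> to \<open>v + h\<close> moves the maximum point by some \<open>d \<in> X1\<close>. The first-order term in
\<open>d\<close> vanishes since \<open>u\<close> is critical, the second-order term is nonpositive, and the mixed terms
are zero by orthogonality. So \<open>d\<close> disappears from the estimate, whatever its size.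
\<close>

lemma M_perturb:
  assumes m: "is_max \<beta> v u" and v: "v \<in> X2" and h: "h \<in> X2" and le: "\<alpha> \<le> \<beta>"
  shows "M \<beta> (v + h) \<le> M \<beta> v + dJf \<beta> (u + v) h + (E h h - \<alpha> * I h h) / 2"
proof -
  have u: "u \<in> X1" using m by (simp add: is_max_def)
  obtain u' where m': "is_max \<beta> (v + h) u'" using is_max_exists[OF X2_add[OF v h] le] .
  define d where "d = u' - u"
  have d: "d \<in> X1" using m' u by (auto simp: d_def is_max_def X1_diff)
  have "u' + (v + h) = (u + v) + (d + h)" by (simp add: d_def)
  then have "M \<beta> (v + h) = Jf \<beta> ((u + v) + (d + h))" using M_eq[OF m'] by (simp only:)
  also have "\<dots> \<le> Jf \<beta> (u + v) + dJf \<beta> (u + v) (d + h) + (E (d + h) (d + h) - \<alpha> * I (d + h) (d + h)) / 2"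
    using u v h d le by (intro J_expansion) auto
  also have "dJf \<beta> (u + v) (d + h) = dJf \<beta> (u + v) h"
    using is_max_critical[OF m v le d] u v h d by (simp add: dJ_add)
  also have "E (d + h) (d + h) = E d d + E h h"
    using X1_X2_orthogonal[OF d h] d h by (simp add: E.square_add)
  also have "I (d + h) (d + h) = I d d + I h h"
    using X1_X2_orthogonal[OF d h] d h by (simp add: I.square_add)
  finally show ?thesis using M_eq[OF m] X1_negative[OF d] by (simp add: field_simps)
qed

text \<open>
The direct method: \<open>M\<close> controls the energy on the unit sphere, and it is lower semicontinuous as
a supremum of lower semicontinuous functions of \<open>v\<close>.
\<close>

lemma M_min_exists:
  assumes le: "\<alpha> \<le> \<beta>"
  obtains v where "v \<in> unit_sphere" "\<And>v'. v' \<in> unit_sphere \<Longrightarrow> M \<beta> v \<le> M \<beta> v'"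
proof -
  have low: "E v v \<le> 2 * M \<beta> v + \<beta>" if "v \<in> unit_sphere" for v
    using J_lower[of v \<beta>] M_ge_J[of v \<beta>] that le by simp
  have bdd: "bdd_below (M \<beta> ` unit_sphere)"
  proof (rule bdd_belowI2)
    fix v assume "v \<in> unit_sphere"
    then show "- \<beta> / 2 \<le> M \<beta> v" using low[of v] E.nonneg[of v] by simp
  qed
  define s where "s = Inf (M \<beta> ` unit_sphere)"
  have s_le: "s \<le> M \<beta> v" if "v \<in> unit_sphere" for v
    unfolding s_def using bdd that by (rule cINF_lower)
  have "\<exists>v\<in>unit_sphere. M \<beta> v < s + 1 / real (Suc n)" for n
  proof -
    have "Inf (M \<beta> ` unit_sphere) < s + 1 / real (Suc n)" by (simp add: s_def)
    then show ?thesis using cInf_lessD[of "M \<beta> ` unit_sphere"] unit_sphere_nonempty by blast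
  qed
  then obtain f where f: "\<And>n. f n \<in> unit_sphere" "\<And>n. M \<beta> (f n) < s + 1 / real (Suc n)" by metis
  have fV: "f n \<in> V" for n using f(1) by simp
  have bound: "E (f n) (f n) \<le> 2 * (s + 1) + \<beta>" for n
  proof -
    have "M \<beta> (f n) < s + 1" using f(2)[of n] by (rule less_le_trans) simp
    then show ?thesis using low[OF f(1)[of n]] by simp
  qed
  obtain v r where v: "v \<in> V" and r: "strict_mono r"
    and lim: "(\<lambda>n. I (f (r n) - v) (f (r n) - v)) \<longlonglongrightarrow> 0"
    by (rule rellich[OF fV bound])
  have "coef j v = 0" if j: "j \<in> {1..k}" for j
  proof -
    have "(\<lambda>n. coef j (f (r n))) \<longlonglongrightarrow> coef j v"
      using j v fV lim by (intro coef_tendsto) auto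
    moreover have "coef j (f (r n)) = 0" for n
      using X2_coef[OF unit_sphere_X2[OF f(1)]] j by auto
    ultimately show ?thesis by (simp add: LIMSEQ_const_iff)
  qed
  then have vX2: "v \<in> X2" using v by (intro X2I) auto
  have "(\<lambda>n. I (f (r n)) (f (r n))) \<longlonglongrightarrow> I v v"
    using v fV lim by (intro I_square_tendsto)
  then have "I v v = 1" using f(1) by (simp add: LIMSEQ_const_iff)
  then have vS: "v \<in> unit_sphere" using vX2 by (intro unit_sphereI)
  obtain u where m: "is_max \<beta> v u" using is_max_exists[OF vX2 le] .
  then have u: "u \<in> X1" by (simp add: is_max_def)
  \<comment> \<open>It suffices to compare at the maximum point \<open>u\<close> belonging to the limit \<open>v\<close>.\<close>
  have "Jf \<beta> (u + v) \<le> s"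
  proof (rule J_lower_semicontinuous)
    show "(\<lambda>n. I ((u + f (r n)) - (u + v)) ((u + f (r n)) - (u + v))) \<longlonglongrightarrow> 0" using lim by simp
    show "Jf \<beta> (u + f (r n)) \<le> s + 1 / real (Suc (r n))" for n
      using order_trans[OF M_ge[OF unit_sphere_X2[OF f(1)] le u] less_imp_le[OF f(2)]] .
    have "(\<lambda>n. s + 1 / real (Suc n)) \<longlonglongrightarrow> s + 0"
      by (intro tendsto_intros LIMSEQ_Suc lim_1_over_n)
    from LIMSEQ_subseq_LIMSEQ[OF this r] show "(\<lambda>n. s + 1 / real (Suc (r n))) \<longlonglongrightarrow> s"
      by (simp add: comp_def)
  qed (use u v fV in auto)
  then have "M \<beta> v \<le> s" using M_eq[OF m] by simp
  then show ?thesis using that[OF vS] s_le by fastforce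
qed

definition m :: "real \<Rightarrow> real" where
  "m \<beta> = (LEAST a. \<exists>v\<in>unit_sphere. a = M \<beta> v)"

lemma m_attained:
  assumes "\<alpha> \<le> \<beta>"
  obtains v where "v \<in> unit_sphere" "m \<beta> = M \<beta> v"
proof -
  obtain v where v: "v \<in> unit_sphere" "\<And>v'. v' \<in> unit_sphere \<Longrightarrow> M \<beta> v \<le> M \<beta> v'"
    using M_min_exists[OF assms] by metis
  have "m \<beta> = M \<beta> v" unfolding m_def by (rule Least_equality) (use v in auto)
  with v that show ?thesis by blast
qed

lemma m_le:
  assumes "\<alpha> \<le> \<beta>" "v \<in> unit_sphere"
  shows "m \<beta> \<le> M \<beta> v"
proof -
  obtain v0 where v: "v0 \<in> unit_sphere" "\<And>v'. v' \<in> unit_sphere \<Longrightarrow> M \<beta> v0 \<le> M \<beta> v'"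
    using M_min_exists[OF assms(1)] by metis
  have "m \<beta> = M \<beta> v0" unfolding m_def by (rule Least_equality) (use v in auto)
  with v assms show ?thesis by simp
qed

lemma M_lower_homogeneous:
  assumes v: "v \<in> X2" and le: "\<alpha> \<le> \<beta>"
  shows "m \<beta> * I v v \<le> M \<beta> v"
proof (cases "I v v = 0")
  case True
  then show ?thesis using J_lower[of v \<beta>] M_ge_J[OF v le] E.nonneg[of v] v le by simp
next
  case False
  then have pos: "0 < I v v" using I.nonneg[of v] v by simp
  define t where "t = 1 / sqrt (I v v)"
  have t: "0 < t" "t\<^sup>2 * I v v = 1" using pos by (simp_all add: t_def power_divide)
  have "t *\<^sub>R v \<in> unit_sphere" using v t by (intro unit_sphereI X2_scale) (simp_all add: I.square_scale)
  from m_le[OF le this] have "m \<beta> \<le> t\<^sup>2 * M \<beta> v" using M_scale[OF v t(1) le] by simp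
  then have "m \<beta> * I v v \<le> (t\<^sup>2 * I v v) * M \<beta> v"
    using pos by (metis mult.assoc mult.commute mult_right_mono less_imp_le)
  then show ?thesis using t by simp
qed

definition fucik :: "real \<Rightarrow> bool" where
  "fucik \<beta> \<longleftrightarrow> (\<exists>w\<in>V. I w w \<noteq> 0 \<and> (\<forall>h\<in>V. dJf \<beta> w h = 0))"

text \<open>
A critical point \<open>w = u + v\<close> has \<open>Jf \<beta> w = 0\<close> by homogeneity, and \<open>u\<close> is the maximum point for
\<open>v\<close>, so \<open>M \<beta> v = 0\<close>. This contradicts \<open>0 < m \<beta>\<close> unless \<open>v\<close> is null, and then \<open>Jf \<beta>\<close> is negative
at \<open>w \<in> X1\<close>.
\<close>

lemma m_pos_imp_not_fucik:
  assumes le: "\<alpha> \<le> \<beta>" and pos: "0 < m \<beta>"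
  shows "\<not> fucik \<beta>"
proof
  assume "fucik \<beta>"
  then obtain w where w: "w \<in> V" "I w w \<noteq> 0" and crit: "\<And>h. h \<in> V \<Longrightarrow> dJf \<beta> w h = 0"
    by (auto simp: fucik_def)
  obtain u v where uv: "u \<in> X1" "v \<in> X2" "w = u + v" using decomposition[OF w(1)] .
  have "is_max \<beta> v u" using uv crit le by (intro critical_is_max) auto
  then have "M \<beta> v = Jf \<beta> w" using M_eq uv by simp
  also have "\<dots> = 0" using dJ_self[OF w(1)] crit[OF w(1)] by simp
  finally have "m \<beta> * I v v \<le> 0" using M_lower_homogeneous[OF uv(2) le] by simp
  then have v0: "I v v = 0" using pos I.nonneg[of v] uv by (simp add: mult_le_0_iff)
  then have "2 * Jf \<beta> w \<le> - ((\<alpha> - \<Lambda> k) * I u u)"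
    using J_sum_le[OF uv(1,2) le] E_null[of v] uv by simp
  moreover have "I w w = I u u"
    using uv v0 X1_X2_orthogonal[OF uv(1,2)] by (simp add: I.square_add)
  then have "0 < I u u" using w I.nonneg[of w] by simp
  then have "0 < (\<alpha> - \<Lambda> k) * I u u" using gap by simp
  ultimately show False using \<open>Jf \<beta> w = 0\<close> by simp
qed

text \<open>
\<open>M \<beta>\<close> is nonnegative on \<open>X2\<close> and attains its minimum 0 at \<open>v\<close>; by \<open>M_perturb\<close> it has there the
quadratic majorant with slope \<open>dJf \<beta> (u + v)\<close>, which must therefore vanish.
\<close>

lemma critical_at_zero:
  assumes le: "\<alpha> \<le> \<beta>" and zero: "m \<beta> = 0" and v: "v \<in> X2" and M0: "M \<beta> v = 0"
    and mx: "is_max \<beta> v u" and h: "h \<in> V"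
  shows "dJf \<beta> (u + v) h = 0"
proof -
  have u: "u \<in> X1" using mx by (simp add: is_max_def)
  have X2: "dJf \<beta> (u + v) g = 0" if g: "g \<in> X2" for g
  proof (rule slope_zero_if_quadratic_nonneg)
    fix t
    have "0 \<le> M \<beta> (v + t *\<^sub>R g)"
      using M_lower_homogeneous[OF X2_add[OF v X2_scale[OF g]] le] zero by simp
    then show "0 \<le> t * dJf \<beta> (u + v) g + t\<^sup>2 * ((E g g - \<alpha> * I g g) / 2)"
      using M_perturb[OF mx v X2_scale[OF g] le, of t] M0 u v g
      by (simp add: dJ_scale E.square_scale I.square_scale field_simps)
  qed
  obtain p q where "p \<in> X1" "q \<in> X2" "h = p + q" using decomposition[OF h] .
  then show ?thesis
    using X2 is_max_critical[OF mx v le] u v by (simp add: dJ_add)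
qed

lemma critical_nontrivial: "u \<in> X1 \<Longrightarrow> v \<in> unit_sphere \<Longrightarrow> 1 \<le> I (u + v) (u + v)"
  using X1_X2_orthogonal[of u v] I.nonneg[of u] by (simp add: I.square_add)

lemma m_zero_imp_fucik:
  assumes le: "\<alpha> \<le> \<beta>" and zero: "m \<beta> = 0"
  shows "fucik \<beta>"
proof -
  obtain v where v: "v \<in> unit_sphere" "m \<beta> = M \<beta> v" using m_attained[OF le] .
  obtain u where mx: "is_max \<beta> v u" using is_max_exists[OF unit_sphere_X2[OF v(1)] le] .
  then have u: "u \<in> X1" by (simp add: is_max_def)
  have "\<forall>h\<in>V. dJf \<beta> (u + v) h = 0"
    using critical_at_zero[OF le zero _ _ mx] v zero by simp
  then show ?thesis
    unfolding fucik_def using critical_nontrivial[OF u v(1)] u v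
    by (intro bexI[of _ "u + v"]) auto
qed

text \<open>
Already \<open>Jf \<beta> v\<close> is nonnegative on the sphere of \<open>X2\<close>, and it could vanish only for \<open>\<beta> = \<Lambda> (k +
1)\<close> and \<open>v\<close> without positive part, which \<open>nonpos_orthogonal_null\<close> excludes.
\<close>

lemma m_pos_up_to_next_eigenvalue:
  assumes le: "\<alpha> \<le> \<beta>" "\<beta> \<le> \<Lambda> (k + 1)"
  shows "0 < m \<beta>"
proof -
  obtain v where v: "v \<in> unit_sphere" "m \<beta> = M \<beta> v" using m_attained[OF le(1)] .
  have vV: "v \<in> V" using v by simp
  have split: "I (pos v) (pos v) = 1 - negsq v" using I_split[OF vV] v by simp
  have E: "\<Lambda> (k + 1) \<le> E v v" using X2_form[of v] v by simp
  have J: "2 * Jf \<beta> v = (E v v - \<beta>) + (\<beta> - \<alpha>) * I (pos v) (pos v)"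
    using vV v by (simp add: J_alt split) (simp add: algebra_simps)
  have "0 < Jf \<beta> v"
  proof (rule ccontr)
    assume "\<not> 0 < Jf \<beta> v"
    moreover have "0 \<le> (\<beta> - \<alpha>) * I (pos v) (pos v)" using le I.nonneg[of "pos v"] vV by simp
    ultimately have "E v v - \<beta> = 0" "(\<beta> - \<alpha>) * I (pos v) (pos v) = 0" using J E le by linarith+
    then have "I (pos v) (pos v) = 0" using E gap by auto
    then have "I v v = 0"
      using nonpos_orthogonal_null[OF vV] X2_coef[OF unit_sphere_X2[OF v(1)], of 1] k by simp
    then show False using v by simp
  qed
  then show ?thesis using M_ge_J[OF unit_sphere_X2[OF v(1)] le(1)] v by simp
qed

lemma J_beta_diff: "w \<in> V \<Longrightarrow> Jf \<beta>\<^sub>2 w = Jf \<beta>\<^sub>1 w - (\<beta>\<^sub>2 - \<beta>\<^sub>1) / 2 * negsq w"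
  by (simp add: J_alt algebra_simps add_divide_distrib diff_divide_distrib)

text \<open>
Both bounds come from evaluating the two functionals at the same point \<open>u + v\<close>. For the second
one, the maximum point \<open>u\<close> has to be bounded uniformly over the unit sphere: \<open>J_sum_le\<close> from
above and \<open>J_lower\<close> from below leave \<open>(\<alpha> - \<Lambda> k) * I u u \<le> \<beta>\<^sub>1 - \<alpha>\<close>, the energy of \<open>v\<close>
cancelling.
\<close>

lemma m_increment:
  assumes le: "\<alpha> \<le> \<beta>\<^sub>1" "\<beta>\<^sub>1 \<le> \<beta>\<^sub>2"
  shows "m \<beta>\<^sub>2 \<le> m \<beta>\<^sub>1"
    and "m \<beta>\<^sub>1 - m \<beta>\<^sub>2 \<le> (\<beta>\<^sub>2 - \<beta>\<^sub>1) * ((\<beta>\<^sub>1 - \<alpha>) / (\<alpha> - \<Lambda> k) + 1) / 2"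
proof -
  have le2: "\<alpha> \<le> \<beta>\<^sub>2" using le by simp
  obtain v where v: "v \<in> unit_sphere" "m \<beta>\<^sub>1 = M \<beta>\<^sub>1 v" using m_attained[OF le(1)] .
  obtain u where mx: "is_max \<beta>\<^sub>2 v u" using is_max_exists[OF unit_sphere_X2[OF v(1)] le2] .
  then have u: "u \<in> X1" by (simp add: is_max_def)
  have "m \<beta>\<^sub>2 \<le> Jf \<beta>\<^sub>2 (u + v)" using m_le[OF le2 v(1)] M_eq[OF mx] by simp
  also have "\<dots> \<le> Jf \<beta>\<^sub>1 (u + v)"
    using J_beta_diff[of "u + v" \<beta>\<^sub>2 \<beta>\<^sub>1] negsq_bounds[of "u + v"] u v le by simp
  also have "\<dots> \<le> m \<beta>\<^sub>1" using M_ge[OF unit_sphere_X2[OF v(1)] le(1) u] v by simp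
  finally show "m \<beta>\<^sub>2 \<le> m \<beta>\<^sub>1" .
next
  have le2: "\<alpha> \<le> \<beta>\<^sub>2" using le by simp
  obtain v where v: "v \<in> unit_sphere" "m \<beta>\<^sub>2 = M \<beta>\<^sub>2 v" using m_attained[OF le2] .
  obtain u where mx: "is_max \<beta>\<^sub>1 v u" using is_max_exists[OF unit_sphere_X2[OF v(1)] le(1)] .
  then have u: "u \<in> X1" by (simp add: is_max_def)
  have "(\<alpha> - \<Lambda> k) * I u u \<le> \<beta>\<^sub>1 - \<alpha>"
    using J_sum_le[OF u unit_sphere_X2[OF v(1)] le(1)] J_lower[of v \<beta>\<^sub>1] M_ge_J[of v \<beta>\<^sub>1]
      M_eq[OF mx] v le by simp
  then have Iu: "I u u \<le> (\<beta>\<^sub>1 - \<alpha>) / (\<alpha> - \<Lambda> k)" using gap by (simp add: field_simps)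
  have "I (u + v) (u + v) = I u u + 1"
    using u v X1_X2_orthogonal[of u v] by (simp add: I.square_add)
  then have q: "negsq (u + v) \<le> (\<beta>\<^sub>1 - \<alpha>) / (\<alpha> - \<Lambda> k) + 1"
    using negsq_bounds[of "u + v"] Iu u v by simp
  have "m \<beta>\<^sub>1 \<le> Jf \<beta>\<^sub>1 (u + v)" using m_le[OF le(1) v(1)] M_eq[OF mx] by simp
  also have "\<dots> = Jf \<beta>\<^sub>2 (u + v) + (\<beta>\<^sub>2 - \<beta>\<^sub>1) / 2 * negsq (u + v)"
    using J_beta_diff[of "u + v" \<beta>\<^sub>2 \<beta>\<^sub>1] u v by simp
  also have "Jf \<beta>\<^sub>2 (u + v) \<le> m \<beta>\<^sub>2" using M_ge[OF unit_sphere_X2[OF v(1)] le2 u] v by simp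
  also have "(\<beta>\<^sub>2 - \<beta>\<^sub>1) / 2 * negsq (u + v) \<le> (\<beta>\<^sub>2 - \<beta>\<^sub>1) / 2 * ((\<beta>\<^sub>1 - \<alpha>) / (\<alpha> - \<Lambda> k) + 1)"
    using q le by (intro mult_left_mono) auto
  finally show "m \<beta>\<^sub>1 - m \<beta>\<^sub>2 \<le> (\<beta>\<^sub>2 - \<beta>\<^sub>1) * ((\<beta>\<^sub>1 - \<alpha>) / (\<alpha> - \<Lambda> k) + 1) / 2"
    by (simp only: times_divide_eq_left) linarith
qed

lemma m_continuous: "continuous_on {\<alpha>..B} m"
proof -
  define L where "L = ((B - \<alpha>) / (\<alpha> - \<Lambda> k) + 1) / 2"
  have one: "\<bar>m x - m y\<bar> \<le> L * \<bar>x - y\<bar>" if "\<alpha> \<le> x" "x \<le> y" "y \<le> B" for x y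
  proof -
    have q: "(x - \<alpha>) / (\<alpha> - \<Lambda> k) \<le> (B - \<alpha>) / (\<alpha> - \<Lambda> k)"
      using that gap by (intro divide_right_mono) auto
    have "((x - \<alpha>) / (\<alpha> - \<Lambda> k) + 1) / 2 \<le> L"
      unfolding L_def by (rule divide_right_mono[OF add_right_mono[OF q]]) simp
    then have "(y - x) * (((x - \<alpha>) / (\<alpha> - \<Lambda> k) + 1) / 2) \<le> (y - x) * L"
      using that by (intro mult_left_mono) auto
    then show ?thesis using m_increment[OF that(1,2)] that by (simp add: mult.commute)
  qed
  show ?thesis
  proof (cases "\<alpha> \<le> B")
    case True
    have "L-lipschitz_on {\<alpha>..B} m"
    proof (rule lipschitz_onI)
      show "0 \<le> L" using True gap by (simp add: L_def)
      show "dist (m x) (m y) \<le> L * dist x y" if "x \<in> {\<alpha>..B}" "y \<in> {\<alpha>..B}" for x y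
        using one[of x y] one[of y x] that by (cases "x \<le> y") (auto simp: dist_real_def abs_minus_commute)
    qed
    then show ?thesis by (rule lipschitz_on_continuous_on)
  qed simp
qed

lemma \<alpha>_not_eigenvalue: "1 \<le> j \<Longrightarrow> \<Lambda> j \<noteq> \<alpha>"
  using \<Lambda>_mono[of j k] \<Lambda>_mono[of "k + 1" j] gap by (cases "j \<le> k") auto

text \<open>
A critical point without negative part solves the linear eigenvalue equation for \<open>\<alpha>\<close>.
\<close>

lemma nonneg_not_critical:
  assumes w: "w \<in> V" and 0: "negsq w = 0" and crit: "\<And>h. h \<in> V \<Longrightarrow> dJf \<beta> w h = 0"
  shows "I w w = 0"
proof (rule null_if_coef_zero[OF w])
  fix j :: nat assume j: "1 \<le> j"
  then have \<phi>: "\<phi> j \<in> V" by (rule \<phi>_V)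
  have "I (neg w) (\<phi> j) = 0" using 0 w \<phi> I.null_left[of "neg w" "\<phi> j"] by (simp add: negsq_def)
  then have "E w (\<phi> j) = \<alpha> * I w (\<phi> j)" using crit[OF \<phi>] w \<phi> by (simp add: dJ_alt)
  then have "E (\<phi> j) w = \<alpha> * I (\<phi> j) w"
    using E.commute[OF w \<phi>] I.commute[OF w \<phi>] by simp
  then have "(\<Lambda> j - \<alpha>) * coef j w = 0" using eigen[OF j w] by (simp add: coef_def algebra_simps)
  then show "coef j w = 0" using \<alpha>_not_eigenvalue[OF j] by simp
qed

text \<open>
If \<open>m \<beta>\<^sub>2\<close> were nonnegative, the point \<open>u + v\<close> made of the minimizer for \<open>\<beta>\<^sub>1\<close> and the maximum
point for \<open>\<beta>\<^sub>2\<close> would satisfy \<open>0 \<le> Jf \<beta>\<^sub>2 (u + v) \<le> Jf \<beta>\<^sub>1 (u + v) \<le> 0\<close>. The difference of the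
functionals is a multiple of \<open>negsq (u + v)\<close>, so this point is critical for \<open>\<beta>\<^sub>1\<close> and has no
negative part.
\<close>

lemma m_zero_strict:
  assumes le: "\<alpha> \<le> \<beta>\<^sub>1" "\<beta>\<^sub>1 < \<beta>\<^sub>2" and zero: "m \<beta>\<^sub>1 = 0"
  shows "m \<beta>\<^sub>2 < 0"
proof (rule ccontr)
  assume nn: "\<not> m \<beta>\<^sub>2 < 0"
  have le2: "\<alpha> \<le> \<beta>\<^sub>2" using le by simp
  obtain v where v: "v \<in> unit_sphere" "m \<beta>\<^sub>1 = M \<beta>\<^sub>1 v" using m_attained[OF le(1)] .
  obtain u where mx: "is_max \<beta>\<^sub>2 v u" using is_max_exists[OF unit_sphere_X2[OF v(1)] le2] .
  then have u: "u \<in> X1" by (simp add: is_max_def)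
  have uv: "u + v \<in> V" using u v by simp
  have "0 \<le> Jf \<beta>\<^sub>2 (u + v)" using m_le[OF le2 v(1)] M_eq[OF mx] nn by simp
  moreover have "Jf \<beta>\<^sub>1 (u + v) \<le> 0" using M_ge[OF unit_sphere_X2[OF v(1)] le(1) u] v zero by simp
  moreover have "0 \<le> (\<beta>\<^sub>2 - \<beta>\<^sub>1) / 2 * negsq (u + v)" using negsq_bounds[OF uv] le by simp
  ultimately have J0: "Jf \<beta>\<^sub>1 (u + v) = 0" and "(\<beta>\<^sub>2 - \<beta>\<^sub>1) / 2 * negsq (u + v) = 0"
    using J_beta_diff[OF uv, of \<beta>\<^sub>2 \<beta>\<^sub>1] by linarith+
  then have q0: "negsq (u + v) = 0" using le by simp
  have mx1: "is_max \<beta>\<^sub>1 v u"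
    using M_ge[OF unit_sphere_X2[OF v(1)] le(1)] v zero J0 u by (simp add: is_max_def)
  have "I (u + v) (u + v) = 0"
    using critical_at_zero[OF le(1) zero unit_sphere_X2[OF v(1)] _ mx1] v zero
    by (intro nonneg_not_critical[OF uv q0]) auto
  then show False using critical_nontrivial[OF u v(1)] by simp
qed

text \<open>
A value \<open>m b \<le> 0\<close> produces a zero of the continuous function \<open>m\<close>; it lies beyond \<open>\<Lambda> (k + 1)\<close> and
is the only one, and \<open>m\<close> is positive before it.
\<close>

theorem fucik_alternative:
  "(\<forall>\<beta>\<ge>\<alpha>. 0 < m \<beta> \<and> \<not> fucik \<beta>) \<or>
   (\<exists>\<beta>\<^sub>0. \<Lambda> (k + 1) < \<beta>\<^sub>0 \<and> m \<beta>\<^sub>0 = 0 \<and>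
      (\<forall>\<beta>. \<Lambda> (k + 1) < \<beta> \<and> m \<beta> = 0 \<longrightarrow> \<beta> = \<beta>\<^sub>0) \<and>
      fucik \<beta>\<^sub>0 \<and> (\<forall>\<beta>. \<alpha> \<le> \<beta> \<and> \<beta> < \<beta>\<^sub>0 \<longrightarrow> \<not> fucik \<beta>))"
proof (cases "\<forall>\<beta>\<ge>\<alpha>. 0 < m \<beta>")
  case True
  then show ?thesis using m_pos_imp_not_fucik by blast
next
  case False
  then obtain b where b: "\<alpha> \<le> b" "m b \<le> 0" by (auto simp: not_less)
  then obtain \<beta>\<^sub>0 where \<beta>0: "\<alpha> \<le> \<beta>\<^sub>0" "m \<beta>\<^sub>0 = 0"
    using IVT2'[of m b 0 \<alpha>] m_continuous m_pos_up_to_next_eigenvalue[of \<alpha>] gap by fastforce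
  have gt: "\<Lambda> (k + 1) < \<beta>\<^sub>0"
    using m_pos_up_to_next_eigenvalue[of \<beta>\<^sub>0] \<beta>0 by (cases "\<beta>\<^sub>0 \<le> \<Lambda> (k + 1)") auto
  have uniq: "\<beta> = \<beta>\<^sub>0" if "\<alpha> \<le> \<beta>" "m \<beta> = 0" for \<beta>
    using m_zero_strict[of \<beta> \<beta>\<^sub>0] m_zero_strict[of \<beta>\<^sub>0 \<beta>] that \<beta>0
    by (cases \<beta> \<beta>\<^sub>0 rule: linorder_cases) auto
  have "\<not> fucik \<beta>" if "\<alpha> \<le> \<beta>" "\<beta> < \<beta>\<^sub>0" for \<beta>
  proof (rule m_pos_imp_not_fucik)
    show "0 < m \<beta>" using m_increment(1)[of \<beta> \<beta>\<^sub>0] uniq[of \<beta>] that \<beta>0 by fastforce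
  qed (use that in simp)
  moreover have "\<forall>\<beta>. \<Lambda> (k + 1) < \<beta> \<and> m \<beta> = 0 \<longrightarrow> \<beta> = \<beta>\<^sub>0" using uniq gap by auto
  ultimately show ?thesis using gt \<beta>0 m_zero_imp_fucik[OF \<beta>0] by blast
qed

end

section \<open>Measurability and integrability on product spaces\<close>

text \<open>
Pointwise scalar multiplication turns functions into a real vector space to which the
variational argument applies directly.
\<close>

instantiation "fun" :: (type, scaleR) scaleR
begin

definition "c *\<^sub>R f = (\<lambda>x. c *\<^sub>R f x)"

instance ..

end

lemma scaleR_fun_apply [simp]: "(c *\<^sub>R f) x = c *\<^sub>R f x"
  by (simp add: scaleR_fun_def)

instance "fun" :: (type, real_vector) real_vector
  by standard (simp_all add: fun_eq_iff scaleR_add_right scaleR_add_left)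

lemma sum_fun_apply: "(\<Sum>j\<in>A. f j) x = (\<Sum>j\<in>A. f j x)" for f :: "'i \<Rightarrow> 'a \<Rightarrow> real"
  by (induction A rule: infinite_finite_induct) simp_all

text \<open>
Lebesgue measurable functions and null sets of one variable have to be transported to pairs \<open>(x,
y)\<close>, along the projections and the difference \<open>x - y\<close>. A Borel map alone does not preserve
Lebesgue measurability; preimages of null sets must be null.
\<close>

lemma lebesgue_pullback:
  fixes T :: "'a::euclidean_space \<Rightarrow> 'b::euclidean_space"
  assumes T: "T \<in> borel_measurable borel"
    and null: "\<And>N. N \<in> null_sets lborel \<Longrightarrow> T -` N \<in> null_sets lborel"
  shows "T \<in> lebesgue \<rightarrow>\<^sub>M lebesgue"
    and "(AE x in lebesgue. P x) \<Longrightarrow> (AE p in lebesgue. P (T p))"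
proof -
  have T': "T \<in> lebesgue \<rightarrow>\<^sub>M lborel"
    using T by (simp add: measurable_completion)
  show "T \<in> lebesgue \<rightarrow>\<^sub>M lebesgue"
  proof (rule completion.measurable_completion2[OF T'])
    show "null_sets lborel \<subseteq> null_sets (distr lebesgue lborel T)"
    proof
      fix N :: "'b set" assume N: "N \<in> null_sets lborel"
      have "T -` N \<inter> space lebesgue \<in> null_sets lebesgue"
        using null_sets_completionI[OF null[OF N]] by simp
      then show "N \<in> null_sets (distr lebesgue lborel T)"
        using null_setsD2[OF N] unfolding null_sets_distr_iff[OF T'] by blast
    qed
  qed
  show "AE p in lebesgue. P (T p)" if "AE x in lebesgue. P x"
  proof -
    from that have "AE x in lborel. P x" by (simp add: AE_completion_iff)
    then obtain N where N: "N \<in> null_sets lborel" "{x \<in> space lborel. \<not> P x} \<subseteq> N"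
      by (auto simp: eventually_ae_filter)
    have "AE p in lborel. p \<notin> T -` N" by (rule AE_not_in[OF null[OF N(1)]])
    then have "AE p in lborel. P (T p)" using N(2) by (auto elim!: eventually_mono)
    then show ?thesis by (rule AE_completion)
  qed
qed

lemma null_sets_vimage_fst:
  fixes N :: "'a::euclidean_space set"
  shows "N \<in> null_sets lborel \<Longrightarrow>
    (fst :: 'a \<times> 'b::euclidean_space \<Rightarrow> 'a) -` N \<in> null_sets lborel"
  using lborel.times_in_null_sets1[of N lborel "UNIV :: 'b set"]
  by (simp add: lborel_prod vimage_fst)

lemma null_sets_vimage_snd:
  fixes N :: "'b::euclidean_space set"
  shows "N \<in> null_sets lborel \<Longrightarrow>
    (snd :: 'a::euclidean_space \<times> 'b \<Rightarrow> 'b) -` N \<in> null_sets lborel"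
  using lborel.times_in_null_sets2[of "UNIV :: 'a set" lborel N]
  by (simp add: lborel_prod vimage_snd)

lemma distr_lborel_reflect: "distr lborel borel (\<lambda>y. x - y) = (lborel :: 'a::euclidean_space measure)"
  using lborel_affine[of "-1" x] by (simp add: density_1)

lemma distr_lborel_translate: "distr lborel borel (\<lambda>y. y - x) = (lborel :: 'a::euclidean_space measure)"
  using lborel_affine[of 1 "- x"] by (simp add: density_1)

lemma null_sets_vimage_minus:
  fixes N :: "'a::euclidean_space set"
  assumes N: "N \<in> null_sets lborel"
  shows "(\<lambda>p::'a \<times> 'a. fst p - snd p) -` N \<in> null_sets lborel"
proof -
  have NB: "N \<in> sets borel" using N by auto
  have mT: "(\<lambda>p::'a \<times> 'a. fst p - snd p) \<in> borel_measurable borel"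
    by (intro borel_measurable_continuous_onI continuous_intros)
  have S: "(\<lambda>p::'a \<times> 'a. fst p - snd p) -` N \<in> sets borel"
    using measurable_sets[OF mT NB] by simp
  have slice: "emeasure lborel (Pair x -` ((\<lambda>p::'a \<times> 'a. fst p - snd p) -` N)) = 0" for x
  proof -
    have "emeasure (distr lborel borel (\<lambda>y. x - y)) N = 0"
      using N by (simp add: distr_lborel_reflect null_setsD1)
    then show ?thesis using NB by (subst (asm) emeasure_distr) (auto simp: vimage_def)
  qed
  have "emeasure (lborel \<Otimes>\<^sub>M lborel) ((\<lambda>p::'a \<times> 'a. fst p - snd p) -` N) = 0"
  proof (subst lborel.emeasure_pair_measure_alt)
    show "(\<lambda>p::'a \<times> 'a. fst p - snd p) -` N \<in> sets (lborel \<Otimes>\<^sub>M lborel)"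
      unfolding lborel_prod using S by simp
  qed (simp add: slice)
  then show ?thesis using S by (simp add: lborel_prod null_sets_def)
qed

lemma measurable_borel_fst: "(fst :: 'a::euclidean_space \<times> 'b::euclidean_space \<Rightarrow> 'a) \<in> borel_measurable borel"
  and measurable_borel_snd: "(snd :: 'a::euclidean_space \<times> 'b::euclidean_space \<Rightarrow> 'b) \<in> borel_measurable borel"
  and measurable_borel_minus: "(\<lambda>p::'a \<times> 'a::euclidean_space. fst p - snd p) \<in> borel_measurable borel"
  by (intro borel_measurable_continuous_onI continuous_intros)+

lemma lebesgue_pullback_fst:
  shows "(fst :: 'a::euclidean_space \<times> 'b::euclidean_space \<Rightarrow> 'a) \<in> lebesgue \<rightarrow>\<^sub>M lebesgue"
    and "(AE x in lebesgue. P x) \<Longrightarrow>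
      (AE p in (lebesgue :: ('a::euclidean_space \<times> 'b::euclidean_space) measure). P (fst p))"
  using lebesgue_pullback[OF measurable_borel_fst] null_sets_vimage_fst by blast+

lemma lebesgue_pullback_snd:
  shows "(snd :: 'a::euclidean_space \<times> 'b::euclidean_space \<Rightarrow> 'b) \<in> lebesgue \<rightarrow>\<^sub>M lebesgue"
    and "(AE x in lebesgue. P x) \<Longrightarrow>
      (AE p in (lebesgue :: ('a::euclidean_space \<times> 'b::euclidean_space) measure). P (snd p))"
  using lebesgue_pullback[OF measurable_borel_snd] null_sets_vimage_snd by blast+

lemma lebesgue_pullback_minus:
  shows "(\<lambda>p::'a \<times> 'a::euclidean_space. fst p - snd p) \<in> lebesgue \<rightarrow>\<^sub>M lebesgue"
    and "(AE x in lebesgue. P x) \<Longrightarrow>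
      (AE p in (lebesgue :: ('a \<times> 'a::euclidean_space) measure). P (fst p - snd p))"
  using lebesgue_pullback[OF measurable_borel_minus] null_sets_vimage_minus by blast+

lemma integrable_mult_of_squares:
  fixes f g :: "'a \<Rightarrow> real"
  assumes "f \<in> borel_measurable M" "g \<in> borel_measurable M"
    and "integrable M (\<lambda>x. (f x)\<^sup>2)" "integrable M (\<lambda>x. (g x)\<^sup>2)"
  shows "integrable M (\<lambda>x. f x * g x)"
proof (rule Bochner_Integration.integrable_bound)
  show "integrable M (\<lambda>x. (f x)\<^sup>2 + (g x)\<^sup>2)" using assms by simp
  have "\<bar>a * b\<bar> \<le> a\<^sup>2 + b\<^sup>2" for a b :: real
  proof -
    have "2 * \<bar>a * b\<bar> \<le> a\<^sup>2 + b\<^sup>2"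
      using sum_squares_bound[of "\<bar>a\<bar>" "\<bar>b\<bar>"] by (simp add: abs_mult mult.assoc)
    then show ?thesis using abs_ge_zero[of "a * b"] by linarith
  qed
  then show "AE x in M. norm (f x * g x) \<le> norm ((f x)\<^sup>2 + (g x)\<^sup>2)"
    by (intro always_eventually) simp
qed (use assms in simp)

lemma integrable_square_add:
  fixes f g :: "'a \<Rightarrow> real"
  assumes "f \<in> borel_measurable M" "g \<in> borel_measurable M"
    and "integrable M (\<lambda>x. (f x)\<^sup>2)" "integrable M (\<lambda>x. (g x)\<^sup>2)"
  shows "integrable M (\<lambda>x. (f x + g x)\<^sup>2)"
  using integrable_mult_of_squares[OF assms] assms(3,4) by (simp add: power2_sum mult.assoc)

text \<open>
From \<open>|u| \<le> \<epsilon> + u\<^sup>2 / \<epsilon>\<close>, obtained by distinguishing \<open>|u| \<le> \<epsilon>\<close>. With \<open>\<epsilon>\<close> at choice, small \<open>L\<^sup>2\<close>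
norm implies small \<open>L\<^sup>1\<close> norm.
\<close>

lemma (in finite_measure)
  fixes u :: "'a \<Rightarrow> real"
  assumes m: "u \<in> borel_measurable M" and sq: "integrable M (\<lambda>x. (u x)\<^sup>2)" and \<epsilon>: "\<epsilon> > 0"
  shows integrable_if_square_integrable: "integrable M u"
    and integral_abs_le_square:
      "(LINT x|M. \<bar>u x\<bar>) \<le> \<epsilon> * measure M (space M) + (LINT x|M. (u x)\<^sup>2) / \<epsilon>"
proof -
  have le: "\<bar>u x\<bar> \<le> \<epsilon> + (u x)\<^sup>2 / \<epsilon>" for x
  proof (cases "\<bar>u x\<bar> \<le> \<epsilon>")
    case False
    then have "\<bar>u x\<bar> * \<epsilon> \<le> \<bar>u x\<bar> * \<bar>u x\<bar>" by (intro mult_left_mono) auto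
    then have "\<bar>u x\<bar> \<le> (u x)\<^sup>2 / \<epsilon>" using \<epsilon> by (simp add: field_simps power2_eq_square)
    then show ?thesis using \<epsilon> by simp
  next
    case True
    moreover have "0 \<le> (u x)\<^sup>2 / \<epsilon>" using \<epsilon> by simp
    ultimately show ?thesis by linarith
  qed
  have ib: "integrable M (\<lambda>x. \<epsilon> + (u x)\<^sup>2 / \<epsilon>)" using sq by simp
  show iu: "integrable M u"
  proof (rule Bochner_Integration.integrable_bound[OF ib m])
    have "norm (u x) \<le> norm (\<epsilon> + (u x)\<^sup>2 / \<epsilon>)" for x
      using le[of x] unfolding real_norm_def by linarith
    then show "AE x in M. norm (u x) \<le> norm (\<epsilon> + (u x)\<^sup>2 / \<epsilon>)" by simp
  qed
  have "(LINT x|M. \<bar>u x\<bar>) \<le> (LINT x|M. \<epsilon> + (u x)\<^sup>2 / \<epsilon>)"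
    using iu ib le by (intro integral_mono) auto
  also have "\<dots> = \<epsilon> * measure M (space M) + (LINT x|M. (u x)\<^sup>2) / \<epsilon>"
    using sq by (simp add: mult.commute)
  finally show "(LINT x|M. \<bar>u x\<bar>) \<le> \<epsilon> * measure M (space M) + (LINT x|M. (u x)\<^sup>2) / \<epsilon>" .
qed

lemma integrable_lebesgue_on:
  fixes f :: "'a::euclidean_space \<Rightarrow> real"
  shows "S \<in> sets lebesgue \<Longrightarrow> integrable lebesgue f \<Longrightarrow> integrable (lebesgue_on S) f"
  by (simp add: integrable_restrict_space integrable_mult_indicator del: real_scaleR_def)

text \<open>
By Tonelli and the invariance of Lebesgue measure under translation and reflection, both
integrals equal the measure of \<open>B\<close> times the integral of \<open>H\<close>. The Borel version \<open>h\<close> of \<open>H\<close> makes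
the iterated integrals available.
\<close>

lemma integrable_strip:
  fixes H :: "'a::euclidean_space \<Rightarrow> real" and B :: "'a set"
  assumes H: "integrable lebesgue H" and B: "B \<in> sets borel" "emeasure lborel B < \<infinity>"
  shows "integrable lebesgue (\<lambda>p. indicator B (fst p) * H (fst p - snd p))"
    and "integrable lebesgue (\<lambda>p. indicator B (snd p) * H (fst p - snd p))"
proof -
  obtain h where h [measurable]: "h \<in> borel_measurable borel" and Hh: "AE x in lborel. H x = h x"
    using completion_ex_borel_measurable_real[of H lborel] H by auto
  have B' [measurable]: "B \<in> sets borel" by (rule B(1))
  define c where "c = (\<integral>\<^sup>+x. ennreal \<bar>h x\<bar> \<partial>lborel)"
  have c: "c < \<infinity>"
  proof -
    have "c = (\<integral>\<^sup>+x. ennreal (norm (H x)) \<partial>lborel)"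
      unfolding c_def using Hh by (intro nn_integral_cong_AE) auto
    also have "\<dots> < \<infinity>" using H by (simp add: integrable_iff_bounded nn_integral_completion)
    finally show ?thesis .
  qed
  have Hp: "(\<lambda>p::'a \<times> 'a. H (fst p - snd p)) \<in> borel_measurable lebesgue"
    using measurable_compose[OF lebesgue_pullback_minus(1)] H by blast
  have ae: "AE p in (lborel \<Otimes>\<^sub>M lborel :: ('a \<times> 'a) measure). H (fst p - snd p) = h (fst p - snd p)"
    using lebesgue_pullback_minus(2)[of "\<lambda>z. H z = h z"] Hh
    unfolding lborel_prod by (simp add: AE_completion_iff)
  have hm [measurable]: "(\<lambda>p::'a \<times> 'a. h (fst p - snd p)) \<in> borel_measurable (lborel \<Otimes>\<^sub>M lborel)"
    by measurable
  have ind: "(indicator B :: 'a \<Rightarrow> real) \<in> borel_measurable lebesgue"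
    by (simp add: measurable_completion)
  note fst_m = measurable_compose[OF lebesgue_pullback_fst(1) ind]
    and snd_m = measurable_compose[OF lebesgue_pullback_snd(1) ind]
  have strip: "(\<integral>\<^sup>+p. ennreal (norm (indicator B (q p) * H (fst p - snd p))) \<partial>(lebesgue :: ('a \<times> 'a) measure))
      = (\<integral>\<^sup>+p. indicator B (q p) * ennreal \<bar>h (fst p - snd p)\<bar> \<partial>(lborel \<Otimes>\<^sub>M lborel))" for q
    unfolding nn_integral_completion lborel_prod[symmetric] using ae
    by (intro nn_integral_cong_AE) (auto elim!: eventually_mono split: split_indicator)
  show "integrable lebesgue (\<lambda>p. indicator B (fst p) * H (fst p - snd p))"
  proof (rule integrableI_bounded)
    show "(\<lambda>p. indicator B (fst p) * H (fst p - snd p)) \<in> borel_measurable lebesgue"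
      using fst_m Hp by (rule borel_measurable_times)
    have "(\<integral>\<^sup>+p. indicator B (fst p) * ennreal \<bar>h (fst p - snd p)\<bar> \<partial>(lborel \<Otimes>\<^sub>M lborel))
        = (\<integral>\<^sup>+x. \<integral>\<^sup>+y. indicator B x * ennreal \<bar>h (x - y)\<bar> \<partial>lborel \<partial>lborel)"
      by (subst lborel.nn_integral_fst[symmetric]) simp_all
    also have "\<dots> = (\<integral>\<^sup>+x. indicator B x * c \<partial>lborel)"
    proof (rule nn_integral_cong)
      fix x
      have "c = (\<integral>\<^sup>+z. ennreal \<bar>h z\<bar> \<partial>distr lborel borel (\<lambda>y. x - y))"
        by (simp add: c_def distr_lborel_reflect)
      also have "\<dots> = (\<integral>\<^sup>+y. ennreal \<bar>h (x - y)\<bar> \<partial>lborel)"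
        by (subst nn_integral_distr) simp_all
      finally show "(\<integral>\<^sup>+y. indicator B x * ennreal \<bar>h (x - y)\<bar> \<partial>lborel) = indicator B x * c"
        by (subst nn_integral_cmult) simp_all
    qed
    also have "\<dots> = emeasure lborel B * c" by (subst nn_integral_multc) simp_all
    also have "\<dots> < \<infinity>" using B(2) c by (simp add: ennreal_mult_less_top)
    finally show "(\<integral>\<^sup>+p. ennreal (norm (indicator B (fst p) * H (fst p - snd p))) \<partial>lebesgue) < \<infinity>"
      unfolding strip .
  qed
  show "integrable lebesgue (\<lambda>p. indicator B (snd p) * H (fst p - snd p))"
  proof (rule integrableI_bounded)
    show "(\<lambda>p. indicator B (snd p) * H (fst p - snd p)) \<in> borel_measurable lebesgue"
      using snd_m Hp by (rule borel_measurable_times)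
    have "(\<integral>\<^sup>+p. indicator B (snd p) * ennreal \<bar>h (fst p - snd p)\<bar> \<partial>(lborel \<Otimes>\<^sub>M lborel))
        = (\<integral>\<^sup>+y. \<integral>\<^sup>+x. indicator B y * ennreal \<bar>h (x - y)\<bar> \<partial>lborel \<partial>lborel)"
      by (subst lborel_pair.nn_integral_snd[symmetric]) simp_all
    also have "\<dots> = (\<integral>\<^sup>+y. indicator B y * c \<partial>lborel)"
    proof (rule nn_integral_cong)
      fix y
      have "c = (\<integral>\<^sup>+z. ennreal \<bar>h z\<bar> \<partial>distr lborel borel (\<lambda>x. x - y))"
        by (simp add: c_def distr_lborel_translate)
      also have "\<dots> = (\<integral>\<^sup>+x. ennreal \<bar>h (x - y)\<bar> \<partial>lborel)"
        by (subst nn_integral_distr) simp_all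
      finally show "(\<integral>\<^sup>+x. indicator B y * ennreal \<bar>h (x - y)\<bar> \<partial>lborel) = indicator B y * c"
        by (subst nn_integral_cmult) simp_all
    qed
    also have "\<dots> = emeasure lborel B * c" by (subst nn_integral_multc) simp_all
    also have "\<dots> < \<infinity>" using B(2) c by (simp add: ennreal_mult_less_top)
    finally show "(\<integral>\<^sup>+p. ennreal (norm (indicator B (snd p) * H (fst p - snd p))) \<partial>lebesgue) < \<infinity>"
      unfolding strip .
  qed
qed

lemma measure_lebesgue_times_balls:
  fixes x :: "'a::euclidean_space" and y :: "'b::euclidean_space"
  shows "ball x r \<times> ball y q \<in> lmeasurable"
    and "measure lebesgue (ball x r \<times> ball y q) = measure lebesgue (ball x r) * measure lebesgue (ball y q)"
proof -
  have S: "ball x r \<times> ball y q \<in> sets lborel"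
    using borel_open[OF open_Times[OF open_ball open_ball]] by simp
  have e: "emeasure lborel (ball x r \<times> ball y q) = emeasure lborel (ball x r) * emeasure lborel (ball y q)"
    unfolding lborel_prod[symmetric] by (rule lborel.emeasure_pair_measure_Times) simp_all
  show "ball x r \<times> ball y q \<in> lmeasurable"
    by (rule lmeasurable_open) (simp_all add: bounded_Times open_Times)
  show "measure lebesgue (ball x r \<times> ball y q) = measure lebesgue (ball x r) * measure lebesgue (ball y q)"
    using S e by (simp add: measure_completion measure_def enn2real_mult)
qed

section \<open>The space of finite energy\<close>

text \<open>
The form of Fatou's lemma that yields membership in \<open>L\<^sup>2\<close> of an almost everywhere limit together
with its norm bound.
\<close>

lemma fatou_square:
  fixes f :: "nat \<Rightarrow> 'a \<Rightarrow> real"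
  assumes meas: "\<And>n. f n \<in> borel_measurable M" "g \<in> borel_measurable M"
    and int: "\<And>n. integrable M (\<lambda>x. (f n x)\<^sup>2)"
    and bound: "\<And>n. (LINT x|M. (f n x)\<^sup>2) \<le> C"
    and lim: "AE x in M. (\<lambda>n. f n x) \<longlonglongrightarrow> g x"
  shows "integrable M (\<lambda>x. (g x)\<^sup>2)" and "(LINT x|M. (g x)\<^sup>2) \<le> C"
proof -
  have C0: "0 \<le> C" using order_trans[OF integral_nonneg_AE bound[of 0]] by simp
  have "(\<integral>\<^sup>+x. ennreal ((g x)\<^sup>2) \<partial>M) = (\<integral>\<^sup>+x. liminf (\<lambda>n. ennreal ((f n x)\<^sup>2)) \<partial>M)"
  proof (rule nn_integral_cong_AE)
    show "AE x in M. ennreal ((g x)\<^sup>2) = liminf (\<lambda>n. ennreal ((f n x)\<^sup>2))"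
      using lim
    proof eventually_elim
      case (elim x)
      then have "(\<lambda>n. ennreal ((f n x)\<^sup>2)) \<longlonglongrightarrow> ennreal ((g x)\<^sup>2)"
        by (intro tendsto_ennrealI tendsto_intros)
      then have "liminf (\<lambda>n. ennreal ((f n x)\<^sup>2)) = ennreal ((g x)\<^sup>2)"
        by (rule lim_imp_Liminf[OF sequentially_bot])
      then show ?case by (rule sym)
    qed
  qed
  also have "\<dots> \<le> liminf (\<lambda>n. \<integral>\<^sup>+x. ennreal ((f n x)\<^sup>2) \<partial>M)"
    using meas by (intro nn_integral_liminf) simp
  also have "\<dots> \<le> ennreal C"
  proof -
    have "(\<integral>\<^sup>+x. ennreal ((f n x)\<^sup>2) \<partial>M) \<le> ennreal C" for n
      using bound[of n] by (subst nn_integral_eq_integral[OF int]) (auto intro: ennreal_leI)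
    then show ?thesis
      by (intro order_trans[OF Liminf_le_Limsup Limsup_bounded]) auto
  qed
  finally have nn: "(\<integral>\<^sup>+x. ennreal ((g x)\<^sup>2) \<partial>M) \<le> ennreal C" .
  show i: "integrable M (\<lambda>x. (g x)\<^sup>2)"
    using nn meas(2) by (intro integrableI_bounded) 
        (auto simp: top_unique less_top[symmetric] intro: le_less_trans)
  show "(LINT x|M. (g x)\<^sup>2) \<le> C"
    using nn C0 by (simp add: nn_integral_eq_integral[OF i])
qed

locale nonlocal_setting =
  fixes K :: "real ^ 'n \<Rightarrow> real" and \<Omega> :: "(real ^ 'n) set" and s :: real
  assumes s: "0 < s" and domain: "bounded_lipschitz_domain \<Omega>" and kernel: "admissible_kernel s K"
begin

abbreviation X0 :: "(real ^ 'n \<Rightarrow> real) set" where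
  "X0 \<equiv> X0_space K \<Omega>"

abbreviation LQ :: "((real ^ 'n) \<times> (real ^ 'n)) measure" where
  "LQ \<equiv> lebesgue_on (Q_set \<Omega>)"

text \<open>
Half of the kernel is put on each increment, so that the energy form becomes an \<open>L\<^sup>2\<close> product of
\<open>D u\<close> and \<open>D v\<close>.
\<close>

definition D :: "(real ^ 'n \<Rightarrow> real) \<Rightarrow> (real ^ 'n) \<times> (real ^ 'n) \<Rightarrow> real" where
  "D u p = (u (fst p) - u (snd p)) * sqrt (K (fst p - snd p))"

lemma open_\<Omega>: "open \<Omega>" and bounded_\<Omega>: "bounded \<Omega>" and \<Omega>_nonempty: "\<Omega> \<noteq> {}"
  using domain by (auto simp: bounded_lipschitz_domain_def)

lemma \<Omega>_sets [simp, measurable]: "\<Omega> \<in> sets lebesgue"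
  using open_\<Omega> by (simp add: borel_open)

lemma finite_\<Omega>: "finite_measure (lebesgue_on \<Omega>)"
proof
  have "\<Omega> \<in> lmeasurable"
    using bounded_\<Omega> open_\<Omega> by (simp add: lmeasurable_open)
  then show "emeasure (lebesgue_on \<Omega>) (space (lebesgue_on \<Omega>)) \<noteq> \<infinity>"
    by (simp add: emeasure_restrict_space fmeasurable_def less_top[symmetric])
qed

lemma Q_sets [simp, measurable]: "Q_set \<Omega> \<in> sets lebesgue"
proof -
  have "closed ((UNIV - \<Omega>) \<times> (UNIV - \<Omega>))"
    using open_\<Omega> by (intro closed_Times) (auto simp: closed_def Compl_eq_Diff_UNIV[symmetric])
  then have "open (Q_set \<Omega>)" by (simp add: Q_set_def open_Diff)
  then show ?thesis by (simp add: borel_open)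
qed

lemma K_pos: "x \<noteq> 0 \<Longrightarrow> 0 < K x"
  and K_integrable: "integrable lebesgue (\<lambda>x. min ((norm x)\<^sup>2) 1 * K x)"
  using kernel by (auto simp: admissible_kernel_def)

text \<open>
Measurability of \<open>K\<close> is hidden in the integrability of \<open>min |x|\<^sup>2 1 * K x\<close>; dividing recovers
\<open>K\<close> except at the origin.
\<close>

lemma K_measurable [measurable]: "K \<in> borel_measurable lebesgue"
proof -
  have [measurable]: "(\<lambda>x. min ((norm x)\<^sup>2) 1 * K x) \<in> borel_measurable lebesgue"
    using K_integrable by auto
  have [measurable]: "(\<lambda>x::real ^ 'n. min ((norm x)\<^sup>2) 1) \<in> borel_measurable lebesgue"
    by (intro measurable_completion) simp
  have [measurable]: "{0 :: real ^ 'n} \<in> sets lebesgue" by simp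
  have "K = (\<lambda>x. if x \<in> {0} then K 0 else (min ((norm x)\<^sup>2) 1 * K x) / min ((norm x)\<^sup>2) 1)"
    by (auto simp: fun_eq_iff min_def)
  also have "\<dots> \<in> borel_measurable lebesgue" by measurable
  finally show ?thesis .
qed

lemma D_measurable:
  assumes "u \<in> borel_measurable lebesgue"
  shows "D u \<in> borel_measurable lebesgue" "D u \<in> borel_measurable LQ"
proof -
  have "(\<lambda>p::(real ^ 'n) \<times> (real ^ 'n). u (fst p)) \<in> borel_measurable lebesgue"
    "(\<lambda>p::(real ^ 'n) \<times> (real ^ 'n). u (snd p)) \<in> borel_measurable lebesgue"
    "(\<lambda>p::(real ^ 'n) \<times> (real ^ 'n). K (fst p - snd p)) \<in> borel_measurable lebesgue"
    using measurable_compose[OF lebesgue_pullback_fst(1) assms]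
      measurable_compose[OF lebesgue_pullback_snd(1) assms]
      measurable_compose[OF lebesgue_pullback_minus(1) K_measurable] by simp_all
  then show "D u \<in> borel_measurable lebesgue" unfolding D_def[abs_def] by measurable
  then show "D u \<in> borel_measurable LQ" by (rule measurable_restrict_space1)
qed

lemma D_mult: "D u (x, y) * D v (x, y) = (u x - u y) * (v x - v y) * K (x - y)"
  using K_pos[of "x - y"] by (cases "x = y") (simp_all add: D_def)

lemma D_square: "(D u (x, y))\<^sup>2 = (u x - u y)\<^sup>2 * K (x - y)"
  using D_mult[of u x y u] by (simp add: power2_eq_square)

lemma D_add: "D (u + v) p = D u p + D v p"
  and D_scale: "D (c *\<^sub>R u) p = c * D u p"
  by (simp_all add: D_def algebra_simps)

lemma X0_iff: "u \<in> X0 \<longleftrightarrow> u \<in> borel_measurable lebesgue \<and>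
    integrable (lebesgue_on \<Omega>) (\<lambda>x. (u x)\<^sup>2) \<and> integrable LQ (\<lambda>p. (D u p)\<^sup>2) \<and>
    (AE x in lebesgue. x \<notin> \<Omega> \<longrightarrow> u x = 0)"
proof -
  have "(\<lambda>(x, y). (u x - u y) * sqrt (K (x - y))) = D u"
    by (auto simp: D_def)
  then show ?thesis
    using D_measurable[of u]
    by (auto simp: X0_space_def X_space_def L2_on_def intro: measurable_restrict_space1)
qed

lemma X0_inner_eq: "X0_inner K \<Omega> u v = (LINT p|LQ. D u p * D v p)"
  unfolding X0_inner_def by (intro Bochner_Integration.integral_cong) (auto simp: D_mult)

lemma X0_measurable: "u \<in> X0 \<Longrightarrow> u \<in> borel_measurable (lebesgue_on \<Omega>)"
  by (auto simp: X0_iff intro: measurable_restrict_space1)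

lemma X0_integrable_mult: "u \<in> X0 \<Longrightarrow> v \<in> X0 \<Longrightarrow> integrable (lebesgue_on \<Omega>) (\<lambda>x. u x * v x)"
  by (intro integrable_mult_of_squares X0_measurable) (auto simp: X0_iff)

lemma X0_integrable_D: "u \<in> X0 \<Longrightarrow> v \<in> X0 \<Longrightarrow> integrable LQ (\<lambda>p. D u p * D v p)"
  by (intro integrable_mult_of_squares D_measurable) (auto simp: X0_iff)

lemma subspace_X0: "subspace X0"
  unfolding subspace_def
proof (intro conjI ballI allI)
  show "0 \<in> X0" by (simp add: X0_iff D_def) (simp add: zero_fun_def)
  fix u v assume u: "u \<in> X0" and v: "v \<in> X0"
  have um: "u \<in> borel_measurable lebesgue" "v \<in> borel_measurable lebesgue"
    using u v by (simp_all add: X0_iff)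
  have "(u + v) \<in> borel_measurable lebesgue"
    unfolding plus_fun_def using um by simp
  moreover have "integrable (lebesgue_on \<Omega>) (\<lambda>x. ((u + v) x)\<^sup>2)"
    using integrable_square_add[OF X0_measurable[OF u] X0_measurable[OF v]] u v
    by (simp add: X0_iff)
  moreover have "integrable LQ (\<lambda>p. (D (u + v) p)\<^sup>2)"
    using integrable_square_add[OF D_measurable(2)[OF um(1)] D_measurable(2)[OF um(2)]] u v
    by (simp add: X0_iff D_add)
  moreover have "AE x in lebesgue. x \<notin> \<Omega> \<longrightarrow> (u + v) x = 0"
  proof -
    have "AE x in lebesgue. x \<notin> \<Omega> \<longrightarrow> u x = 0" "AE x in lebesgue. x \<notin> \<Omega> \<longrightarrow> v x = 0"
      using u v by (simp_all add: X0_iff)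
    then show ?thesis by eventually_elim simp
  qed
  ultimately show "u + v \<in> X0" by (simp add: X0_iff)
next
  fix c u assume u: "u \<in> X0"
  have "AE x in lebesgue. x \<notin> \<Omega> \<longrightarrow> u x = 0" using u by (simp add: X0_iff)
  then have "AE x in lebesgue. x \<notin> \<Omega> \<longrightarrow> (c *\<^sub>R u) x = 0" by eventually_elim simp
  moreover have "(c *\<^sub>R u) \<in> borel_measurable lebesgue"
  proof -
    have [measurable]: "u \<in> borel_measurable lebesgue" using u by (simp add: X0_iff)
    show ?thesis unfolding scaleR_fun_def by measurable
  qed
  ultimately show "c *\<^sub>R u \<in> X0" using u by (simp add: X0_iff D_scale power_mult_distrib)
qed


lemma semi_inner_E: "semi_inner X0 (X0_inner K \<Omega>)"
proof
  fix u v w assume "u \<in> X0" "v \<in> X0" "w \<in> X0"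
  then show "X0_inner K \<Omega> (u + v) w = X0_inner K \<Omega> u w + X0_inner K \<Omega> v w"
    using X0_integrable_D[of u w] X0_integrable_D[of v w]
    by (simp add: X0_inner_eq D_add distrib_right)
qed (auto simp: X0_inner_eq D_scale mult.commute mult.left_commute subspace_X0)

lemma semi_inner_I: "semi_inner X0 (L2_inner \<Omega>)"
proof
  fix u v w assume "u \<in> X0" "v \<in> X0" "w \<in> X0"
  then show "L2_inner \<Omega> (u + v) w = L2_inner \<Omega> u w + L2_inner \<Omega> v w"
    using X0_integrable_mult[of u w] X0_integrable_mult[of v w]
    by (simp add: L2_inner_def distrib_right)
qed (auto simp: L2_inner_def mult.commute mult.left_commute subspace_X0)

lemma AE_zero_iff:
  assumes "u \<in> X0"
  shows "L2_inner \<Omega> u u = 0 \<longleftrightarrow> (AE x in lebesgue. u x = 0)"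
proof -
  have "L2_inner \<Omega> u u = 0 \<longleftrightarrow> (AE x in lebesgue_on \<Omega>. u x = 0)"
    unfolding L2_inner_def using X0_integrable_mult[OF assms assms]
    by (subst integral_nonneg_eq_0_iff_AE) auto
  also have "\<dots> \<longleftrightarrow> (AE x in lebesgue. x \<in> \<Omega> \<longrightarrow> u x = 0)"
    by (rule AE_restrict_space_iff) simp
  also have "\<dots> \<longleftrightarrow> (AE x in lebesgue. u x = 0)"
  proof
    have "AE x in lebesgue. x \<notin> \<Omega> \<longrightarrow> u x = 0" using assms by (simp add: X0_iff)
    moreover assume "AE x in lebesgue. x \<in> \<Omega> \<longrightarrow> u x = 0"
    ultimately show "AE x in lebesgue. u x = 0" by eventually_elim auto
  qed (auto elim: eventually_mono)
  finally show ?thesis .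
qed

lemma pos_part_X0:
  assumes u: "u \<in> X0"
  shows "pos_part u \<in> X0"
proof -
  have m: "pos_part u \<in> borel_measurable lebesgue"
  proof -
    have [measurable]: "u \<in> borel_measurable lebesgue" using u by (simp add: X0_iff)
    show ?thesis unfolding pos_part_def[abs_def] by measurable
  qed
  have "integrable (lebesgue_on \<Omega>) (\<lambda>x. (pos_part u x)\<^sup>2)"
  proof (rule Bochner_Integration.integrable_bound)
    show "integrable (lebesgue_on \<Omega>) (\<lambda>x. (u x)\<^sup>2)" using u by (simp add: X0_iff)
    show "(\<lambda>x. (pos_part u x)\<^sup>2) \<in> borel_measurable (lebesgue_on \<Omega>)"
      using measurable_restrict_space1[OF m] by simp
  qed (auto simp: pos_part_def max_def)
  moreover have "integrable LQ (\<lambda>p. (D (pos_part u) p)\<^sup>2)"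
  proof (rule Bochner_Integration.integrable_bound)
    show "integrable LQ (\<lambda>p. (D u p)\<^sup>2)" using u by (simp add: X0_iff)
    show "(\<lambda>p. (D (pos_part u) p)\<^sup>2) \<in> borel_measurable LQ" using D_measurable(2)[OF m] by simp
    have "(D (pos_part u) p)\<^sup>2 \<le> (D u p)\<^sup>2" for p
    proof -
      have "\<bar>pos_part u (fst p) - pos_part u (snd p)\<bar> \<le> \<bar>u (fst p) - u (snd p)\<bar>"
        by (auto simp: pos_part_def)
      then have "\<bar>D (pos_part u) p\<bar> \<le> \<bar>D u p\<bar>" by (simp add: D_def abs_mult mult_right_mono)
      then show ?thesis by (simp add: abs_le_square_iff)
    qed
    then show "AE p in LQ. norm ((D (pos_part u) p)\<^sup>2) \<le> norm ((D u p)\<^sup>2)" by simp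
  qed
  moreover have "AE x in lebesgue. x \<notin> \<Omega> \<longrightarrow> pos_part u x = 0"
  proof -
    have "AE x in lebesgue. x \<notin> \<Omega> \<longrightarrow> u x = 0" using u by (simp add: X0_iff)
    then show ?thesis by eventually_elim (simp add: pos_part_def)
  qed
  ultimately show ?thesis using m by (simp add: X0_iff)
qed

text \<open>
Where \<open>f g = 0\<close>, the product of the increments is \<open>- (f x * g y + f y * g x)\<close>, and \<open>K > 0\<close> off
the diagonal. A nonnegative integral thus forces \<open>f x * g y = 0\<close> for almost all pairs, and by
Fubini one of the two functions vanishes almost everywhere.
\<close>

lemma disjoint_nonneg_form:
  assumes f: "f \<in> X0" "\<And>x. 0 \<le> f x" and g: "g \<in> X0" "\<And>x. 0 \<le> g x"
    and I0: "L2_inner \<Omega> f g = 0" and E0: "0 \<le> X0_inner K \<Omega> f g"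
  shows "L2_inner \<Omega> f f = 0 \<or> L2_inner \<Omega> g g = 0"
proof -
  have out: "AE x in lebesgue. x \<notin> \<Omega> \<longrightarrow> f x = 0" "AE x in lebesgue. x \<notin> \<Omega> \<longrightarrow> g x = 0"
    using f g by (simp_all add: X0_iff)
  have "AE x in lebesgue_on \<Omega>. f x * g x = 0"
    using I0 X0_integrable_mult[OF f(1) g(1)] f(2) g(2) unfolding L2_inner_def
    by (subst (asm) integral_nonneg_eq_0_iff_AE) auto
  then have "AE x in lebesgue. x \<in> \<Omega> \<longrightarrow> f x * g x = 0"
    by (subst (asm) AE_restrict_space_iff) auto
  with out have prod: "AE x in lebesgue. (x \<notin> \<Omega> \<longrightarrow> f x = 0 \<and> g x = 0) \<and> f x * g x = 0"
    by eventually_elim auto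
  have both: "AE p in lebesgue. (fst p \<notin> \<Omega> \<longrightarrow> f (fst p) = 0 \<and> g (fst p) = 0) \<and>
      (snd p \<notin> \<Omega> \<longrightarrow> f (snd p) = 0 \<and> g (snd p) = 0) \<and>
      f (fst p) * g (fst p) = 0 \<and> f (snd p) * g (snd p) = 0"
    using lebesgue_pullback_fst(2)[OF prod] lebesgue_pullback_snd(2)[OF prod] by eventually_elim auto
  have le: "f (fst p) * g (snd p) = 0 \<and> f (snd p) * g (fst p) = 0 \<or> D f p * D g p < 0"
    if "f (fst p) * g (fst p) = 0" "f (snd p) * g (snd p) = 0" for p
  proof (cases "fst p = snd p")
    case False
    then have "0 < K (fst p - snd p)" by (intro K_pos) simp
    moreover have "D f p * D g p
        = - ((f (fst p) * g (snd p) + f (snd p) * g (fst p)) * K (fst p - snd p))"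
      using D_mult[of f "fst p" "snd p" g] that by (simp add: algebra_simps)
    moreover have "0 \<le> f (fst p) * g (snd p)" "0 \<le> f (snd p) * g (fst p)"
      using f(2) g(2) by simp_all
    ultimately show ?thesis
      by (smt (verit) mult_pos_pos)
  qed (use that in auto)
  have nonpos: "AE p in LQ. 0 \<le> - (D f p * D g p)"
  proof -
    have "AE p in lebesgue. D f p * D g p \<le> 0"
      using both
    proof eventually_elim
      case (elim p)
      then have *: "f (fst p) * g (fst p) = 0" "f (snd p) * g (snd p) = 0" by auto
      from le[OF *] show ?case
        using D_mult[of f "fst p" "snd p" g] * by (auto simp: algebra_simps)
    qed
    then show ?thesis by (subst AE_restrict_space_iff) auto
  qed
  have int: "integrable LQ (\<lambda>p. - (D f p * D g p))" using X0_integrable_D[OF f(1) g(1)] by simp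
  have "(LINT p|LQ. - (D f p * D g p)) \<le> 0" using E0 by (simp add: X0_inner_eq)
  moreover have "0 \<le> (LINT p|LQ. - (D f p * D g p))" using nonpos by (rule integral_nonneg_AE)
  ultimately have "(LINT p|LQ. - (D f p * D g p)) = 0" by linarith
  then have "AE p in LQ. - (D f p * D g p) = 0"
    using integral_nonneg_eq_0_iff_AE[OF int nonpos] by simp
  then have "AE p in lebesgue. p \<in> Q_set \<Omega> \<longrightarrow> D f p * D g p = 0"
    by (subst (asm) AE_restrict_space_iff) auto
  with both have "AE p in lebesgue. f (fst p) * g (snd p) = 0"
  proof eventually_elim
    case (elim p)
    show ?case
    proof (cases "p \<in> Q_set \<Omega>")
      case True
      then have "D f p * D g p = 0" using elim by simp
      then show ?thesis using le[of p] elim by auto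
    next
      case False
      then have "fst p \<notin> \<Omega>" by (auto simp: Q_set_def)
      then show ?thesis using elim by simp
    qed
  qed
  then have "AE p in lborel \<Otimes>\<^sub>M lborel. f (fst p) * g (snd p) = 0"
    unfolding lborel_prod by (simp add: AE_completion_iff)
  then have fg: "AE x in lborel. AE y in lborel. f x * g y = 0"
    using lborel_pair.AE_pair[of "\<lambda>p. f (fst p) * g (snd p) = 0"] by simp
  have "(AE x in lebesgue. f x = 0) \<or> (AE x in lebesgue. g x = 0)"
  proof (rule disjCI)
    assume "\<not> (AE x in lebesgue. g x = 0)"
    then have g0: "\<not> (AE x in lborel. g x = 0)" by (simp add: AE_completion_iff)
    from fg have "AE x in lborel. f x = 0"
    proof eventually_elim
      case (elim x)
      with g0 show ?case by (cases "f x = 0") auto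
    qed
    then show "AE x in lebesgue. f x = 0" by (rule AE_completion)
  qed
  then show ?thesis using AE_zero_iff f(1) g(1) by blast
qed

text \<open>
On the bounded set \<open>\<Omega>\<close> a Cauchy sequence in \<open>L\<^sup>2\<close> is Cauchy in \<open>L\<^sup>1\<close>, so a subsequence converges
almost everywhere. Fatou's lemma, applied to the energies, to the \<open>L\<^sup>2\<close> norms and to the
differences \<open>f n - f m\<close>, shows that the limit belongs to \<open>X0\<close> and is the limit in \<open>L\<^sup>2\<close>.
\<close>

lemma X0_closed:
  fixes f :: "nat \<Rightarrow> real ^ 'n \<Rightarrow> real"
  assumes f: "\<And>n. f n \<in> X0" and C: "\<And>n. X0_inner K \<Omega> (f n) (f n) \<le> C"
    and cauchy: "\<And>\<epsilon>. \<epsilon> > 0 \<Longrightarrow> \<exists>N. \<forall>m\<ge>N. \<forall>n\<ge>N. L2_inner \<Omega> (f m - f n) (f m - f n) < \<epsilon>"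
  shows "\<exists>v\<in>X0. (\<lambda>n. L2_inner \<Omega> (f n - v) (f n - v)) \<longlonglongrightarrow> 0"
proof -
  interpret I: semi_inner X0 "L2_inner \<Omega>" by (rule semi_inner_I)
  interpret finite_measure "lebesgue_on \<Omega>" by (rule finite_\<Omega>)
  let ?L = "lebesgue_on \<Omega>"
  define vol where "vol = measure ?L (space ?L)"
  have vol0: "0 \<le> vol" by (simp add: vol_def)
  have L1: "integrable ?L u" "(LINT x|?L. \<bar>u x\<bar>) \<le> \<epsilon> * vol + L2_inner \<Omega> u u / \<epsilon>"
    if "u \<in> X0" "\<epsilon> > 0" for u \<epsilon>
    using integrable_if_square_integrable[OF X0_measurable[OF that(1)], of \<epsilon>]
      integral_abs_le_square[OF X0_measurable[OF that(1)], of \<epsilon>] that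
    unfolding X0_iff vol_def L2_inner_def by (simp_all add: power2_eq_square)
  have "\<exists>N. \<forall>i\<ge>N. \<forall>j\<ge>N. (LINT x|?L. norm (f i x - f j x)) < e" if e: "e > 0" for e
  proof -
    define \<epsilon> where "\<epsilon> = e / (2 * (vol + 1))"
    have \<epsilon>: "\<epsilon> > 0" using e vol0 by (simp add: \<epsilon>_def)
    have half: "\<epsilon> * vol \<le> e / 2"
    proof -
      have "\<epsilon> * vol \<le> \<epsilon> * (vol + 1)" using \<epsilon> by simp
      also have "\<dots> = e / 2" using vol0 by (simp add: \<epsilon>_def field_simps)
      finally show ?thesis .
    qed
    from cauchy[of "\<epsilon> * e / 2"] \<epsilon> e obtain N where
      N: "\<And>i j. i \<ge> N \<Longrightarrow> j \<ge> N \<Longrightarrow> L2_inner \<Omega> (f i - f j) (f i - f j) < \<epsilon> * e / 2" by auto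
    have "(LINT x|?L. norm (f i x - f j x)) < e" if "i \<ge> N" "j \<ge> N" for i j
    proof -
      have "(LINT x|?L. \<bar>(f i - f j) x\<bar>) \<le> \<epsilon> * vol + L2_inner \<Omega> (f i - f j) (f i - f j) / \<epsilon>"
        by (rule L1(2)[OF I.V_diff[OF f f] \<epsilon>])
      also have "\<dots> < e / 2 + e / 2"
      proof (rule add_le_less_mono[OF half])
        show "L2_inner \<Omega> (f i - f j) (f i - f j) / \<epsilon> < e / 2"
          using N[OF that] \<epsilon> by (simp add: field_simps)
      qed
      finally show ?thesis by simp
    qed
    then show ?thesis by blast
  qed
  from cauchy_L1_AE_cauchy_subseq[OF L1(1)[OF f zero_less_one] this]
  obtain r where r: "strict_mono r" and ae: "AE x in ?L. Cauchy (\<lambda>i. f (r i) x)" by blast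
  define v where "v x = (if x \<in> \<Omega> then lim (\<lambda>i. f (r i) x) else 0)" for x
  have fm: "f n \<in> borel_measurable lebesgue" for n using f by (simp add: X0_iff)
  have vm: "v \<in> borel_measurable lebesgue"
    unfolding v_def[abs_def] using fm by measurable
  have "AE x in lebesgue. x \<in> \<Omega> \<longrightarrow> Cauchy (\<lambda>i. f (r i) x)"
    using ae by (subst (asm) AE_restrict_space_iff) auto
  moreover have "AE x in lebesgue. \<forall>n. x \<notin> \<Omega> \<longrightarrow> f n x = 0"
    using f by (subst AE_all_countable) (simp add: X0_iff)
  ultimately have conv: "AE x in lebesgue. (\<lambda>i. f (r i) x) \<longlonglongrightarrow> v x"
  proof eventually_elim
    case (elim x)
    then show ?case
      by (cases "x \<in> \<Omega>") (auto simp: v_def Cauchy_convergent_iff convergent_LIMSEQ_iff)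
  qed
  then have conv_\<Omega>: "AE x in ?L. (\<lambda>i. f (r i) x) \<longlonglongrightarrow> v x"
    by (subst AE_restrict_space_iff) auto
  have conv_D: "AE p in LQ. (\<lambda>i. D (f (r i)) p) \<longlonglongrightarrow> D v p"
  proof -
    have "AE p in lebesgue. (\<lambda>i. D (f (r i)) p) \<longlonglongrightarrow> D v p"
      using lebesgue_pullback_fst(2)[OF conv] lebesgue_pullback_snd(2)[OF conv]
    proof eventually_elim
      case (elim p)
      then show ?case unfolding D_def by (intro tendsto_intros)
    qed
    then show ?thesis by (subst AE_restrict_space_iff) auto
  qed
  have v: "v \<in> X0"
  proof -
    have "integrable LQ (\<lambda>p. (D v p)\<^sup>2)"
    proof (rule fatou_square(1)[OF _ _ _ _ conv_D])
      show "(LINT p|LQ. (D (f (r n)) p)\<^sup>2) \<le> C" for n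
        using C[of "r n"] by (simp add: X0_inner_eq power2_eq_square)
      show "integrable LQ (\<lambda>p. (D (f (r n)) p)\<^sup>2)" for n using f[of "r n"] by (simp add: X0_iff)
    qed (rule D_measurable(2)[OF fm] D_measurable(2)[OF vm])+
    moreover have "integrable ?L (\<lambda>x. (v x)\<^sup>2)"
    proof -
      obtain N where N: "\<And>m n. m \<ge> N \<Longrightarrow> n \<ge> N \<Longrightarrow> L2_inner \<Omega> (f m - f n) (f m - f n) < 1"
        using cauchy[of 1] by auto
      have "L2_inner \<Omega> (f n) (f n) \<le> 2 * 1 + 2 * L2_inner \<Omega> (f N) (f N)" if "n \<ge> N" for n
      proof -
        have "L2_inner \<Omega> ((f n - f N) + f N) ((f n - f N) + f N)
            \<le> 2 * L2_inner \<Omega> (f n - f N) (f n - f N) + 2 * L2_inner \<Omega> (f N) (f N)"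
          using I.square_diff_le[of "f n - f N" "- f N"] f by (simp add: I.minus_left I.minus_right)
        then show ?thesis using N[OF that order_refl] by simp
      qed
      then have b: "(LINT x|?L. (f (r (n + N)) x)\<^sup>2) \<le> 2 * 1 + 2 * L2_inner \<Omega> (f N) (f N)" for n
        using seq_suble[OF r, of "n + N"] by (simp add: L2_inner_def power2_eq_square)
      have l: "AE x in ?L. (\<lambda>n. f (r (n + N)) x) \<longlonglongrightarrow> v x"
        using conv_\<Omega> by eventually_elim (rule LIMSEQ_ignore_initial_segment)
      have i: "integrable ?L (\<lambda>x. (f n x)\<^sup>2)" for n using f by (simp add: X0_iff)
      show ?thesis
        by (rule fatou_square(1)[OF X0_measurable[OF f] measurable_restrict_space1[OF vm] i b l])
    qed
    ultimately show ?thesis using vm by (simp add: X0_iff v_def)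
  qed
  have "(\<lambda>n. L2_inner \<Omega> (f n - v) (f n - v)) \<longlonglongrightarrow> 0"
  proof (rule LIMSEQ_I)
    fix \<epsilon> :: real assume \<epsilon>: "\<epsilon> > 0"
    then obtain N where
      N: "\<And>m n. m \<ge> N \<Longrightarrow> n \<ge> N \<Longrightarrow> L2_inner \<Omega> (f m - f n) (f m - f n) < \<epsilon> / 2"
      using cauchy[of "\<epsilon> / 2"] by auto
    have "L2_inner \<Omega> (f n - v) (f n - v) \<le> \<epsilon> / 2" if n: "n \<ge> N" for n
    proof -
      have b: "(LINT x|?L. ((f n - f (r (i + N))) x)\<^sup>2) \<le> \<epsilon> / 2" for i
        using N[OF n, of "r (i + N)"] seq_suble[OF r, of "i + N"]
        by (simp add: L2_inner_def power2_eq_square)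
      have l: "AE x in ?L. (\<lambda>i. (f n - f (r (i + N))) x) \<longlonglongrightarrow> (f n - v) x"
        using conv_\<Omega>
      proof eventually_elim
        case (elim x)
        then have "(\<lambda>i. f (r (i + N)) x) \<longlonglongrightarrow> v x" by (rule LIMSEQ_ignore_initial_segment)
        then show ?case by (simp add: tendsto_diff)
      qed
      have mem: "f n - f (r (i + N)) \<in> X0" "f n - v \<in> X0" for i using f v by auto
      have "(LINT x|?L. ((f n - v) x)\<^sup>2) \<le> \<epsilon> / 2"
        by (rule fatou_square(2)[OF X0_measurable[OF mem(1)] X0_measurable[OF mem(2)] _ b l])
          (use mem(1) in \<open>simp add: X0_iff\<close>)
      then show ?thesis by (simp add: L2_inner_def power2_eq_square)
    qed
    then show "\<exists>N. \<forall>n\<ge>N. norm (L2_inner \<Omega> (f n - v) (f n - v) - 0) < \<epsilon>"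
      using \<epsilon> I.nonneg[of "f _ - v"] f v
      by (intro exI[of _ N]) (auto intro: le_less_trans[of _ "\<epsilon> / 2"])
  qed
  with v show ?thesis by blast
qed

end

section \<open>Unboundedness of the Rayleigh quotient\<close>

context nonlocal_setting
begin

definition bump :: "real ^ 'n \<Rightarrow> real \<Rightarrow> real ^ 'n \<Rightarrow> real" where
  "bump a r x = max 0 (r - dist x a)"

lemma bump_lipschitz: "\<bar>bump a r x - bump a r y\<bar> \<le> norm (x - y)"
proof -
  have "\<bar>dist x a - dist y a\<bar> \<le> dist x y" 
    using dist_triangle[of x a y] dist_triangle[of y a x] by (simp add: dist_commute abs_le_iff)
  then show ?thesis by (auto simp: bump_def dist_norm max_def)
qed

lemma bump_bounds: "0 \<le> r \<Longrightarrow> 0 \<le> bump a r x \<and> bump a r x \<le> r"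
  by (simp add: bump_def)

lemma bump_outside: "x \<notin> ball a r \<Longrightarrow> bump a r x = 0"
  by (simp add: bump_def dist_commute)

lemma bump_measurable: "bump a r \<in> borel_measurable lebesgue"
proof -
  have "bump a r \<in> borel_measurable borel"
    unfolding bump_def[abs_def] by (intro borel_measurable_continuous_onI continuous_intros)
  then show ?thesis by (simp add: measurable_completion)
qed

text \<open>
The squared increment of the bump is at most \<open>min |x - y|\<^sup>2 1\<close> and vanishes unless \<open>x\<close> or \<open>y\<close>
lies in the ball; so the energy is controlled by the integral of \<open>min |z|\<^sup>2 1 * K z\<close>.
\<close>

lemma bump_X0:
  assumes r: "0 < r" "r \<le> 1" and sub: "ball a r \<subseteq> \<Omega>"
  shows "bump a r \<in> X0"
proof -
  let ?b = "bump a r" and ?B = "ball a r"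
  let ?H = "\<lambda>x. min ((norm x)\<^sup>2) 1 * K x"
  have fin: "emeasure lborel ?B < \<infinity>" by (rule emeasure_lborel_ball_finite)
  have "integrable lebesgue (\<lambda>p. indicator ?B (fst p) * ?H (fst p - snd p)
      + indicator ?B (snd p) * ?H (fst p - snd p))"
    by (intro Bochner_Integration.integrable_add integrable_strip K_integrable fin) simp_all
  then have G: "integrable LQ (\<lambda>p. indicator ?B (fst p) * ?H (fst p - snd p)
      + indicator ?B (snd p) * ?H (fst p - snd p))" (is "integrable LQ ?G")
    by (rule integrable_lebesgue_on[OF Q_sets])
  have "(D ?b p)\<^sup>2 \<le> ?G p" for p
  proof -
    obtain x y where p: "p = (x, y)" by fastforce
    show ?thesis
    proof (cases "x = y")
      case True then show ?thesis by (simp add: p D_def)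
    next
      case False
      then have K: "0 < K (x - y)" by (intro K_pos) simp
      have "(?b x - ?b y)\<^sup>2 \<le> (indicator ?B x + indicator ?B y) * min ((norm (x - y))\<^sup>2) 1"
      proof (cases "x \<in> ?B \<or> y \<in> ?B")
        case False
        then show ?thesis by (simp add: bump_outside)
      next
        case True
        have "\<bar>?b x - ?b y\<bar> \<le> 1"
          using bump_bounds[of r a x] bump_bounds[of r a y] r by (simp add: abs_le_iff)
        then have "(?b x - ?b y)\<^sup>2 \<le> min ((norm (x - y))\<^sup>2) 1"
          using bump_lipschitz[of a r x y] by (simp add: abs_le_square_iff[symmetric] abs_square_le_1)
        also have "1 * min ((norm (x - y))\<^sup>2) 1
            \<le> (indicator ?B x + indicator ?B y) * min ((norm (x - y))\<^sup>2) 1"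
          using True by (intro mult_right_mono) (auto simp: indicator_def)
        finally show ?thesis by simp
      qed
      then have "(?b x - ?b y)\<^sup>2 * K (x - y)
          \<le> (indicator ?B x + indicator ?B y) * min ((norm (x - y))\<^sup>2) 1 * K (x - y)"
        using K by (intro mult_right_mono) auto
      then show ?thesis unfolding p D_square by (simp add: algebra_simps)
    qed
  qed
  then have le: "AE p in LQ. norm ((D ?b p)\<^sup>2) \<le> norm (?G p)"
    by (intro always_eventually allI) (simp add: order_trans[OF _ abs_ge_self])
  have m: "(\<lambda>p. (D ?b p)\<^sup>2) \<in> borel_measurable LQ"
    using D_measurable(2)[OF bump_measurable] by simp
  have 1: "integrable LQ (\<lambda>p. (D ?b p)\<^sup>2)"
    by (rule Bochner_Integration.integrable_bound[OF G m le])
  interpret finite_measure "lebesgue_on \<Omega>" by (rule finite_\<Omega>)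
  have 2: "integrable (lebesgue_on \<Omega>) (\<lambda>x. (?b x)\<^sup>2)"
  proof (rule integrable_const_bound[where B = "r\<^sup>2"])
    show "AE x in lebesgue_on \<Omega>. norm ((?b x)\<^sup>2) \<le> r\<^sup>2"
      using bump_bounds[of r a] r by (simp add: power_mono)
    show "(\<lambda>x. (?b x)\<^sup>2) \<in> borel_measurable (lebesgue_on \<Omega>)"
      using measurable_restrict_space1[OF bump_measurable] by simp
  qed
  have "?b x = 0" if "x \<notin> \<Omega>" for x using that sub by (intro bump_outside) auto
  then show ?thesis unfolding X0_iff using 1 2 bump_measurable by simp
qed

lemma bump_L2_le:
  assumes r: "0 < r" and sub: "ball a r \<subseteq> \<Omega>"
  shows "L2_inner \<Omega> (bump a r) (bump a r) \<le> r\<^sup>2 * measure lebesgue (ball a r)"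
proof -
  interpret finite_measure "lebesgue_on \<Omega>" by (rule finite_\<Omega>)
  have i: "integrable (lebesgue_on \<Omega>) (\<lambda>x. r\<^sup>2 * indicator (ball a r) x)"
  proof (rule integrable_lebesgue_on[OF \<Omega>_sets])
    have "integrable lebesgue (indicat_real (ball a r))"
      using lmeasurable_iff_integrable lmeasurable_ball by blast
    then show "integrable lebesgue (\<lambda>x. r\<^sup>2 * indicator (ball a r) x)"
      by (rule integrable_mult_right)
  qed
  have "L2_inner \<Omega> (bump a r) (bump a r) \<le> (LINT x|lebesgue_on \<Omega>. r\<^sup>2 * indicator (ball a r) x)"
    unfolding L2_inner_def
  proof (rule integral_mono')
    show "integrable (lebesgue_on \<Omega>) (\<lambda>x. r\<^sup>2 * indicator (ball a r) x)" by (rule i)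
    show "bump a r x * bump a r x \<le> r\<^sup>2 * indicator (ball a r) x" for x
      using bump_bounds[of r a x] r bump_outside[of x a r]
      by (cases "x \<in> ball a r") (auto simp: power2_eq_square intro: mult_mono)
  qed (simp add: bump_def)
  also have "\<dots> = r\<^sup>2 * measure (lebesgue_on \<Omega>) (ball a r)"
    using sub by (simp add: Int_absorb2)
  also have "measure (lebesgue_on \<Omega>) (ball a r) = measure lebesgue (ball a r)"
    using sub by (intro measure_restrict_space) auto
  finally show ?thesis .
qed

lemma bump_L2_nonneg: "0 \<le> L2_inner \<Omega> (bump a r) (bump a r)"
  by (simp add: L2_inner_def)

text \<open>
Only pairs in a product of two balls of radius \<open>r / 2\<close> are counted: \<open>x\<close> near the centre, where
the bump is at least \<open>r / 2\<close>, and \<open>y\<close> near a point at distance \<open>3 * r / 2\<close> from the centre,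
where it is 0. There \<open>|x - y| \<le> 3 * r\<close>, which bounds the kernel from below.
\<close>

lemma bump_energy_ge:
  assumes r: "0 < r" "r \<le> 1" and sub: "ball a r \<subseteq> \<Omega>"
    and \<theta>: "0 < \<theta>" "\<And>z. z \<noteq> 0 \<Longrightarrow> \<theta> * norm z powr (- (real CARD('n) + 2 * s)) \<le> K z"
  shows "r\<^sup>2 / 4 * (\<theta> * (3 * r) powr (- (real CARD('n) + 2 * s)))
      * (unit_ball_vol (real CARD('n)) * (r / 2) ^ CARD('n))\<^sup>2
    \<le> X0_inner K \<Omega> (bump a r) (bump a r)"
proof -
  obtain e :: "real ^ 'n" where e: "norm e = 1" using vector_choose_size[of 1] by auto
  define b where "b = a + (3 * r / 2) *\<^sub>R e"
  define S where "S = ball a (r / 2) \<times> ball b (r / 2)"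
  define c where "c = r\<^sup>2 / 4 * (\<theta> * (3 * r) powr (- (real CARD('n) + 2 * s)))"
  have c0: "0 \<le> c" unfolding c_def using \<theta>(1) by simp
  have S: "S \<in> lmeasurable" "S \<subseteq> Q_set \<Omega>"
  proof -
    have "ball a (r / 2) \<subseteq> \<Omega>" using sub subset_ball[of "r / 2" r a] r by auto
    then show "S \<subseteq> Q_set \<Omega>" by (auto simp: S_def Q_set_def)
    show "S \<in> lmeasurable" unfolding S_def by (rule measure_lebesgue_times_balls)
  qed
  have mS: "measure lebesgue S = (unit_ball_vol (real CARD('n)) * (r / 2) ^ CARD('n))\<^sup>2"
    unfolding S_def measure_lebesgue_times_balls(2) using r
    by (simp add: content_ball power2_eq_square)
  have le: "c * indicator S p \<le> (D (bump a r) p)\<^sup>2" for p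
  proof (cases "p \<in> S")
    case True
    obtain x y where p: "p = (x, y)" by fastforce
    have x: "dist x a < r / 2" and y: "dist y b < r / 2"
      using True by (simp_all add: p S_def dist_commute)
    have ab: "dist b a = 3 * r / 2" using r by (simp add: b_def dist_norm e)
    have ya: "r < dist y a" "dist y a < 2 * r"
      using dist_triangle[of b a y] dist_triangle[of y a b] y ab by (simp_all add: dist_commute)
    have "r / 2 \<le> bump a r x" using x by (auto simp: bump_def max_def)
    moreover have "bump a r y = 0" using ya by (simp add: bump_def)
    ultimately have "(r / 2)\<^sup>2 \<le> (bump a r x - bump a r y)\<^sup>2" using r by (intro power_mono) auto
    then have 1: "r\<^sup>2 / 4 \<le> (bump a r x - bump a r y)\<^sup>2" by (simp add: power_divide)
    have xy: "x \<noteq> y" using x ya r by auto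
    have "norm (x - y) \<le> 3 * r"
      using dist_triangle[of x y a] x ya r by (simp add: dist_norm[symmetric] dist_commute)
    then have "(3 * r) powr (- (real CARD('n) + 2 * s)) \<le> norm (x - y) powr (- (real CARD('n) + 2 * s))"
      using xy s r by (intro powr_mono2') auto
    then have "\<theta> * (3 * r) powr (- (real CARD('n) + 2 * s))
        \<le> \<theta> * norm (x - y) powr (- (real CARD('n) + 2 * s))"
      using \<theta>(1) by (intro mult_left_mono) simp_all
    also have "\<dots> \<le> K (x - y)" using \<theta>(2)[of "x - y"] xy by simp
    finally have "c \<le> (bump a r x - bump a r y)\<^sup>2 * K (x - y)"
      unfolding c_def using 1 \<theta>(1) by (intro mult_mono) auto
    then show ?thesis using True by (simp add: p D_square)
  qed simp
  have "c * measure lebesgue S = (LINT p|LQ. c * indicator S p)"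
    using S by (simp add: Int_absorb2 measure_restrict_space)
  also have "\<dots> \<le> (LINT p|LQ. (D (bump a r) p)\<^sup>2)"
  proof (rule integral_mono[OF _ _ le])
    have "integrable lebesgue (indicat_real S)"
      using S lmeasurable_iff_integrable by blast
    then show "integrable LQ (\<lambda>p. c * indicator S p)"
      by (intro integrable_lebesgue_on Q_sets integrable_mult_right)
    show "integrable LQ (\<lambda>p. (D (bump a r) p)\<^sup>2)"
      using bump_X0[OF r sub] by (simp add: X0_iff)
  qed
  finally show ?thesis by (simp add: mS c_def X0_inner_eq power2_eq_square)
qed

text \<open>
For bumps of radius \<open>r\<close> the squared \<open>L\<^sup>2\<close> norm is at most of order \<open>r ^ (d + 2)\<close> and the energy
at least of order \<open>r ^ (d + 2) * r powr (- 2 * s)\<close>, so the quotient grows like \<open>r powr (- 2 *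
s)\<close> as \<open>r \<rightarrow> 0\<close>.
\<close>

lemma rayleigh_quotient_unbounded: "\<exists>u\<in>X0. C * L2_inner \<Omega> u u < X0_inner K \<Omega> u u"
proof -
  define d where "d = CARD('n)"
  obtain \<theta> where \<theta>: "0 < \<theta>" "\<And>z. z \<noteq> 0 \<Longrightarrow> \<theta> * norm z powr (- (real d + 2 * s)) \<le> K z"
    using kernel unfolding admissible_kernel_def d_def by blast
  obtain a r0 where a: "0 < r0" "ball a r0 \<subseteq> \<Omega>"
    using open_\<Omega> \<Omega>_nonempty by (metis open_contains_ball ex_in_conv)
  define v where "v = unit_ball_vol (real d)"
  have v: "0 < v" by (simp add: v_def)
  define A where "A = \<theta> * v / (4 * 4 ^ d) * 3 powr (- (real d + 2 * s))"
  have A: "0 < A" using \<theta>(1) v by (simp add: A_def)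
  \<comment> \<open>Chosen so that \<open>A * q powr (- (2 * s)) = |C| + 1\<close>, where \<open>A\<close> is the constant in the lower bound of the quotient.\<close>
  define q where "q = (A / (\<bar>C\<bar> + 1)) powr (1 / (2 * s))"
  have q: "0 < q" using A by (simp add: q_def)
  define r where "r = min (min 1 r0) q"
  have r: "0 < r" "r \<le> 1" "r \<le> r0" "r \<le> q" using a q by (simp_all add: r_def)
  have sub: "ball a r \<subseteq> \<Omega>" using a r by (auto intro: order_less_le_trans)
  have "r powr (2 * s) \<le> q powr (2 * s)" using r s by (intro powr_mono2) auto
  also have "\<dots> = A / (\<bar>C\<bar> + 1)" using A s by (simp add: q_def powr_powr)
  finally have "r powr (2 * s) * (\<bar>C\<bar> + 1) \<le> A" by (simp add: field_simps)
  then have C: "\<bar>C\<bar> + 1 \<le> A * r powr (- (2 * s))"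
    using r by (simp add: powr_minus field_simps)
  have r2: "0 < r\<^sup>2 * (v * r ^ d)" using r v by simp
  have "C * L2_inner \<Omega> (bump a r) (bump a r) < X0_inner K \<Omega> (bump a r) (bump a r)"
  proof -
    have "C * L2_inner \<Omega> (bump a r) (bump a r) \<le> \<bar>C\<bar> * L2_inner \<Omega> (bump a r) (bump a r)"
      using bump_L2_nonneg by (intro mult_right_mono) auto
    also have "\<dots> \<le> \<bar>C\<bar> * (r\<^sup>2 * (v * r ^ d))"
      using bump_L2_le[OF r(1) sub] r by (intro mult_left_mono) (simp_all add: content_ball v_def d_def)
    also have "\<dots> < (A * r powr (- (2 * s))) * (r\<^sup>2 * (v * r ^ d))"
      using C r2 by (intro mult_strict_right_mono) auto
    also have "\<dots> = r\<^sup>2 / 4 * (\<theta> * (3 * r) powr (- (real d + 2 * s))) * (v * (r / 2) ^ d)\<^sup>2"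
    proof -
      have "(3 * r) powr (- (real d + 2 * s))
          = 3 powr (- (real d + 2 * s)) * r powr (- real d + - (2 * s))"
        using r by (simp add: powr_mult)
      also have "r powr (- real d + - (2 * s)) = r powr (- real d) * r powr (- (2 * s))"
        by (rule powr_add)
      also have "r powr (- real d) = 1 / r ^ d"
        using r by (simp add: powr_minus powr_realpow divide_inverse)
      finally have "(3 * r) powr (- (real d + 2 * s))
          = 3 powr (- (real d + 2 * s)) * (1 / r ^ d * r powr (- (2 * s)))" .
      moreover have "(v * (r / 2) ^ d)\<^sup>2 = v * v * (r ^ d * r ^ d / 4 ^ d)"
        by (simp add: power_divide power2_eq_square power_mult_distrib[symmetric])
      ultimately show ?thesis
        using r by (simp only: A_def) (simp add: field_simps)
    qed
    also have "\<dots> \<le> X0_inner K \<Omega> (bump a r) (bump a r)"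
      using bump_energy_ge[OF r(1,2) sub \<theta>(1)] \<theta>(2) by (simp add: d_def v_def)
    finally show ?thesis .
  qed
  then show ?thesis using bump_X0[OF r(1,2) sub] by blast
qed

end

section \<open>The alternative for the nonlocal operator\<close>

lemma sum_scaleR_fun_eq: "(\<Sum>j\<in>A. c j *\<^sub>R f j) = (\<lambda>x. \<Sum>j\<in>A. c j * f j x)"
  for f :: "'i \<Rightarrow> 'a \<Rightarrow> real"
  by (simp add: fun_eq_iff sum_fun_apply)

lemma orthogonal_basis_dense:
  assumes "orthogonal_basis ip V \<phi>" and u: "u \<in> V" and \<epsilon>: "0 < (\<epsilon> :: real)"
  shows "\<exists>N c. ip (u - (\<Sum>j=1..N. c j *\<^sub>R \<phi> j)) (u - (\<Sum>j=1..N. c j *\<^sub>R \<phi> j)) < \<epsilon>"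
proof -
  have "\<forall>u\<in>V. \<forall>\<epsilon>>0. \<exists>N c. sqrt (ip (\<lambda>x. u x - (\<Sum>j=1..N. c j * \<phi> j x))
      (\<lambda>x. u x - (\<Sum>j=1..N. c j * \<phi> j x))) < \<epsilon>"
    using assms(1) unfolding orthogonal_basis_def Let_def by (elim conjE)
  moreover have "0 < sqrt \<epsilon>" using \<epsilon> by simp
  ultimately show ?thesis
    unfolding sum_scaleR_fun_eq fun_diff_def real_sqrt_less_iff[symmetric, of _ \<epsilon>] using u by blast
qed

locale fucik_setting = nonlocal_setting K \<Omega> s
  for K :: "real ^ 'n \<Rightarrow> real" and \<Omega> and s +
  fixes \<Lambda> :: "nat \<Rightarrow> real" and \<phi> :: "nat \<Rightarrow> real ^ 'n \<Rightarrow> real" and k :: nat and \<alpha> :: real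
  assumes eig: "eigensystem K \<Omega> \<Lambda> \<phi>"
    and k: "1 \<le> k" and gap: "\<Lambda> k < \<alpha>" "\<alpha> < \<Lambda> (k + 1)"
begin

lemma eigenbasis_X0: "eigenbasis X0 (X0_inner K \<Omega>) (L2_inner \<Omega>) \<Lambda> \<phi>"
proof -
  interpret E: semi_inner X0 "X0_inner K \<Omega>" by (rule semi_inner_E)
  interpret I: semi_inner X0 "L2_inner \<Omega>" by (rule semi_inner_I)
  have weak: "\<And>j. 1 \<le> j \<Longrightarrow> weak_solution K \<Omega> (\<lambda>x. \<Lambda> j * \<phi> j x) (\<phi> j)"
    and L2: "orthonormal_basis (L2_inner \<Omega>) (L2_on \<Omega>) \<phi>"
    and X: "orthogonal_basis (X0_inner K \<Omega>) X0 \<phi>"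
    and \<Lambda>: "0 < \<Lambda> 1" "\<Lambda> 1 < \<Lambda> 2" "\<And>j. 2 \<le> j \<Longrightarrow> \<Lambda> j \<le> \<Lambda> (Suc j)"
    using eig by (simp_all add: eigensystem_def)
  show ?thesis
  proof
    show \<phi>: "\<phi> j \<in> X0" if "1 \<le> j" for j using weak[OF that] by (simp add: weak_solution_def)
    show "X0_inner K \<Omega> (\<phi> j) u = \<Lambda> j * L2_inner \<Omega> (\<phi> j) u" if "1 \<le> j" "u \<in> X0" for j u
      using weak[OF that(1)] that(2)
      by (simp add: weak_solution_def X0_inner_def L2_inner_def mult.assoc)
    show "L2_inner \<Omega> (\<phi> i) (\<phi> j) = (if i = j then 1 else 0)" if "1 \<le> i" "1 \<le> j" for i j
      using L2 that by (simp add: orthonormal_basis_def orthogonal_basis_def)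
    show "\<exists>N c. L2_inner \<Omega> (u - (\<Sum>j=1..N. c j *\<^sub>R \<phi> j)) (u - (\<Sum>j=1..N. c j *\<^sub>R \<phi> j)) < \<epsilon>"
      if "u \<in> X0" "0 < \<epsilon>" for u and \<epsilon> :: real
    proof -
      have "orthogonal_basis (L2_inner \<Omega>) (L2_on \<Omega>) \<phi>"
        using L2 by (simp add: orthonormal_basis_def)
      moreover have "u \<in> L2_on \<Omega>" using that(1) by (simp add: X0_space_def X_space_def)
      ultimately show ?thesis using that(2) by (rule orthogonal_basis_dense)
    qed
    show "\<exists>N c. X0_inner K \<Omega> (u - (\<Sum>j=1..N. c j *\<^sub>R \<phi> j)) (u - (\<Sum>j=1..N. c j *\<^sub>R \<phi> j)) < \<epsilon>"
      if "u \<in> X0" "0 < \<epsilon>" for u and \<epsilon> :: real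
      using X that by (rule orthogonal_basis_dense)
    show "0 < \<Lambda> 1" by (rule \<Lambda>(1))
    have Suc_mono: "\<Lambda> j \<le> \<Lambda> (Suc j)" if "1 \<le> j" for j
      using \<Lambda>(2) \<Lambda>(3)[of j] that by (cases "j = 1") (auto simp: numeral_2_eq_2)
    show "\<Lambda> i \<le> \<Lambda> j" if "1 \<le> i" "i \<le> j" for i j
      using that(2)
    proof (induction j rule: dec_induct)
      case (step n)
      then show ?case using \<open>1 \<le> i\<close> Suc_mono[of n] by linarith
    qed simp
  qed
qed

sublocale fucik_gap X0 "X0_inner K \<Omega>" "L2_inner \<Omega>" \<Lambda> \<phi> pos_part k \<alpha>
proof -
  interpret eigenbasis X0 "X0_inner K \<Omega>" "L2_inner \<Omega>" \<Lambda> \<phi> by (rule eigenbasis_X0)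
  show "fucik_gap X0 (X0_inner K \<Omega>) (L2_inner \<Omega>) \<Lambda> \<phi> pos_part k \<alpha>"
  proof
    show "\<exists>j\<ge>1. C < \<Lambda> j" for C
    proof (rule ccontr)
      assume "\<not> (\<exists>j\<ge>1. C < \<Lambda> j)"
      then have "\<Lambda> j \<le> C" if "1 \<le> j" for j using that by (auto simp: not_less)
      then show False
        using rayleigh_quotient_unbounded[of C] rayleigh_upper[of _ C] by (auto simp: not_le[symmetric])
    qed
    show "\<exists>v\<in>X0. (\<lambda>n. L2_inner \<Omega> (f n - v) (f n - v)) \<longlonglongrightarrow> 0"
      if "\<And>n. f n \<in> X0" "\<And>n. X0_inner K \<Omega> (f n) (f n) \<le> C"
        "\<And>\<epsilon>. \<epsilon> > 0 \<Longrightarrow> \<exists>N. \<forall>m\<ge>N. \<forall>n\<ge>N. L2_inner \<Omega> (f m - f n) (f m - f n) < \<epsilon>" for f C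
      using that by (rule X0_closed)
    show "pos_part u \<in> X0" if "u \<in> X0" for u using that by (rule pos_part_X0)
    show "pos_part u - pos_part (- u) = u" for u :: "real ^ 'n \<Rightarrow> real"
      by (auto simp: fun_eq_iff pos_part_def)
    show "pos_part (t *\<^sub>R u) = t *\<^sub>R pos_part u" if "0 < t" for u :: "real ^ 'n \<Rightarrow> real" and t
      using that by (auto simp: fun_eq_iff pos_part_def max_def mult_le_0_iff zero_le_mult_iff)
    show "L2_inner \<Omega> (pos_part u) (pos_part (- u)) = 0" for u
    proof -
      have "(\<lambda>x. pos_part u x * pos_part (- u) x) = (\<lambda>_. 0)"
        by (simp add: fun_eq_iff pos_part_def max_def)
      then show ?thesis by (simp only: L2_inner_def Bochner_Integration.integral_zero)
    qed
    show "0 \<le> L2_inner \<Omega> (pos_part u) (pos_part v)" for u v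
      by (simp add: L2_inner_def pos_part_def)
    show "L2_inner \<Omega> (pos_part u) (pos_part u) = 0 \<or> L2_inner \<Omega> (pos_part v) (pos_part v) = 0"
      if "u \<in> X0" "v \<in> X0" "L2_inner \<Omega> (pos_part u) (pos_part v) = 0"
        "0 \<le> X0_inner K \<Omega> (pos_part u) (pos_part v)" for u v
      using that by (intro disjoint_nonneg_form pos_part_X0) (simp_all add: pos_part_def)
  qed (use k gap in auto)
qed

lemma neg_part_eq: "neg_part u = pos_part (- u)"
  by (simp add: fun_eq_iff neg_part_def pos_part_def)

lemma X1_space_eq: "X1_space \<phi> k = X1"
  unfolding X1_space_def X1_def comb_def sum_scaleR_fun_eq by auto

text \<open>
Orthogonality to \<open>\<phi> j\<close> in the energy and in \<open>L\<^sup>2\<close> are the same condition, as \<open>\<Lambda> j \<noteq> 0\<close>.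
\<close>

lemma X2_space_eq: "X2_space K \<Omega> \<phi> k = X2"
proof (intro set_eqI iffI)
  fix v assume "v \<in> X2"
  then show "v \<in> X2_space K \<Omega> \<phi> k"
    using X1_X2_orthogonal X2_V by (auto simp: X2_space_def X1_space_eq)
next
  fix v assume v: "v \<in> X2_space K \<Omega> \<phi> k"
  then have vX: "v \<in> X0" and orth: "\<And>u. u \<in> X1 \<Longrightarrow> X0_inner K \<Omega> u v = 0"
    by (simp_all add: X2_space_def X1_space_eq)
  show "v \<in> X2"
  proof (rule X2I[OF vX])
    fix j assume j: "1 \<le> j" "j \<le> k"
    have "comb k (\<lambda>i. if i = j then 1 else 0) = \<phi> j"
      using j by (simp add: comb_def if_distrib[of "\<lambda>c. c *\<^sub>R _"] cong: if_cong)
    then have "\<phi> j \<in> X1" unfolding X1_def by (metis rangeI)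
    then have "\<Lambda> j * coef j v = 0" using orth eigen[OF j(1) vX] by (simp add: coef_def)
    then show "coef j v = 0" using \<Lambda>_pos'[OF j(1)] by simp
  qed
qed

lemma J_functional_eq: "u \<in> X0 \<Longrightarrow> J_functional K \<Omega> \<alpha> \<beta> u = J \<alpha> \<beta> u"
proof -
  assume u: "u \<in> X0"
  have "(LINT (x, y)|LQ. \<bar>u x - u y\<bar>\<^sup>2 * K (x - y)) = X0_inner K \<Omega> u u"
    by (simp add: X0_inner_def power2_eq_square)
  then have "(X0_norm K \<Omega> u)\<^sup>2 = X0_inner K \<Omega> u u"
    using E.nonneg[OF u] by (simp add: X0_norm_def)
  then show ?thesis
    by (simp add: J_functional_def J_def L2_inner_def neg_part_eq power2_eq_square)
qed

lemma L2_norm_eq_1: "L2_norm \<Omega> v = 1 \<longleftrightarrow> L2_inner \<Omega> v v = 1"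
  by (simp add: L2_norm_def L2_inner_def power2_eq_square)

text \<open>
On \<open>X1 + X2\<close> the concrete functional is the abstract one, so that the sets whose greatest and
least elements are taken coincide.
\<close>

lemma minimax_eq: "minimax K \<Omega> \<phi> k \<alpha> \<beta> = m \<beta>"
proof -
  have J: "J_functional K \<Omega> \<alpha> \<beta> (\<lambda>x. u x + v x) = Jf \<beta> (u + v)" if "u \<in> X1" "v \<in> X2" for u v
    using J_functional_eq[OF E.V_add[OF X1_V[OF that(1)] X2_V[OF that(2)]]]
    by (simp only: plus_fun_def)
  define G where "G v = (GREATEST b. \<exists>u\<in>X1. b = J_functional K \<Omega> \<alpha> \<beta> (\<lambda>x. u x + v x))" for v
  have G: "G v = M \<beta> v" if "v \<in> X2" for v
  proof -
    have "(\<lambda>b. \<exists>u\<in>X1. b = J_functional K \<Omega> \<alpha> \<beta> (\<lambda>x. u x + v x)) = (\<lambda>b. \<exists>u\<in>X1. b = Jf \<beta> (u + v))"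
      using J[OF _ that] by (auto simp: fun_eq_iff)
    then show ?thesis by (simp add: M_def G_def)
  qed
  have "(\<exists>v\<in>X2. L2_norm \<Omega> v = 1 \<and> a = G v) \<longleftrightarrow> (\<exists>v\<in>unit_sphere. a = M \<beta> v)" for a
    unfolding L2_norm_eq_1 by (metis G unit_sphereI unit_sphere_X2 unit_sphere_norm)
  then show ?thesis
    unfolding minimax_def m_def X1_space_eq X2_space_eq G_def[symmetric] by simp
qed

text \<open>
The weak formulation says that the derivative of the functional vanishes in all directions of
\<open>X0\<close>, and nontriviality almost everywhere is positivity of the \<open>L\<^sup>2\<close> norm.
\<close>

lemma fucik_spectrum_eq: "(\<alpha>, \<beta>) \<in> fucik_spectrum K \<Omega> \<longleftrightarrow> fucik \<beta>"
proof -
  have weak: "weak_solution K \<Omega> (\<lambda>x. \<alpha> * pos_part u x - \<beta> * neg_part u x) u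
      \<longleftrightarrow> (\<forall>h\<in>X0. dJf \<beta> u h = 0)" if u: "u \<in> X0" for u
  proof -
    have "(LINT x|lebesgue_on \<Omega>. (\<alpha> * pos_part u x - \<beta> * neg_part u x) * h x)
        = \<alpha> * L2_inner \<Omega> (pos_part u) h - \<beta> * L2_inner \<Omega> (pos_part (- u)) h" if h: "h \<in> X0" for h
      using X0_integrable_mult[OF pos_V[OF u] h] X0_integrable_mult[OF pos_V[OF E.V_minus[OF u]] h]
      by (simp add: L2_inner_def neg_part_eq left_diff_distrib mult.assoc)
    then show ?thesis
      using u by (simp add: weak_solution_def X0_inner_def[symmetric] dJ_def)
  qed
  have "(\<alpha>, \<beta>) \<in> fucik_spectrum K \<Omega> \<longleftrightarrow> (\<exists>u\<in>X0.
      weak_solution K \<Omega> (\<lambda>x. \<alpha> * pos_part u x - \<beta> * neg_part u x) u \<and> \<not> (AE x in lebesgue. u x = 0))"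
    by (auto simp: fucik_spectrum_def weak_solution_def)
  also have "\<dots> \<longleftrightarrow> fucik \<beta>"
    unfolding fucik_def using weak AE_zero_iff by auto
  finally show ?thesis .
qed

end

theorem theorem3p22:
  fixes s \<alpha> :: real
    and \<Omega> :: "(real ^ 'n) set"
    and K :: "real ^ 'n \<Rightarrow> real"
    and \<Lambda> :: "nat \<Rightarrow> real"
    and \<phi> :: "nat \<Rightarrow> real ^ 'n \<Rightarrow> real"
    and k :: nat
  assumes "0 < s" and "s < 1" and "real CARD('n) > 2 * s"
    and "bounded_lipschitz_domain \<Omega>"
    and "admissible_kernel s K"
    and "eigensystem K \<Omega> \<Lambda> \<phi>"
    and "1 \<le> k" and "\<Lambda> k < \<Lambda> (k + 1)"
    and "\<Lambda> k < \<alpha>" and "\<alpha> < \<Lambda> (k + 1)"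
  shows "(\<forall>\<beta>\<ge>\<alpha>. 0 < minimax K \<Omega> \<phi> k \<alpha> \<beta> \<and> (\<alpha>, \<beta>) \<notin> fucik_spectrum K \<Omega>) \<or>
    (\<exists>\<beta>\<^sub>0. \<Lambda> (k + 1) < \<beta>\<^sub>0 \<and> minimax K \<Omega> \<phi> k \<alpha> \<beta>\<^sub>0 = 0 \<and>
       (\<forall>\<beta>. \<Lambda> (k + 1) < \<beta> \<and> minimax K \<Omega> \<phi> k \<alpha> \<beta> = 0 \<longrightarrow> \<beta> = \<beta>\<^sub>0) \<and>
       (\<alpha>, \<beta>\<^sub>0) \<in> fucik_spectrum K \<Omega> \<and>
       (\<forall>\<beta>. \<alpha> \<le> \<beta> \<and> \<beta> < \<beta>\<^sub>0 \<longrightarrow> (\<alpha>, \<beta>) \<notin> fucik_spectrum K \<Omega>))"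
proof -
  interpret fucik_setting K \<Omega> s \<Lambda> \<phi> k \<alpha>
    using assms by unfold_locales
  show ?thesis using fucik_alternative by (simp only: minimax_eq fucik_spectrum_eq)
qed

end
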